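(* Let $k\in\mathbb Z_{>0}$ and $1+\frac1n<p<1+\frac{k+1}{kn}$ (so that $\sigma\in(0,\frac{1}{2k})$). Let $u_0\in L^1_1(\mathbb R^n)\cap L^\infty(\mathbb R^n)$ and let $u$ be the global solution of the convection-diffusion problem with initial datum $u_0$. Then for every $q\in[1,\infty]$ there exists $C>0$ such that for all $t>2^k$, $$t^{\frac n2(1-\frac1q)}\|u(t)-\mathcal A_{0,k}(t)\|_q\le\begin{cases}Ct^{-(k+1)\sigma}&\text{if }(k+1)\sigma<\frac12,\\ Ct^{-\frac12}\log(2+t)&\text{if }(k+1)\sigma=\frac12,\\ Ct^{-\frac12}&\text{if }(k+1)\sigma>\frac12.\end{cases}$$
   Context: Let $n\ge1$, $a=(a_1,\dots,a_n)\in\mathbb R^n\setminus\{0\}$, $p\in(1,\infty)$, and let $f\in C^1(\mathbb R)$, $f\not\equiv0$, $f(0)=0$, satisfy $|f(\xi)-f(\eta)|\le C(|\xi|^{p-1}+|\eta|^{p-1})|\xi-\eta|$ for all $\xi,\eta\in\mathbb R$. $\|\cdot\|_q$ is the $L^q(\mathbb R^n)$ norm; $L^1_1(\mathbb R^n)=\{\varphi\in L^1(\mathbb R^n): x_j\varphi\in L^1 \text{ for } j=1,\dots,n\}$. $G_t(x)=(4\pi t)^{-n/2}e^{-|x|^2/(4t)}$, $e^{t\Delta}\varphi=G_t*\varphi$ for $t>0$, $e^{0\Delta}\varphi=\varphi$. For $u_0\in L^1\cap L^\infty$, the global solution of $\partial_tu-\Delta u=a\cdot\nabla f(u)$, $u(0)=u_0$,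 is the unique $u\in (C\cap L^\infty)([0,\infty);L^1(\mathbb R^n))\cap(C\cap L^\infty)((0,\infty);L^\infty(\mathbb R^n))$ with $u(t)=e^{t\Delta}u_0+\int_0^ta\cdot\nabla e^{(t-s)\Delta}f(u(s))\,ds$ in $L^1\cap L^\infty$ for all $t>0$ (it exists and satisfies $\sup_{q\in[1,\infty]}\sup_{t>0}t^{\frac n2(1-\frac1q)}\|u(t)\|_q\le C\|u_0\|_1$). Dilation: $(\delta_t\varphi)(x)=t^{-n/2}\varphi(t^{-1/2}x)$. $\mathcal M_0(\varphi)=\int_{\mathbb R^n}\varphi\,dx$. $\mathcal A_0(t)=\mathcal M_0(u_0)\delta_tG_1=\mathcal M_0(u_0)G_t$. $\sigma=\frac n2(p-1)-\frac12$. Profiles: $\mathcal A_{0,0}=\mathcal A_0$ and for $k\ge1$, $\mathcal A_{0,k}(t)=\mathcal A_0(t)+\int_0^1a\cdot\nabla e^{(t-s)\Delta}f(\mathcal A_0(s))ds+\int_1^ta\cdot\nabla e^{(t-s)\Delta}f(\mathcal A_{0,k-1}(s))ds$. *)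

theory Defs
  imports "HOL-Analysis.Analysis" "HOL-Probability.Essential_Supremum"
begin

text \<open>Setting: R^n is modelled by an arbitrary euclidean space 'a with n = DIM('a).
 Functions on R^n are real-valued functions 'a => real; equalities in L^q are a.e. w.r.t.
 Lebesgue measure.\<close>

definition Lnorm :: "ereal \<Rightarrow> ('a::euclidean_space \<Rightarrow> real) \<Rightarrow> ereal" where
  "Lnorm q g =
     (if q = \<infinity> then esssup lebesgue (\<lambda>x. ereal \<bar>g x\<bar>)
      else (let I = (\<integral>\<^sup>+ x. ennreal (\<bar>g x\<bar> powr real_of_ereal q) \<partial>lebesgue)
            in if g \<in> borel_measurable lebesgue \<and> I \<noteq> \<infinity>
               then ereal (enn2real I powr (1 / real_of_ereal q)) else \<infinity>))"

definition qinv :: "ereal \<Rightarrow> real" where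
  "qinv q = (if q = \<infinity> then 0 else 1 / real_of_ereal q)"

definition gauss :: "real \<Rightarrow> 'a::euclidean_space \<Rightarrow> real" where
  "gauss t x = (4 * pi * t) powr (- real DIM('a) / 2) * exp (- (norm x)\<^sup>2 / (4 * t))"

definition heat :: "real \<Rightarrow> ('a::euclidean_space \<Rightarrow> real) \<Rightarrow> 'a \<Rightarrow> real" where
  "heat t \<phi> x = (if t = 0 then \<phi> x else (LINT y|lebesgue. gauss t (x - y) * \<phi> y))"

definition dderiv :: "'a::euclidean_space \<Rightarrow> ('a \<Rightarrow> real) \<Rightarrow> 'a \<Rightarrow> real" where
  "dderiv a h x = deriv (\<lambda>\<epsilon>. h (x + \<epsilon> *\<^sub>R a)) 0"

text \<open>Global (mild) solution of u_t - Delta u = a . nabla f(u), u(0) = u0, in the class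
 (C cap L^infty)([0,infty);L^1) cap (C cap L^infty)((0,infty);L^infty), satisfying the
 Duhamel formula (a.e. in x) for every t > 0.\<close>
definition is_global_solution ::
  "'a::euclidean_space \<Rightarrow> (real \<Rightarrow> real) \<Rightarrow> ('a \<Rightarrow> real) \<Rightarrow> (real \<Rightarrow> 'a \<Rightarrow> real) \<Rightarrow> bool" where
  "is_global_solution a f u0 u \<longleftrightarrow>
     (\<forall>t\<ge>0. integrable lebesgue (u t)) \<and>
     (\<forall>t0\<ge>0. ((\<lambda>t. Lnorm 1 (\<lambda>x. u t x - u t0 x)) \<longlongrightarrow> 0) (at t0 within {0..})) \<and>
     (\<exists>M::real. \<forall>t\<ge>0. Lnorm 1 (u t) \<le> ereal M) \<and>
     (\<forall>t>0. u t \<in> borel_measurable lebesgue \<and> Lnorm \<infinity> (u t) < \<infinity>) \<and>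
     (\<forall>t0>0. ((\<lambda>t. Lnorm \<infinity> (\<lambda>x. u t x - u t0 x)) \<longlongrightarrow> 0) (at t0 within {0<..})) \<and>
     (\<exists>M::real. \<forall>t>0. Lnorm \<infinity> (u t) \<le> ereal M) \<and>
     (AE x in lebesgue. u 0 x = u0 x) \<and>
     (\<forall>t>0. AE x in lebesgue.
        u t x = heat t u0 x + (LBINT s=ereal 0..ereal t. dderiv a (heat (t - s) (\<lambda>y. f (u s y))) x))"

definition mass0 :: "('a::euclidean_space \<Rightarrow> real) \<Rightarrow> real" where
  "mass0 \<phi> = (LINT x|lebesgue. \<phi> x)"

definition A0 :: "('a::euclidean_space \<Rightarrow> real) \<Rightarrow> real \<Rightarrow> 'a \<Rightarrow> real" where
  "A0 u0 t x = mass0 u0 * gauss t x"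

primrec profile ::
  "'a::euclidean_space \<Rightarrow> (real \<Rightarrow> real) \<Rightarrow> ('a \<Rightarrow> real) \<Rightarrow> nat \<Rightarrow> real \<Rightarrow> 'a \<Rightarrow> real" where
  "profile a f u0 0 = A0 u0"
| "profile a f u0 (Suc k) = (\<lambda>t x. A0 u0 t x
      + (LBINT s=ereal 0..ereal 1. dderiv a (heat (t - s) (\<lambda>y. f (A0 u0 s y))) x)
      + (LBINT s=ereal 1..ereal t. dderiv a (heat (t - s) (\<lambda>y. f (profile a f u0 k s y))) x))"

end

theory Submission
  imports Defs "HOL-Probability.Distributions"
begin

text \<open>
  Everything is estimated simultaneously in \<open>L\<^sup>1\<close> and \<open>L\<^sup>\<infinity>\<close>, the other norms following by interpolation.
  Subtracting the Duhamel formulas, \<open>u - \<A>\<^sub>0\<^sub>,\<^sub>k\<close> is \<open>e\<^bsup>t\<Delta>\<^esup>u\<^sub>0 - \<M>\<^sub>0(u\<^sub>0) G\<^sub>t = O(t\<^bsup>-1/2\<^esup>)\<close> plus the Duhamel integral of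
  \<open>f(u) - f(\<A>\<^sub>0\<^sub>,\<^sub>k\<^sub>-\<^sub>1)\<close>, and the growth bound on \<open>f\<close> together with \<open>\<parallel>u(s)\<parallel>\<^sub>\<infinity> \<le> C s\<^bsup>-n/2\<^esup>\<close> turns the rate
  \<open>s\<^bsup>-k\<sigma>\<^esup>\<close> for \<open>u - \<A>\<^sub>0\<^sub>,\<^sub>k\<^sub>-\<^sub>1\<close> into a source of size \<open>s\<^bsup>-1/2-(k+1)\<sigma>\<^esup>\<close>, whose time integral produces the three cases.

  The decay of the sup norm is proved from the definition of the solution. Restarting the Duhamel formula gives
  Hoelder regularity of exponent 3/4, which exceeds 1/2 and so suffices for
  \<open>\<parallel>u(t + h)\<parallel>\<^sub>2\<^sup>2 \<le> \<parallel>e\<^bsup>h\<Delta>\<^esup>u(t)\<parallel>\<^sub>2\<^sup>2 + C h\<^bsup>5/4\<^esup>\<close>: the nonlinear contribution vanishes to leading order because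
  \<open>\<integral> u a\<cdot>\<nabla>f(u) = 0\<close>. Log-convexity of the heat flow in \<open>L\<^sup>2\<close> and letting \<open>h \<rightarrow> 0\<close> give algebraic decay of the
  \<open>L\<^sup>2\<close> norm, hence some algebraic decay of the sup norm, which the subcriticality \<open>p > 1 + 1/n\<close> upgrades to the
  rate \<open>t\<^bsup>-n/2\<^esup>\<close>.
\<close>

section \<open>Gaussian kernel\<close>

text \<open>The definition of a global solution offers neither a time derivative nor decay, so the
  energy identity cannot be differentiated. It is replaced by a one-step inequality whose error must
  be o(h): Hoelder exponent \<theta> in space and \<theta>/2 in time give an error of order
  h^(\<theta> + 1/2), hence the threshold \<theta> > 1/2. Exponent 1 is out of reach here, because
  increments of the derivative kernel then cost the non-integrable factor 1/t; 3/4 leaves t^(-7/8)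
  and the error h^(5/4), so that 2^m steps of length T/2^m lose only O(2^(-m/4)). The upgrade to
  t^(-n/2) is a bootstrap linear in the unknown constant, with a factor t^(-\<delta>) that is
  absorbed for large t. For the profiles the sup bound is always t^(-n/2) times the L1 bound;
  splitting the time integral at t/2 lets the kernel or the source supply that factor. The upper
  bound on p says k \<sigma> < 1/2, so every error before the last one is a pure power and each
  iteration gains \<sigma> in the exponent.\<close>

lemma nn_integral_lborel_shift:
  fixes f :: "'a::euclidean_space \<Rightarrow> ennreal"
  assumes [measurable]: "f \<in> borel_measurable borel"
  shows "(\<integral>\<^sup>+x. f (x + t) \<partial>lborel) = (\<integral>\<^sup>+x. f x \<partial>lborel)"
  by (subst lborel_affine[of 1 t]) (simp_all add: density_1 nn_integral_density nn_integral_distr add.commute)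

lemma integrable_lborel_shift:
  fixes f :: "'a::euclidean_space \<Rightarrow> real"
  assumes "integrable lborel f"
  shows "integrable lborel (\<lambda>x. f (x + t))"
proof -
  have [measurable]: "f \<in> borel_measurable borel" using assms by auto
  show ?thesis using assms by (subst (asm) lborel_affine[of 1 t]) (simp_all add: density_1 integrable_distr_eq add.commute)
qed

lemma integral_lborel_shift:
  fixes f :: "'a::euclidean_space \<Rightarrow> real"
  assumes [measurable]: "f \<in> borel_measurable borel"
  shows "(LINT x|lborel. f (x + t)) = (LINT x|lborel. f x)"
  by (subst (2) lborel_affine[of 1 t]) (simp_all add: density_1 integral_density integral_distr add.commute)

lemma integrable_lborel_reflect:
  fixes f :: "'a::euclidean_space \<Rightarrow> real"
  assumes "integrable lborel f"
  shows "integrable lborel (\<lambda>x. f (t - x))"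
proof -
  have [measurable]: "f \<in> borel_measurable borel" using assms by auto
  show ?thesis using assms by (subst (asm) lborel_affine[of "-1" t]) (simp_all add: density_1 integrable_distr_eq)
qed

lemma integral_lborel_reflect:
  fixes f :: "'a::euclidean_space \<Rightarrow> real"
  assumes [measurable]: "f \<in> borel_measurable borel"
  shows "(LINT x|lborel. f (t - x)) = (LINT x|lborel. f x)"
  by (subst (2) lborel_affine[of "-1" t]) (simp_all add: density_1 integral_density integral_distr)

section \<open>The Gauss kernel: positivity, mass one and pointwise moments\<close>

lemma gauss_nonneg: "0 \<le> gauss t x"
  by (simp add: gauss_def)

lemma gauss_minus: "gauss t (- x) = gauss t x"
  by (simp add: gauss_def)

lemma gauss_measurable [measurable (raw)]:
  assumes [measurable]: "f \<in> borel_measurable M" "g \<in> borel_measurable M"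
  shows "(\<lambda>x. gauss (f x) (g x :: 'a::euclidean_space)) \<in> borel_measurable M"
  unfolding gauss_def by measurable

lemma gauss_le:
  fixes x :: "'a::euclidean_space"
  assumes "t > 0"
  shows "gauss t x \<le> (4 * pi * t) powr (- real DIM('a) / 2)"
proof -
  have "exp (- (norm x)\<^sup>2 / (4 * t)) \<le> 1" using assms by simp
  thus ?thesis unfolding gauss_def using mult_left_mono[of _ 1 "(4 * pi * t) powr (- real DIM('a) / 2)"] by simp
qed

text \<open>The kernel is the product over \<open>Basis\<close> of centred normal densities with
  variance 2t, so the integral factors into one-dimensional ones.\<close>

lemma nn_integral_gauss:
  assumes t: "t > 0"
  shows "(\<integral>\<^sup>+(x::'a::euclidean_space). ennreal (gauss t x) \<partial>lborel) = 1"
proof -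
  have eq: "gauss t x = (\<Prod>b\<in>Basis. normal_density 0 (sqrt (2 * t)) (x \<bullet> b))" for x :: 'a
  proof -
    have "(norm x)\<^sup>2 = (\<Sum>b\<in>Basis. (x \<bullet> b)\<^sup>2)"
      unfolding power2_norm_eq_inner by (subst euclidean_inner) (simp add: power2_eq_square)
    hence 1: "exp (- (norm x)\<^sup>2 / (4 * t)) = (\<Prod>b\<in>Basis. exp (- (x \<bullet> b)\<^sup>2 / (4 * t)))"
      by (simp add: exp_sum[symmetric] sum_negf sum_divide_distrib[symmetric])
    have "(4 * pi * t) powr (- real DIM('a) / 2) = ((4 * pi * t) powr (-1/2)) ^ DIM('a)"
      using t by (simp add: powr_realpow[symmetric] powr_powr)
    also have "(4 * pi * t) powr (-1/2) = 1 / sqrt (4 * pi * t)"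
      using t by (simp add: powr_minus powr_half_sqrt divide_simps)
    finally have 2: "(4 * pi * t) powr (- real DIM('a) / 2) = (\<Prod>b\<in>(Basis::'a set). 1 / sqrt (4 * pi * t))"
      by simp
    show ?thesis
      unfolding gauss_def 1 2 normal_density_def prod.distrib[symmetric]
      using t by (simp add: mult.assoc mult.left_commute)
  qed
  have "(\<integral>\<^sup>+(x::'a). ennreal (gauss t x) \<partial>lborel) =
     (\<integral>\<^sup>+(x::'a). (\<Prod>b\<in>Basis. ennreal (normal_density 0 (sqrt (2 * t)) (x \<bullet> b))) \<partial>lborel)"
    by (simp add: eq prod_ennreal)
  also have "\<dots> = (\<Prod>b\<in>(Basis::'a set). (\<integral>\<^sup>+x. ennreal (normal_density 0 (sqrt (2 * t)) x) \<partial>lborel))"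
    by (rule nn_integral_lborel_prod[where f="\<lambda>b x. ennreal (normal_density 0 (sqrt (2 * t)) x)"]) auto
  also have "(\<integral>\<^sup>+x. ennreal (normal_density 0 (sqrt (2 * t)) x) \<partial>lborel) = 1"
    using t integral_normal_density[of "sqrt (2*t)" 0]
    by (subst nn_integral_eq_integral) auto
  finally show ?thesis by simp
qed

lemma gauss_integrable: "t > 0 \<Longrightarrow> integrable lborel (gauss t :: 'a::euclidean_space \<Rightarrow> real)"
  using nn_integral_gauss[of t, where ?'a='a]
  by (intro integrableI_nonneg) (auto simp: gauss_nonneg)

lemma gauss_integral: "t > 0 \<Longrightarrow> (LINT x|lborel. gauss t (x :: 'a::euclidean_space)) = 1"
  using nn_integral_gauss[of t, where ?'a='a]
  by (simp add: integral_eq_nn_integral gauss_nonneg)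

text \<open>The factor 129 comes from \<open>1 + r\<^sup>4 \<le> 129 exp (r\<^sup>2 / 8)\<close>.\<close>

definition moment_const :: "'a::euclidean_space itself \<Rightarrow> real" where
  "moment_const _ = 129 * 2 powr (real DIM('a) / 2)"

lemma moment_const_pos: "0 < moment_const TYPE('a::euclidean_space)"
  by (simp add: moment_const_def)

lemma gauss_prefactor_double:
  assumes "t > 0"
  shows "(4 * pi * t) powr (- real DIM('a) / 2) = 2 powr (real DIM('a::euclidean_space) / 2) * (4 * pi * (2 * t)) powr (- real DIM('a) / 2)"
proof -
  have "(4 * pi * (2 * t)) powr (- real DIM('a) / 2) = 2 powr (- real DIM('a) / 2) * (4 * pi * t) powr (- real DIM('a) / 2)"
    using assms by (subst powr_mult[symmetric]) (auto simp: algebra_simps)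
  moreover have "2 powr (real DIM('a)/2) * 2 powr (- real DIM('a) / 2) = 1"
    by (simp add: powr_add[symmetric])
  ultimately show ?thesis by (simp add: mult.assoc[symmetric])
qed

text \<open>With r = |x|/sqrt t, half of the exponent absorbs r^b and the other half is the
  exponential at time 2t. A pointwise bound by one Gauss kernel yields the L1 and the sup estimate
  of a weighted kernel at once.\<close>

lemma gauss_moment:
  fixes x :: "'a::euclidean_space"
  assumes t: "t > 0" and b: "0 \<le> b" "b \<le> 4"
  shows "norm x powr b * gauss t x \<le> moment_const TYPE('a) * t powr (b / 2) * gauss (2 * t) x"
proof -
  define r where "r = norm x / sqrt t"
  have r0: "r \<ge> 0" using t by (simp add: r_def)
  have nx: "norm x = sqrt t * r" using t by (simp add: r_def)
  have "r powr b \<le> 1 + r ^ 4"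
  proof (cases "r \<le> 1")
    case True
    hence "r powr b \<le> 1" using r0 b by (simp add: powr_le1)
    thus ?thesis using zero_le_power[OF r0, of 4] by linarith
  next
    case False
    hence "r powr b \<le> r powr 4" using b by (intro powr_mono) auto
    thus ?thesis using False by simp
  qed
  also have "\<dots> \<le> 129 * exp (r\<^sup>2 / 8)"
  proof -
    have "1 + r\<^sup>2 / 8 + (r\<^sup>2 / 8)\<^sup>2 / 2 \<le> exp (r\<^sup>2 / 8)"
      by (rule exp_lower_Taylor_quadratic) simp
    moreover have "r\<^sup>2 / 8 \<ge> 0" by simp
    ultimately have "1 + (r\<^sup>2 / 8)\<^sup>2 / 2 \<le> exp (r\<^sup>2 / 8)" by linarith
    hence "1 + r ^ 4 / 128 \<le> exp (r\<^sup>2 / 8)"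
      by (simp add: power_divide flip: power_mult)
    moreover have "r ^ 4 \<ge> 0" by simp
    ultimately show ?thesis by linarith
  qed
  finally have 1: "r powr b \<le> 129 * exp (r\<^sup>2 / 8)" .
  have r2: "(norm x)\<^sup>2 = t * r\<^sup>2" using t by (simp add: nx power_mult_distrib)
  have "norm x powr b = t powr (b/2) * r powr b"
    using t r0 by (simp add: nx powr_mult powr_half_sqrt[symmetric] powr_powr)
  moreover have "exp (- (norm x)\<^sup>2 / (4 * t)) = exp (- r\<^sup>2 / 8) * exp (- r\<^sup>2 / 8)"
    using t by (simp add: r2 exp_add[symmetric])
  moreover have "exp (- (norm x)\<^sup>2 / (4 * (2 * t))) = exp (- r\<^sup>2 / 8)"
    using t by (simp add: r2)
  moreover note gauss_prefactor_double[OF t, where ?'a='a]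
  moreover have "r powr b * (exp (- r\<^sup>2 / 8) * exp (- r\<^sup>2 / 8)) \<le> 129 * exp (- r\<^sup>2 / 8)"
  proof -
    have "r powr b * (exp (- r\<^sup>2 / 8) * exp (- r\<^sup>2 / 8)) \<le> 129 * exp (r\<^sup>2 / 8) * (exp (- r\<^sup>2 / 8) * exp (- r\<^sup>2 / 8))"
      by (intro mult_right_mono 1) auto
    also have "\<dots> = 129 * exp (- r\<^sup>2 / 8)" by (simp add: exp_add[symmetric])
    finally show ?thesis .
  qed
  ultimately show ?thesis
    unfolding gauss_def moment_const_def
    using mult_left_mono[of "r powr b * (exp (- r\<^sup>2 / 8) * exp (- r\<^sup>2 / 8))" "129 * exp (- r\<^sup>2 / 8)"
       "t powr (b/2) * (2 powr (real DIM('a)/2) * (4 * pi * (2 * t)) powr (- real DIM('a) / 2))"]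
    by (simp only: ac_simps) simp
qed

text \<open>The derivative of \<open>gauss t\<close> in direction a in closed form, that is, the
  convolution kernel of a . grad e^(t Delta).\<close>

definition dgauss :: "'a::euclidean_space \<Rightarrow> real \<Rightarrow> 'a \<Rightarrow> real" where
  "dgauss a t x = - (a \<bullet> x) / (2 * t) * gauss t x"

lemma dgauss_measurable [measurable (raw)]:
  assumes [measurable]: "f \<in> borel_measurable M" "g \<in> borel_measurable M"
  shows "(\<lambda>x. dgauss a (f x) (g x :: 'a::euclidean_space)) \<in> borel_measurable M"
  unfolding dgauss_def by measurable

lemma dgauss_minus: "dgauss a t (- x) = - dgauss a t x"
  by (simp add: dgauss_def gauss_minus)

text \<open>The factor a . x / (2t) raises the moment by one and costs 1/t, hence the exponent (b +
  1)/2 - 1.\<close>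

lemma dgauss_moment:
  fixes a :: "'a::euclidean_space"
  assumes t: "t > 0" and b: "0 \<le> b" "b \<le> 3"
  shows "norm x powr b * \<bar>dgauss a t x\<bar> \<le> norm a * moment_const TYPE('a) * t powr ((b - 1) / 2) * gauss (2 * t) x"
proof (cases "x = 0")
  case True
  thus ?thesis using moment_const_pos[where ?'a='a] by (simp add: gauss_nonneg)
next
  case False
  have "\<bar>dgauss a t x\<bar> \<le> norm a * norm x / (2 * t) * gauss t x"
    unfolding dgauss_def using t Cauchy_Schwarz_ineq2[of a x]
    by (auto simp: abs_mult gauss_nonneg intro!: mult_right_mono divide_right_mono)
  hence "norm x powr b * \<bar>dgauss a t x\<bar> \<le> norm x powr b * (norm a * norm x / (2 * t) * gauss t x)"
    by (intro mult_left_mono) auto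
  also have "\<dots> = norm a / (2 * t) * (norm x powr (b + 1) * gauss t x)"
    using False by (simp add: powr_add)
  also have "\<dots> \<le> norm a / (2 * t) * (moment_const TYPE('a) * t powr ((b + 1) / 2) * gauss (2 * t) x)"
    using t b by (intro mult_left_mono gauss_moment) auto
  also have "\<dots> = norm a * moment_const TYPE('a) * (t powr ((b + 1) / 2) / t / 2) * gauss (2 * t) x"
    by simp
  also have "t powr ((b + 1) / 2) / t = t powr ((b - 1) / 2)"
  proof -
    have "t powr ((b + 1) / 2) / t powr 1 = t powr ((b + 1) / 2 - 1)" by (rule powr_diff[symmetric])
    also have "(b + 1) / 2 - 1 = (b - 1) / 2" by (simp add: field_simps)
    finally show ?thesis using t by simp
  qed
  also have "norm a * moment_const TYPE('a) * (t powr ((b - 1) / 2) / 2) * gauss (2 * t) x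
     \<le> norm a * moment_const TYPE('a) * t powr ((b - 1) / 2) * gauss (2 * t) x"
    using moment_const_pos[where ?'a='a] by (intro mult_right_mono mult_left_mono) (auto simp: gauss_nonneg)
  finally show ?thesis .
qed

text \<open>\<open>0 powr 0\<close> is 0, so the moment bound with b = 0 is void at the origin;
  \<open>dgauss\<close> vanishes there.\<close>

lemma abs_dgauss_le:
  fixes a :: "'a::euclidean_space"
  assumes t: "t > 0"
  shows "\<bar>dgauss a t x\<bar> \<le> norm a * moment_const TYPE('a) * t powr (- 1 / 2) * gauss (2 * t) x"
  using dgauss_moment[OF t, of 0 x a] by (cases "x = 0") (auto simp: dgauss_def gauss_nonneg moment_const_pos less_imp_le)

lemma gauss_double_le:
  fixes x :: "'a::euclidean_space"
  assumes t: "t > 0"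
  shows "gauss (2 * t) x \<le> t powr (- real DIM('a) / 2)"
proof -
  have "gauss (2 * t) x \<le> (4 * pi * (2 * t)) powr (- real DIM('a) / 2)" using t by (intro gauss_le) auto
  also have "\<dots> \<le> t powr (- real DIM('a) / 2)"
    using t pi_gt3 by (intro powr_mono2') (auto simp: field_simps)
  finally show ?thesis .
qed

section \<open>Directional derivatives of the kernel\<close>

lemma gauss_line_derivative:
  fixes x z :: "'a::euclidean_space"
  assumes "t > 0"
  shows "((\<lambda>e. gauss t (x + e *\<^sub>R z)) has_real_derivative dgauss z t (x + e *\<^sub>R z)) (at e within S)"
proof -
  have *: "(norm (x + e *\<^sub>R z))\<^sup>2 = x \<bullet> x + 2 * e * (x \<bullet> z) + e\<^sup>2 * (z \<bullet> z)" for e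
    unfolding power2_norm_eq_inner by (simp add: inner_add_left inner_add_right inner_commute algebra_simps power2_eq_square)
  show ?thesis
    unfolding gauss_def dgauss_def *
    using assms by (auto intro!: derivative_eq_intros simp: inner_add_right inner_commute field_simps)
qed

text \<open>The second derivative of \<open>gauss t\<close> in the directions a and z. It controls
  increments of \<open>dgauss\<close> and the Taylor remainder behind differentiation under the
  integral.\<close>

definition d2gauss :: "'a::euclidean_space \<Rightarrow> 'a \<Rightarrow> real \<Rightarrow> 'a \<Rightarrow> real" where
  "d2gauss a z t x = (- (a \<bullet> z) / (2 * t) + (a \<bullet> x) * (z \<bullet> x) / (4 * t\<^sup>2)) * gauss t x"

lemma d2gauss_measurable [measurable (raw)]:
  assumes [measurable]: "g \<in> borel_measurable M"
  shows "(\<lambda>x. d2gauss a z t (g x :: 'a::euclidean_space)) \<in> borel_measurable M"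
  unfolding d2gauss_def by measurable

lemma dgauss_line_derivative:
  fixes x z :: "'a::euclidean_space"
  assumes "t > 0"
  shows "((\<lambda>e. dgauss a t (x + e *\<^sub>R z)) has_real_derivative d2gauss a z t (x + e *\<^sub>R z)) (at e within S)"
proof -
  have 1: "((\<lambda>e. - (a \<bullet> (x + e *\<^sub>R z)) / (2 * t)) has_real_derivative - (a \<bullet> z) / (2 * t)) (at e within S)"
    unfolding inner_add_right inner_scaleR_right using assms by (auto intro!: derivative_eq_intros)
  show ?thesis
    unfolding dgauss_def
    by (rule DERIV_cong[OF DERIV_mult[OF 1 gauss_line_derivative[OF assms]]])
       (use assms in \<open>simp add: d2gauss_def dgauss_def field_simps power2_eq_square\<close>)
qed

lemma abs_d2gauss_le:
  fixes a z :: "'a::euclidean_space"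
  assumes t: "t > 0"
  shows "\<bar>d2gauss a z t x\<bar> \<le> norm a * norm z * moment_const TYPE('a) * t powr (- 1) * gauss (2 * t) x"
proof -
  have m: "norm x powr b * gauss t x \<le> moment_const TYPE('a) * t powr (b/2) * gauss (2 * t) x" if "b = 0 \<or> b = 2" for b
    using that by (intro gauss_moment t) auto
  have m2: "(norm x)\<^sup>2 * gauss t x \<le> moment_const TYPE('a) * t * gauss (2 * t) x"
    using m[of 2] t by (cases "x = 0") (auto simp: powr_numeral)
  have m0: "gauss t x \<le> moment_const TYPE('a) * gauss (2 * t) x"
  proof (cases "x = 0")
    case False thus ?thesis using m[of 0] t by simp
  next
    \<comment> \<open>\<open>norm x powr 0\<close> is 0 here, so \<open>m\<close> gives nothing;
      only the prefactors at times t and 2t are compared.\<close>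
    case True
    show ?thesis using True gauss_prefactor_double[OF t, where ?'a='a] by (simp add: gauss_def moment_const_def)
  qed
  have "\<bar>d2gauss a z t x\<bar> \<le> (norm a * norm z / (2 * t) + (norm a * norm x) * (norm z * norm x) / (4 * t\<^sup>2)) * gauss t x"
  proof -
    have 1: "\<bar>a \<bullet> z\<bar> \<le> norm a * norm z" "\<bar>a \<bullet> x\<bar> \<le> norm a * norm x" "\<bar>z \<bullet> x\<bar> \<le> norm z * norm x"
      by (rule Cauchy_Schwarz_ineq2)+
    have "\<bar>- (a \<bullet> z) / (2 * t) + (a \<bullet> x) * (z \<bullet> x) / (4 * t\<^sup>2)\<bar> \<le> \<bar>a \<bullet> z\<bar> / (2 * t) + \<bar>a \<bullet> x\<bar> * \<bar>z \<bullet> x\<bar> / (4 * t\<^sup>2)"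
      using t by (intro order.trans[OF abs_triangle_ineq]) (auto simp: abs_mult)
    also have "\<dots> \<le> norm a * norm z / (2 * t) + (norm a * norm x) * (norm z * norm x) / (4 * t\<^sup>2)"
      using 1 t by (intro add_mono divide_right_mono mult_mono) auto
    finally show ?thesis unfolding d2gauss_def by (simp add: abs_mult gauss_nonneg mult_right_mono)
  qed
  also have "\<dots> = norm a * norm z * (1 / (2 * t) * gauss t x + 1 / (4 * t\<^sup>2) * ((norm x)\<^sup>2 * gauss t x))"
    by (simp add: algebra_simps power2_eq_square)
  also have "\<dots> \<le> norm a * norm z * (1 / (2 * t) * (moment_const TYPE('a) * gauss (2 * t) x) + 1 / (4 * t\<^sup>2) * (moment_const TYPE('a) * t * gauss (2 * t) x))"
    using t by (intro mult_left_mono add_mono m0 m2) auto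
  also have "\<dots> = norm a * norm z * moment_const TYPE('a) * (3 / (4 * t)) * gauss (2 * t) x"
    using t by (simp add: field_simps power2_eq_square)
  also have "\<dots> \<le> norm a * norm z * moment_const TYPE('a) * t powr (- 1) * gauss (2 * t) x"
    using t moment_const_pos[where ?'a='a]
    by (intro mult_right_mono mult_left_mono) (auto simp: gauss_nonneg powr_minus field_simps)
  finally show ?thesis .
qed

section \<open>Functions bounded in \<open>L\<^sup>1\<close> and \<open>L\<^sup>\<infinity>\<close>, and convolution\<close>

text \<open>A bounds the L1 norm and B the sup norm. The sup bound holds at every point and
  measurability is Borel rather than Lebesgue, so Fubini applies to parametrised families and no
  null set has to be carried along.\<close>

definition L1Linf :: "('a::euclidean_space \<Rightarrow> real) \<Rightarrow> real \<Rightarrow> real \<Rightarrow> bool" where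
  "L1Linf g A B \<longleftrightarrow> g \<in> borel_measurable borel \<and> 0 \<le> A \<and>
     (\<integral>\<^sup>+x. ennreal \<bar>g x\<bar> \<partial>lborel) \<le> ennreal A \<and> (\<forall>x. \<bar>g x\<bar> \<le> B)"

lemma L1LinfD:
  assumes "L1Linf g A B"
  shows "g \<in> borel_measurable borel" "0 \<le> A" "(\<integral>\<^sup>+x. ennreal \<bar>g x\<bar> \<partial>lborel) \<le> ennreal A" "\<And>x. \<bar>g x\<bar> \<le> B" "0 \<le> B"
    "integrable lborel g" "integrable lborel (\<lambda>x. \<bar>g x\<bar>)" "(LINT x|lborel. \<bar>g x\<bar>) \<le> A"
proof -
  show 1: "g \<in> borel_measurable borel" "0 \<le> A" and 2: "(\<integral>\<^sup>+x. ennreal \<bar>g x\<bar> \<partial>lborel) \<le> ennreal A" "\<And>x. \<bar>g x\<bar> \<le> B"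
    using assms by (auto simp: L1Linf_def)
  show "0 \<le> B" using 2(2)[of undefined] by linarith
  show 3: "integrable lborel g"
    using 1 2(1) by (intro integrableI_bounded) (auto simp: le_less_trans)
  thus 4: "integrable lborel (\<lambda>x. \<bar>g x\<bar>)" by auto
  have "ennreal (LINT x|lborel. \<bar>g x\<bar>) \<le> ennreal A"
    using 2(1) nn_integral_eq_integral[OF 4] by simp
  thus "(LINT x|lborel. \<bar>g x\<bar>) \<le> A" using 1 by simp
qed

lemma L1LinfI:
  assumes "integrable lborel g" "(LINT x|lborel. \<bar>g x\<bar>) \<le> A" "\<And>x. \<bar>g x\<bar> \<le> B"
  shows "L1Linf g A B"
proof -
  have 0: "integrable lborel (\<lambda>x. \<bar>g x\<bar>)" using assms(1) by auto
  have "0 \<le> (LINT x|lborel. \<bar>g x\<bar>)" by (intro integral_nonneg_AE) auto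
  hence "0 \<le> A" using assms(2) by linarith
  thus ?thesis
    using assms nn_integral_eq_integral[OF 0] by (auto simp: L1Linf_def ennreal_leI)
qed

section \<open>Closure properties of \<open>L1Linf\<close> and Hoelder's inequality\<close>

lemma L1Linf_mono: "L1Linf g A B \<Longrightarrow> A \<le> A' \<Longrightarrow> B \<le> B' \<Longrightarrow> L1Linf g A' B'"
  unfolding L1Linf_def by (meson ennreal_leI order_trans)

lemma L1Linf_dominated:
  assumes "L1Linf g A B" "h \<in> borel_measurable borel" "\<And>x. \<bar>h x\<bar> \<le> c * \<bar>g x\<bar>" "0 \<le> c"
  shows "L1Linf h (c * A) (c * B)"
proof -
  have [measurable]: "g \<in> borel_measurable borel" using assms by (auto simp: L1Linf_def)
  have "(\<integral>\<^sup>+x. ennreal \<bar>h x\<bar> \<partial>lborel) \<le> (\<integral>\<^sup>+x. ennreal c * ennreal \<bar>g x\<bar> \<partial>lborel)"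
    using assms by (intro nn_integral_mono) (auto simp: ennreal_mult[symmetric] intro!: ennreal_leI)
  also have "\<dots> = ennreal c * (\<integral>\<^sup>+x. ennreal \<bar>g x\<bar> \<partial>lborel)"
    by (intro nn_integral_cmult) auto
  also have "\<dots> \<le> ennreal c * ennreal A" using assms by (intro mult_left_mono) (auto simp: L1Linf_def)
  also have "\<dots> = ennreal (c * A)" using assms by (auto simp: ennreal_mult L1Linf_def)
  finally show ?thesis
    using assms unfolding L1Linf_def by (meson mult_left_mono mult_nonneg_nonneg order_trans)
qed

lemma L1Linf_cmult: "L1Linf g A B \<Longrightarrow> L1Linf (\<lambda>x. c * g x) (\<bar>c\<bar> * A) (\<bar>c\<bar> * B)"
  by (rule L1Linf_dominated[of g]) (auto simp: abs_mult L1Linf_def)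

lemma L1Linf_add:
  assumes "L1Linf g A B" "L1Linf h A' B'"
  shows "L1Linf (\<lambda>x. g x + h x) (A + A') (B + B')"
proof -
  have [measurable]: "g \<in> borel_measurable borel" "h \<in> borel_measurable borel" using assms by (auto simp: L1Linf_def)
  have "(\<integral>\<^sup>+x. ennreal \<bar>g x + h x\<bar> \<partial>lborel) \<le> (\<integral>\<^sup>+x. ennreal \<bar>g x\<bar> + ennreal \<bar>h x\<bar> \<partial>lborel)"
    by (intro nn_integral_mono) (simp add: ennreal_plus[symmetric] ennreal_leI del: ennreal_plus)
  also have "\<dots> = (\<integral>\<^sup>+x. ennreal \<bar>g x\<bar> \<partial>lborel) + (\<integral>\<^sup>+x. ennreal \<bar>h x\<bar> \<partial>lborel)"
    by (intro nn_integral_add) auto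
  also have "\<dots> \<le> ennreal A + ennreal A'" using assms by (intro add_mono) (auto simp: L1Linf_def)
  also have "\<dots> = ennreal (A + A')" using assms by (auto simp: L1Linf_def)
  finally show ?thesis using assms unfolding L1Linf_def
    by (auto intro!: order.trans[OF abs_triangle_ineq] add_mono)
qed

lemma L1Linf_diff:
  assumes "L1Linf g A B" "L1Linf h A' B'"
  shows "L1Linf (\<lambda>x. g x - h x) (A + A') (B + B')"
  using L1Linf_add[OF assms(1) L1Linf_cmult[OF assms(2), of "-1"]] by simp

lemma L1Linf_shift:
  assumes "L1Linf g A B"
  shows "L1Linf (\<lambda>x. g (x + z)) A B"
proof -
  have [measurable]: "g \<in> borel_measurable borel" using assms by (auto simp: L1Linf_def)
  show ?thesis using assms nn_integral_lborel_shift[of "\<lambda>x. ennreal \<bar>g x\<bar>" z] by (auto simp: L1Linf_def)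
qed

text \<open>Hoelder's inequality with exponents 1 and infinity; for equal factors it bounds a
  squared L2 norm.\<close>

lemma L1Linf_mult_integrable:
  assumes "L1Linf g A B" "L1Linf h A' B'"
  shows "integrable lborel (\<lambda>x. g x * h x)" "(LINT x|lborel. \<bar>g x * h x\<bar>) \<le> A * B'" "\<bar>LINT x|lborel. g x * h x\<bar> \<le> A * B'"
proof -
  note [measurable] = L1LinfD(1)[OF assms(1)] L1LinfD(1)[OF assms(2)]
  have le: "\<bar>g x * h x\<bar> \<le> \<bar>g x\<bar> * B'" for x
    using L1LinfD(4)[OF assms(2), of x] by (simp add: abs_mult mult_left_mono)
  show 1: "integrable lborel (\<lambda>x. g x * h x)"
    by (rule Bochner_Integration.integrable_bound[of _ "\<lambda>x. \<bar>g x\<bar> * B'"])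
       (use L1LinfD(7)[OF assms(1)] le in \<open>auto intro!: AE_I2 order.trans[OF le]\<close>)
  have "(LINT x|lborel. \<bar>g x * h x\<bar>) \<le> (LINT x|lborel. \<bar>g x\<bar> * B')"
    using 1 L1LinfD(7)[OF assms(1)] le by (intro integral_mono) auto
  also have "\<dots> \<le> A * B'" using L1LinfD(8)[OF assms(1)] L1LinfD(5)[OF assms(2)] by (auto intro: mult_right_mono)
  finally show "(LINT x|lborel. \<bar>g x * h x\<bar>) \<le> A * B'" .
  thus "\<bar>LINT x|lborel. g x * h x\<bar> \<le> A * B'"
    using integral_abs_bound[of lborel "\<lambda>x. g x * h x"] by linarith
qed

text \<open>Minkowski's integral inequality in L1 and in the sup norm simultaneously; the L1 part is
  Tonelli.\<close>

lemma L1Linf_integral: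
  fixes F :: "'b::euclidean_space \<Rightarrow> 'a::euclidean_space \<Rightarrow> real"
  assumes meas: "(\<lambda>(s,x). F s x) \<in> borel_measurable (borel \<Otimes>\<^sub>M borel)"
    and bd: "\<And>s. L1Linf (F s) (\<alpha> s) (\<beta> s)"
    and A: "(\<integral>\<^sup>+s. ennreal (\<alpha> s) \<partial>lborel) \<le> ennreal A" "0 \<le> A"
    and B: "(\<integral>\<^sup>+s. ennreal (\<beta> s) \<partial>lborel) \<le> ennreal B" "0 \<le> B"
  shows "L1Linf (\<lambda>x. LINT s|lborel. F s x) A B" "integrable lborel (\<lambda>s. F s x)"
proof -
  note [measurable] = meas
  have le: "(\<integral>\<^sup>+s. ennreal \<bar>F s x\<bar> \<partial>lborel) \<le> ennreal B" for x
    using bd by (intro order.trans[OF nn_integral_mono B(1)]) (auto simp: L1Linf_def intro!: ennreal_leI)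
  show int: "integrable lborel (\<lambda>s. F s x)" for x
    using le[of x] by (intro integrableI_bounded) (auto simp: le_less_trans)
  have le2: "ennreal \<bar>LINT s|lborel. F s x\<bar> \<le> (\<integral>\<^sup>+s. ennreal \<bar>F s x\<bar> \<partial>lborel)" for x
    using integral_norm_bound_ennreal[OF int[of x]] by simp
  have "\<bar>LINT s|lborel. F s x\<bar> \<le> B" for x
    using order.trans[OF le2 le] B(2) by simp
  moreover have "(\<integral>\<^sup>+x. ennreal \<bar>LINT s|lborel. F s x\<bar> \<partial>lborel) \<le> (\<integral>\<^sup>+x. \<integral>\<^sup>+s. ennreal \<bar>F s x\<bar> \<partial>lborel \<partial>lborel)"
    by (intro nn_integral_mono le2)
  moreover have "\<dots> = (\<integral>\<^sup>+s. \<integral>\<^sup>+x. ennreal \<bar>F s x\<bar> \<partial>lborel \<partial>lborel)"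
    by (rule lborel_pair.Fubini') measurable
  moreover have "\<dots> \<le> ennreal A"
    using bd by (intro order.trans[OF nn_integral_mono A(1)]) (auto simp: L1Linf_def)
  ultimately show "L1Linf (\<lambda>x. LINT s|lborel. F s x) A B"
    using A(2) by (auto simp: L1Linf_def)
qed

text \<open>Powers are integrated with \<open>has_integral\<close>, whereas estimates are made with
  nonnegative Lebesgue integrals; this is the bridge. The open interval keeps the singular endpoints
  out of the hypotheses on integrands.\<close>

lemma nn_integral_has_integral_indicator:
  fixes \<beta> :: "real \<Rightarrow> real"
  assumes "(\<beta> has_integral I) {0..t}" "\<And>s. s \<in> {0..t} \<Longrightarrow> 0 \<le> \<beta> s"
  shows "(\<integral>\<^sup>+s. ennreal (indicator {0<..<t} s * \<beta> s) \<partial>lborel) \<le> ennreal I" "0 \<le> I"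
proof -
  show "0 \<le> I" using assms by (rule has_integral_nonneg)
  have "(\<integral>\<^sup>+s. ennreal (indicator {0<..<t} s * \<beta> s) \<partial>lborel) \<le> (\<integral>\<^sup>+s. ennreal (indicator {0..t} s * \<beta> s) \<partial>lborel)"
    using assms(2) by (intro nn_integral_mono ennreal_leI) (auto simp: indicator_def)
  also have "\<dots> = ennreal I"
    by (rule nn_integral_has_integral_lebesgue) (use assms in auto)
  finally show "(\<integral>\<^sup>+s. ennreal (indicator {0<..<t} s * \<beta> s) \<partial>lborel) \<le> ennreal I" .
qed

text \<open>The sup bound is a fixed multiple c of the L1 bound, so one majorant \<beta> serves both
  norms; c is 1 in the regularity estimates and t^(-n/2) in the decay estimates.\<close>

lemma L1Linf_time_integral:
  fixes F :: "real \<Rightarrow> 'a::euclidean_space \<Rightarrow> real"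
  assumes meas: "(\<lambda>(s,x). F s x) \<in> borel_measurable (borel \<Otimes>\<^sub>M borel)"
    and bd: "\<And>s. 0 < s \<Longrightarrow> s < t \<Longrightarrow> L1Linf (F s) (\<beta> s) (c * \<beta> s)"
    and \<beta>: "(\<beta> has_integral I) {0..t}" "\<And>s. s \<in> {0..t} \<Longrightarrow> 0 \<le> \<beta> s" and c: "0 \<le> c"
  shows "L1Linf (\<lambda>x. LBINT s:{0<..<t}. F s x) I (c * I)" "set_integrable lborel {0<..<t} (\<lambda>s. F s x)"
proof -
  note [measurable] = meas
  have \<beta>': "((\<lambda>s. c * \<beta> s) has_integral c * I) {0..t}" by (intro has_integral_mult_right \<beta>)
  have meas': "(\<lambda>(s,x). indicator {0<..<t} s * F s x) \<in> borel_measurable (borel \<Otimes>\<^sub>M borel)"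
    by measurable
  have bd': "L1Linf (\<lambda>x. indicator {0<..<t} s * F s x) (indicator {0<..<t} s * \<beta> s) (indicator {0<..<t} s * (c * \<beta> s))" for s
  proof (cases "s \<in> {0<..<t}")
    case True thus ?thesis using bd[of s] by simp
  next
    case False thus ?thesis by (simp add: L1Linf_def)
  qed
  have c\<beta>: "\<And>s. s \<in> {0..t} \<Longrightarrow> 0 \<le> c * \<beta> s" using \<beta>(2) c by simp
  note n = L1Linf_integral[OF meas' bd' nn_integral_has_integral_indicator[OF \<beta>] nn_integral_has_integral_indicator[OF \<beta>' c\<beta>]]
  show "L1Linf (\<lambda>x. LBINT s:{0<..<t}. F s x) I (c * I)"
    unfolding set_lebesgue_integral_def using n(1) by simp
  show "set_integrable lborel {0<..<t} (\<lambda>s. F s x)"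
    unfolding set_integrable_def using n(2)[of x] by simp
qed

lemma abs_time_integral_le:
  fixes F :: "real \<Rightarrow> real"
  assumes meas: "F \<in> borel_measurable borel"
    and bd: "\<And>s. 0 < s \<Longrightarrow> s < t \<Longrightarrow> \<bar>F s\<bar> \<le> \<beta> s"
    and \<beta>: "(\<beta> has_integral I) {0..t}" "\<And>s. s \<in> {0..t} \<Longrightarrow> 0 \<le> \<beta> s"
  shows "\<bar>LBINT s:{0<..<t}. F s\<bar> \<le> I" "set_integrable lborel {0<..<t} F"
proof -
  note [measurable] = meas
  have "(\<integral>\<^sup>+s. ennreal (norm (indicator {0<..<t} s *\<^sub>R F s)) \<partial>lborel) \<le> (\<integral>\<^sup>+s. ennreal (indicator {0<..<t} s * \<beta> s) \<partial>lborel)"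
    using bd by (intro nn_integral_mono ennreal_leI) (auto simp: indicator_def)
  also have "\<dots> \<le> ennreal I" by (rule nn_integral_has_integral_indicator[OF \<beta>])
  finally have le: "(\<integral>\<^sup>+s. ennreal (norm (indicator {0<..<t} s *\<^sub>R F s)) \<partial>lborel) \<le> ennreal I" .
  show si: "set_integrable lborel {0<..<t} F"
    unfolding set_integrable_def using le by (intro integrableI_bounded) (auto simp: le_less_trans)
  have "ennreal (norm (LBINT s:{0<..<t}. F s)) \<le> ennreal I"
    unfolding set_lebesgue_integral_def
    by (rule order.trans[OF integral_norm_bound_ennreal le]) (use si in \<open>simp add: set_integrable_def\<close>)
  thus "\<bar>LBINT s:{0<..<t}. F s\<bar> \<le> I" using nn_integral_has_integral_indicator(2)[OF \<beta>] by simp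
qed

lemma integral_lborel_swap:
  fixes f :: "'b::euclidean_space \<Rightarrow> 'a::euclidean_space \<Rightarrow> real"
  assumes [measurable]: "(\<lambda>(x,y). f x y) \<in> borel_measurable (borel \<Otimes>\<^sub>M borel)"
    and fin: "(\<integral>\<^sup>+x. \<integral>\<^sup>+y. ennreal \<bar>f x y\<bar> \<partial>lborel \<partial>lborel) < \<infinity>"
  shows "(LINT y|lborel. LINT x|lborel. f x y) = (LINT x|lborel. LINT y|lborel. f x y)"
proof -
  have m: "case_prod f \<in> borel_measurable (lborel \<Otimes>\<^sub>M lborel)" by measurable
  have "(\<integral>\<^sup>+z. ennreal (norm (case_prod f z)) \<partial>(lborel \<Otimes>\<^sub>M lborel)) = (\<integral>\<^sup>+x. \<integral>\<^sup>+y. ennreal \<bar>f x y\<bar> \<partial>lborel \<partial>lborel)"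
    by (subst lborel.nn_integral_fst[symmetric]) (use m in auto)
  hence "integrable (lborel \<Otimes>\<^sub>M lborel) (case_prod f)"
    using fin m by (intro integrableI_bounded) auto
  thus ?thesis by (rule lborel_pair.Fubini_integral)
qed

section \<open>Convolution: measurability, Young's inequality, associativity\<close>

definition convol :: "('a::euclidean_space \<Rightarrow> real) \<Rightarrow> ('a \<Rightarrow> real) \<Rightarrow> 'a \<Rightarrow> real" where
  "convol K g x = (LINT y|lborel. K (x - y) * g y)"

lemma convol_measurable:
  assumes [measurable]: "(\<lambda>(w,y). K w y) \<in> borel_measurable (M \<Otimes>\<^sub>M borel)" "(\<lambda>(w,y). g w y) \<in> borel_measurable (M \<Otimes>\<^sub>M borel)"
    "x \<in> measurable M borel"
  shows "(\<lambda>w. convol (K w) (g w) (x w :: 'a::euclidean_space)) \<in> borel_measurable M"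
  unfolding convol_def by measurable

lemma convol_measurable1 [measurable]:
  assumes [measurable]: "K \<in> borel_measurable borel" "g \<in> borel_measurable borel"
  shows "convol K g \<in> borel_measurable (borel :: 'a::euclidean_space measure)"
  by (rule convol_measurable) measurable

lemma convol_alt:
  assumes [measurable]: "K \<in> borel_measurable borel" "g \<in> borel_measurable borel"
  shows "convol K g x = (LINT z|lborel. K z * g (x - z))"
  unfolding convol_def using integral_lborel_reflect[of "\<lambda>z. K z * g (x - z)" x] by simp

lemma convol_shift: "convol K g (x + z) = convol (\<lambda>y. K (y + z)) g x"
  unfolding convol_def by (simp add: algebra_simps)

text \<open>Young's inequality: the convolution is a superposition of translates of g with weights K
  z, so the integral inequality for \<open>L1Linf\<close> applies.\<close>

lemma L1Linf_convol:
  assumes [measurable]: "K \<in> borel_measurable borel"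
    and K: "(\<integral>\<^sup>+x. ennreal \<bar>K x\<bar> \<partial>lborel) \<le> ennreal \<kappa>" "0 \<le> \<kappa>" and g: "L1Linf g A B"
  shows "L1Linf (convol K g) (\<kappa> * A) (\<kappa> * B)"
proof -
  note [measurable] = L1LinfD(1)[OF g]
  have "L1Linf (\<lambda>x. LINT z|lborel. K z * g (x - z)) (\<kappa> * A) (\<kappa> * B)"
  proof (rule L1Linf_integral)
    show "L1Linf (\<lambda>x. K z * g (x - z)) (\<bar>K z\<bar> * A) (\<bar>K z\<bar> * B)" for z
      using L1Linf_cmult[OF L1Linf_shift[OF g, of "-z"], of "K z"] by simp
    show "(\<lambda>(z, x). K z * g (x - z)) \<in> borel_measurable (borel \<Otimes>\<^sub>M borel)" by measurable
    show "(\<integral>\<^sup>+z. ennreal (\<bar>K z\<bar> * A) \<partial>lborel) \<le> ennreal (\<kappa> * A)"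
      using K L1LinfD(2)[OF g] by (simp add: ennreal_mult nn_integral_multc mult_right_mono)
    show "(\<integral>\<^sup>+z. ennreal (\<bar>K z\<bar> * B) \<partial>lborel) \<le> ennreal (\<kappa> * B)"
      using K L1LinfD(5)[OF g] by (simp add: ennreal_mult nn_integral_multc mult_right_mono)
  qed (use K L1LinfD[OF g] in auto)
  moreover have "convol K g = (\<lambda>x. LINT z|lborel. K z * g (x - z))" by (rule ext, rule convol_alt) auto
  ultimately show ?thesis by simp
qed

lemma convol_integrable:
  fixes g :: "'a::euclidean_space \<Rightarrow> real"
  assumes [measurable]: "K \<in> borel_measurable borel" and K: "\<And>x. \<bar>K x\<bar> \<le> \<kappa>" and g: "integrable lborel g"
  shows "integrable lborel (\<lambda>y. K (x - y) * g y)"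
proof (rule Bochner_Integration.integrable_bound[of _ "\<lambda>y. \<kappa> * \<bar>g y\<bar>"])
  have [measurable]: "g \<in> borel_measurable borel" using g by auto
  show "(\<lambda>y. K (x - y) * g y) \<in> borel_measurable lborel" by measurable
  have "\<bar>K (x - y) * g y\<bar> \<le> \<kappa> * \<bar>g y\<bar>" for y unfolding abs_mult by (intro mult_right_mono K) auto
  moreover have "0 \<le> \<kappa>" using K[of undefined] by linarith
  ultimately show "AE y in lborel. norm (K (x - y) * g y) \<le> norm (\<kappa> * \<bar>g y\<bar>)" by (auto intro!: AE_I2)
qed (use g in auto)

lemma abs_convol_le:
  assumes [measurable]: "K \<in> borel_measurable borel" and K: "\<And>x. \<bar>K x\<bar> \<le> \<kappa>" and g: "integrable lborel g"
  shows "\<bar>convol K g x\<bar> \<le> \<kappa> * (LINT x|lborel. \<bar>g x\<bar>)"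
proof -
  have i: "integrable lborel (\<lambda>y. K (x - y) * g y)" by (rule convol_integrable) (use K g in auto)
  have "\<bar>convol K g x\<bar> \<le> (LINT y|lborel. \<bar>K (x - y) * g y\<bar>)" unfolding convol_def by (rule integral_abs_bound)
  also have "\<dots> \<le> (LINT y|lborel. \<kappa> * \<bar>g y\<bar>)"
    using i g by (intro integral_mono integrable_abs) (auto simp: abs_mult intro!: mult_right_mono K)
  finally show ?thesis by simp
qed

lemma convol_diff_right:
  assumes "K \<in> borel_measurable borel" "\<And>x. \<bar>K x\<bar> \<le> \<kappa>" "integrable lborel g" "integrable lborel h"
  shows "convol K (\<lambda>y. g y - h y) x = convol K g x - convol K h x"
  unfolding convol_def using convol_integrable[OF assms(1,2,3)] convol_integrable[OF assms(1,2,4)]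
  by (simp add: right_diff_distrib)

lemma convol_diff_left:
  assumes "K \<in> borel_measurable borel" "\<And>x. \<bar>K x\<bar> \<le> \<kappa>" "H \<in> borel_measurable borel" "\<And>x. \<bar>H x\<bar> \<le> \<eta>" "integrable lborel g"
  shows "convol (\<lambda>y. K y - H y) g x = convol K g x - convol H g x"
  unfolding convol_def using convol_integrable[OF assms(1,2,5)] convol_integrable[OF assms(3,4,5)]
  by (simp add: left_diff_distrib)

lemma convol_cong_AE:
  assumes "AE y in lborel. g y = h y" "g \<in> borel_measurable borel" "h \<in> borel_measurable borel" "K \<in> borel_measurable borel"
  shows "convol K g x = convol K h x"
  unfolding convol_def using assms by (intro integral_cong_AE) auto

text \<open>Fubini; the absolute double integral is finite because K1 is bounded and K2 and g are
  integrable.\<close>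

lemma convol_assoc:
  assumes K1[measurable]: "K1 \<in> borel_measurable borel" and b: "\<And>x. \<bar>K1 x\<bar> \<le> \<kappa>" and K2: "L1Linf K2 \<kappa>1 \<kappa>2" and g: "integrable lborel g"
  shows "convol K1 (convol K2 g) x = convol (convol K1 K2) g x"
proof -
  note [measurable] = L1LinfD(1)[OF K2]
  have [measurable]: "g \<in> borel_measurable borel" using g by auto
  have \<kappa>: "0 \<le> \<kappa>" using b[of undefined] by linarith
  have fin: "(\<integral>\<^sup>+z. \<integral>\<^sup>+y. ennreal \<bar>K1 (x - y) * (K2 (y - z) * g z)\<bar> \<partial>lborel \<partial>lborel) < \<infinity>"
  proof -
    have "(\<integral>\<^sup>+z. \<integral>\<^sup>+y. ennreal \<bar>K1 (x - y) * (K2 (y - z) * g z)\<bar> \<partial>lborel \<partial>lborel)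
       \<le> (\<integral>\<^sup>+z. \<integral>\<^sup>+y. ennreal (\<kappa> * \<bar>g z\<bar>) * ennreal \<bar>K2 (y - z)\<bar> \<partial>lborel \<partial>lborel)"
    proof (intro nn_integral_mono)
      fix z y
      have "\<bar>K1 (x - y)\<bar> * (\<bar>K2 (y - z)\<bar> * \<bar>g z\<bar>) \<le> \<kappa> * (\<bar>K2 (y - z)\<bar> * \<bar>g z\<bar>)" by (intro mult_right_mono b) auto
      thus "ennreal \<bar>K1 (x - y) * (K2 (y - z) * g z)\<bar> \<le> ennreal (\<kappa> * \<bar>g z\<bar>) * ennreal \<bar>K2 (y - z)\<bar>"
        using \<kappa> by (simp add: ennreal_mult[symmetric] abs_mult ac_simps ennreal_leI)
    qed
    also have "\<dots> = (\<integral>\<^sup>+z. ennreal (\<kappa> * \<bar>g z\<bar>) * (\<integral>\<^sup>+y. ennreal \<bar>K2 (y - z)\<bar> \<partial>lborel) \<partial>lborel)"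
      by (simp add: nn_integral_cmult)
    also have "\<dots> \<le> (\<integral>\<^sup>+z. ennreal (\<kappa> * \<bar>g z\<bar>) * ennreal \<kappa>1 \<partial>lborel)"
      using nn_integral_lborel_shift[of "\<lambda>y. ennreal \<bar>K2 y\<bar>" "- z" for z] L1LinfD(3)[OF K2]
      by (intro nn_integral_mono mult_left_mono) auto
    also have "\<dots> = ennreal \<kappa> * (\<integral>\<^sup>+z. ennreal \<bar>g z\<bar> \<partial>lborel) * ennreal \<kappa>1"
      using \<kappa> by (simp add: nn_integral_multc nn_integral_cmult ennreal_mult)
    also have "\<dots> < \<infinity>"
      using g by (auto simp: integrable_iff_bounded ennreal_mult_less_top)
    finally show ?thesis .
  qed
  have "convol K1 (convol K2 g) x = (LINT y|lborel. LINT z|lborel. K1 (x - y) * (K2 (y - z) * g z))"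
    unfolding convol_def by simp
  also have "\<dots> = (LINT z|lborel. LINT y|lborel. K1 (x - y) * (K2 (y - z) * g z))"
    by (rule integral_lborel_swap) (use fin in auto)
  also have "\<dots> = (LINT z|lborel. convol K1 K2 (x - z) * g z)"
  proof (rule Bochner_Integration.integral_cong[OF refl])
    fix z
    have "(LINT y|lborel. K1 (x - y) * (K2 (y - z) * g z)) = (LINT y|lborel. K1 (x - y) * K2 (y - z)) * g z"
      by (simp add: mult.assoc[symmetric])
    also have "(LINT y|lborel. K1 (x - y) * K2 (y - z)) = convol K1 K2 (x - z)"
      unfolding convol_def using integral_lborel_shift[of "\<lambda>y. K1 (x - y) * K2 (y - z)" z] by (simp add: algebra_simps)
    finally show "(LINT y|lborel. K1 (x - y) * (K2 (y - z) * g z)) = convol K1 K2 (x - z) * g z" .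
  qed
  also have "\<dots> = convol (convol K1 K2) g x" by (simp add: convol_def)
  finally show ?thesis .
qed

section \<open>Heat kernel estimates\<close>

lemma nn_integral_le_gauss:
  fixes \<phi> :: "'a::euclidean_space \<Rightarrow> real"
  assumes "t > 0" "0 \<le> c" "\<And>x. \<phi> x \<le> c * gauss t x"
  shows "(\<integral>\<^sup>+x. ennreal (\<phi> x) \<partial>lborel) \<le> ennreal c"
proof -
  have "(\<integral>\<^sup>+x. ennreal (\<phi> x) \<partial>lborel) \<le> (\<integral>\<^sup>+x. ennreal c * ennreal (gauss t (x::'a)) \<partial>lborel)"
    using assms by (intro nn_integral_mono) (auto simp: ennreal_mult[symmetric] gauss_nonneg intro!: ennreal_leI)
  also have "\<dots> = ennreal c" using assms by (simp add: nn_integral_cmult nn_integral_gauss)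
  finally show ?thesis .
qed

abbreviation dgauss_const :: "'a::euclidean_space \<Rightarrow> real" where
  "dgauss_const a \<equiv> norm a * moment_const TYPE('a)"

lemma dgauss_const_nonneg: "0 \<le> dgauss_const a"
  using moment_const_pos[where ?'a='a] by simp

lemma L1Linf_gauss:
  "t > 0 \<Longrightarrow> L1Linf (gauss t :: 'a::euclidean_space \<Rightarrow> real) 1 ((4 * pi * t) powr (- real DIM('a) / 2))"
  unfolding L1Linf_def by (auto simp: nn_integral_gauss gauss_nonneg intro!: gauss_le[simplified])

lemma abs_dgauss_le_sup:
  fixes a :: "'a::euclidean_space"
  assumes t: "t > 0"
  shows "\<bar>dgauss a t x\<bar> \<le> dgauss_const a * t powr (- 1 / 2 - real DIM('a) / 2)"
proof -
  have "\<bar>dgauss a t x\<bar> \<le> dgauss_const a * t powr (- 1 / 2) * gauss (2 * t) x" by (rule abs_dgauss_le[OF t])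
  also have "\<dots> \<le> dgauss_const a * t powr (- 1 / 2) * t powr (- real DIM('a) / 2)"
    using dgauss_const_nonneg[of a] by (intro mult_left_mono gauss_double_le t) auto
  also have "\<dots> = dgauss_const a * t powr (- 1 / 2 - real DIM('a) / 2)"
    by (simp add: powr_add[symmetric] mult.assoc)
  finally show ?thesis .
qed

lemma L1Linf_dgauss:
  fixes a :: "'a::euclidean_space"
  assumes t: "t > 0"
  shows "L1Linf (dgauss a t) (dgauss_const a * t powr (- 1 / 2)) (dgauss_const a * t powr (- 1 / 2 - real DIM('a) / 2))"
  unfolding L1Linf_def
proof (intro conjI allI abs_dgauss_le_sup t)
  show "(\<integral>\<^sup>+x. ennreal \<bar>dgauss a t x\<bar> \<partial>lborel) \<le> ennreal (dgauss_const a * t powr (- 1 / 2))"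
    by (rule nn_integral_le_gauss[of "2 * t"]) (use t abs_dgauss_le[OF t] dgauss_const_nonneg[of a] in auto)
qed (use dgauss_const_nonneg[of a] in auto)

lemma dgauss_integral:
  fixes a :: "'a::euclidean_space"
  shows "(LINT x|lborel. dgauss a t x) = 0"
  using integral_lborel_reflect[of "dgauss a t" 0] by (simp add: dgauss_minus)

text \<open>Completing the square in y: the product is a Gaussian in y centred at t x/(h + t) with
  time parameter h t/(h + t). Integrating it against 1 or against a . y yields the two semigroup
  laws.\<close>

lemma gauss_mult_gauss:
  fixes x y :: "'a::euclidean_space"
  assumes h: "h > 0" and t: "t > 0"
  shows "gauss h (x - y) * gauss t y = gauss (h + t) x * gauss (h * t / (h + t)) (y - (t / (h + t)) *\<^sub>R x)"
proof -
  have ht: "h + t > 0" using h t by simp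
  have "(4 * pi * h) powr (- real DIM('a) / 2) * (4 * pi * t) powr (- real DIM('a) / 2)
      = (4 * pi * (h + t)) powr (- real DIM('a) / 2) * (4 * pi * (h * t / (h + t))) powr (- real DIM('a) / 2)"
  proof -
    have "(4 * pi * h) * (4 * pi * t) = (4 * pi * (h + t)) * (4 * pi * (h * t / (h + t)))" using ht by simp
    thus ?thesis using h t ht by (metis powr_mult)
  qed
  moreover have "(norm (x - y))\<^sup>2 / (4 * h) + (norm y)\<^sup>2 / (4 * t)
      = (norm x)\<^sup>2 / (4 * (h + t)) + (norm (y - (t / (h + t)) *\<^sub>R x))\<^sup>2 / (4 * (h * t / (h + t)))"
  proof -
    define s where "s = h + t"
    have s: "s > 0" and hs: "h = s - t" using ht by (auto simp: s_def)
    have 1: "(norm (x - y))\<^sup>2 = x \<bullet> x - 2 * (x \<bullet> y) + y \<bullet> y"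
      unfolding power2_norm_eq_inner by (simp add: inner_diff_left inner_diff_right inner_commute)
    have 2: "(norm (y - (t / s) *\<^sub>R x))\<^sup>2 = y \<bullet> y - 2 * (t / s) * (x \<bullet> y) + (t / s)\<^sup>2 * (x \<bullet> x)"
      unfolding power2_norm_eq_inner
      by (simp add: inner_diff_left inner_diff_right inner_commute power2_eq_square)
    have "(x \<bullet> x - 2 * (x \<bullet> y) + y \<bullet> y) / (4 * h) + (y \<bullet> y) / (4 * t)
      = (x \<bullet> x) / (4 * s) + (y \<bullet> y - 2 * (t / s) * (x \<bullet> y) + (t / s)\<^sup>2 * (x \<bullet> x)) / (4 * (h * t / s))"
      using h t s by (simp add: divide_simps power2_eq_square) (simp add: hs algebra_simps)
    thus ?thesis unfolding s_def[symmetric] 1 2 by (simp add: power2_norm_eq_inner)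
  qed
  hence "exp (- (norm (x - y))\<^sup>2 / (4 * h)) * exp (- (norm y)\<^sup>2 / (4 * t))
      = exp (- (norm x)\<^sup>2 / (4 * (h + t))) * exp (- (norm (y - (t / (h + t)) *\<^sub>R x))\<^sup>2 / (4 * (h * t / (h + t))))"
    unfolding exp_add[symmetric] by (intro arg_cong[where f=exp]) simp
  moreover have "(p * e) * (q * d) = (p' * e') * (q' * d')" if "p * q = p' * q'" "e * d = e' * d'" for p q p' q' e d e' d' :: real
    using that by algebra
  ultimately show ?thesis unfolding gauss_def by blast
qed

lemma convol_gauss_gauss:
  fixes x :: "'a::euclidean_space"
  assumes "h > 0" "t > 0"
  shows "convol (gauss h) (gauss t) x = gauss (h + t) x"
proof -
  have "h * t / (h + t) > 0" using assms by simp
  hence "(LINT y|lborel. gauss (h * t / (h + t)) (y - (t / (h + t)) *\<^sub>R x)) = 1"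
    using integral_lborel_shift[of "gauss (h * t / (h + t))" "- (t / (h + t)) *\<^sub>R x"]
    by (simp add: gauss_integral)
  thus ?thesis unfolding convol_def gauss_mult_gauss[OF assms] by simp
qed

lemma convol_gauss_dgauss:
  fixes x a :: "'a::euclidean_space"
  assumes h: "h > 0" and t: "t > 0"
  shows "convol (gauss h) (dgauss a t) x = dgauss a (h + t) x"
proof -
  define \<mu> where "\<mu> = h * t / (h + t)"
  define m where "m = (t / (h + t)) *\<^sub>R x"
  have \<mu>: "\<mu> > 0" using assms by (simp add: \<mu>_def)
  have i: "integrable lborel (dgauss a \<mu>)" by (rule L1LinfD(6)[OF L1Linf_dgauss[OF \<mu>]])
  \<comment> \<open>Written as a multiple of \<open>dgauss\<close>, the linear moment vanishes by
    oddness; only the value a . m at the centre survives.\<close>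
  have eq: "(a \<bullet> y) * gauss \<mu> y = - (2 * \<mu>) * dgauss a \<mu> y" for y
    using \<mu> by (simp add: dgauss_def)
  have "(LINT y|lborel. (a \<bullet> y) * gauss \<mu> (y - m)) = (LINT y|lborel. (a \<bullet> (y + m)) * gauss \<mu> (y + m - m))"
    by (rule integral_lborel_shift[symmetric, of "\<lambda>y. (a \<bullet> y) * gauss \<mu> (y - m)"]) measurable
  also have "\<dots> = (LINT y|lborel. - (2 * \<mu>) * dgauss a \<mu> y + (a \<bullet> m) * gauss \<mu> y)"
    by (intro Bochner_Integration.integral_cong refl) (simp add: inner_add_right distrib_right eq)
  also have "\<dots> = a \<bullet> m"
    using i gauss_integrable[OF \<mu>, where ?'a='a]
    by (subst Bochner_Integration.integral_add) (auto simp: dgauss_integral gauss_integral[OF \<mu>])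
  finally have *: "(LINT y|lborel. (a \<bullet> y) * gauss \<mu> (y - m)) = a \<bullet> m" .
  have "gauss h (x - y) * dgauss a t y = (- gauss (h + t) x / (2 * t)) * ((a \<bullet> y) * gauss \<mu> (y - m))" for y
  proof -
    have "gauss h (x - y) * dgauss a t y = (- (a \<bullet> y) / (2 * t)) * (gauss h (x - y) * gauss t y)"
      by (simp add: dgauss_def)
    thus ?thesis unfolding gauss_mult_gauss[OF assms] \<mu>_def m_def by simp
  qed
  hence "convol (gauss h) (dgauss a t) x = (- gauss (h + t) x / (2 * t)) * (a \<bullet> m)"
    unfolding convol_def by (simp only: Bochner_Integration.integral_mult_right_zero *)
  also have "\<dots> = dgauss a (h + t) x" using h t by (simp add: m_def dgauss_def)
  finally show ?thesis .
qed

text \<open>Here \<phi>' is the derivative of \<phi> in direction z. The fundamental theorem along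
  the segment from x to x + z and Tonelli give the bound, since all translates of \<phi>' have the
  same L1 norm.\<close>

lemma nn_integral_translate_diff_le:
  fixes \<phi> \<phi>' :: "'a::euclidean_space \<Rightarrow> real"
  assumes [measurable]: "\<phi> \<in> borel_measurable borel" and cont: "continuous_on UNIV \<phi>'"
    and der: "\<And>x e. ((\<lambda>e. \<phi> (x + e *\<^sub>R z)) has_real_derivative \<phi>' (x + e *\<^sub>R z)) (at e within {0..1})"
    and A: "(\<integral>\<^sup>+x. ennreal \<bar>\<phi>' x\<bar> \<partial>lborel) \<le> ennreal A"
  shows "(\<integral>\<^sup>+x. ennreal \<bar>\<phi> (x + z) - \<phi> x\<bar> \<partial>lborel) \<le> ennreal A"
proof -
  have [measurable]: "\<phi>' \<in> borel_measurable borel" using cont by (rule borel_measurable_continuous_onI)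
  have le: "ennreal \<bar>\<phi> (x + z) - \<phi> x\<bar> \<le> (\<integral>\<^sup>+e. ennreal (indicator {0..1} e * \<bar>\<phi>' (x + e *\<^sub>R z)\<bar>) \<partial>lborel)" for x
  proof -
    have hi: "((\<lambda>e. \<phi>' (x + e *\<^sub>R z)) has_integral (\<phi> (x + z) - \<phi> x)) {0..1}"
      using fundamental_theorem_of_calculus[of 0 1 "\<lambda>e. \<phi> (x + e *\<^sub>R z)" "\<lambda>e. \<phi>' (x + e *\<^sub>R z)"] der[of x]
      by (simp add: has_real_derivative_iff_has_vector_derivative)
    have "continuous_on {0..1} (\<lambda>e. \<bar>\<phi>' (x + e *\<^sub>R z)\<bar>)"
      by (intro continuous_intros continuous_on_compose2[OF cont]) auto
    hence ai: "(\<lambda>e. \<bar>\<phi>' (x + e *\<^sub>R z)\<bar>) integrable_on {0..1}" by (rule integrable_continuous_real)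
    have "norm (integral {0..1} (\<lambda>e. \<phi>' (x + e *\<^sub>R z))) \<le> integral {0..1} (\<lambda>e. \<bar>\<phi>' (x + e *\<^sub>R z)\<bar>)"
      using hi ai by (intro integral_norm_bound_integral) auto
    hence "\<bar>\<phi> (x + z) - \<phi> x\<bar> \<le> integral {0..1} (\<lambda>e. \<bar>\<phi>' (x + e *\<^sub>R z)\<bar>)"
      using integral_unique[OF hi] by simp
    hence "ennreal \<bar>\<phi> (x + z) - \<phi> x\<bar> \<le> ennreal (integral {0..1} (\<lambda>e. \<bar>\<phi>' (x + e *\<^sub>R z)\<bar>))" by (rule ennreal_leI)
    also have "\<dots> = (\<integral>\<^sup>+e. ennreal (indicator {0..1} e * \<bar>\<phi>' (x + e *\<^sub>R z)\<bar>) \<partial>lborel)"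
      by (rule nn_integral_has_integral_lebesgue[symmetric]) (use ai in auto)
    finally show ?thesis .
  qed
  have "(\<integral>\<^sup>+x. ennreal \<bar>\<phi> (x + z) - \<phi> x\<bar> \<partial>lborel)
     \<le> (\<integral>\<^sup>+x. \<integral>\<^sup>+e. ennreal (indicator {0..1} e * \<bar>\<phi>' (x + e *\<^sub>R z)\<bar>) \<partial>lborel \<partial>lborel)"
    by (intro nn_integral_mono le)
  also have "\<dots> = (\<integral>\<^sup>+e. \<integral>\<^sup>+x. ennreal (indicator {0..1} e * \<bar>\<phi>' (x + e *\<^sub>R z)\<bar>) \<partial>lborel \<partial>lborel)"
    by (rule lborel_pair.Fubini') measurable
  also have "\<dots> = (\<integral>\<^sup>+e. indicator {0..1} e * (\<integral>\<^sup>+x. ennreal \<bar>\<phi>' (x + e *\<^sub>R z)\<bar> \<partial>lborel) \<partial>lborel)"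
    by (simp add: ennreal_mult' ennreal_indicator nn_integral_cmult)
  also have "\<dots> = (\<integral>\<^sup>+e. indicator {0..1::real} e * (\<integral>\<^sup>+x. ennreal \<bar>\<phi>' x\<bar> \<partial>lborel) \<partial>lborel)"
    by (subst nn_integral_lborel_shift[of "\<lambda>x. ennreal \<bar>\<phi>' x\<bar>"]) auto
  also have "\<dots> \<le> (\<integral>\<^sup>+e. indicator {0..1::real} e * ennreal A \<partial>lborel)"
    by (intro nn_integral_mono mult_left_mono A) auto
  also have "\<dots> = ennreal A" by (subst nn_integral_multc) auto
  finally show ?thesis .
qed

lemma gauss_continuous: "continuous_on UNIV (gauss t)"
  unfolding gauss_def by (cases "t = 0") (auto intro!: continuous_intros)

lemma dgauss_continuous: "continuous_on UNIV (dgauss a t)"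
  unfolding dgauss_def by (cases "t = 0") (auto intro!: continuous_intros gauss_continuous)

lemma d2gauss_continuous: "continuous_on UNIV (d2gauss a z t)"
  unfolding d2gauss_def by (cases "t = 0") (auto intro!: continuous_intros gauss_continuous)

lemma nn_integral_gauss_diff:
  fixes z :: "'a::euclidean_space"
  assumes t: "t > 0"
  shows "(\<integral>\<^sup>+x. ennreal \<bar>gauss t (x + z) - gauss t x\<bar> \<partial>lborel) \<le> ennreal (dgauss_const z * t powr (- 1 / 2))"
  by (rule nn_integral_translate_diff_le[OF _ dgauss_continuous gauss_line_derivative[OF t] L1LinfD(3)[OF L1Linf_dgauss[OF t]]]) measurable

lemma nn_integral_dgauss_diff:
  fixes a z :: "'a::euclidean_space"
  assumes t: "t > 0"
  shows "(\<integral>\<^sup>+x. ennreal \<bar>dgauss a t (x + z) - dgauss a t x\<bar> \<partial>lborel) \<le> ennreal (dgauss_const a * norm z * t powr (- 1))"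
proof (rule nn_integral_translate_diff_le[OF _ d2gauss_continuous dgauss_line_derivative[OF t]])
  show "(\<integral>\<^sup>+ x. ennreal \<bar>d2gauss a z t x\<bar> \<partial>lborel) \<le> ennreal (dgauss_const a * norm z * t powr - 1)"
    using t abs_d2gauss_le[OF t, of a z] moment_const_pos[where ?'a='a]
    by (intro nn_integral_le_gauss[of "2 * t"]) (auto simp: ac_simps)
qed measurable

lemma abs_gauss_diff_le:
  fixes x z :: "'a::euclidean_space"
  assumes t: "t > 0"
  shows "\<bar>gauss t (x + z) - gauss t x\<bar> \<le> dgauss_const z * t powr (- 1 / 2 - real DIM('a) / 2)"
proof -
  obtain e where "gauss t (x + 1 *\<^sub>R z) - gauss t (x + 0 *\<^sub>R z) = (1 - 0) * dgauss z t (x + e *\<^sub>R z)"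
    using MVT2[of 0 1 "\<lambda>e. gauss t (x + e *\<^sub>R z)" "\<lambda>e. dgauss z t (x + e *\<^sub>R z)"] gauss_line_derivative[OF t, of x z _ UNIV] zero_less_one by blast
  thus ?thesis using abs_dgauss_le_sup[OF t, of z "x + e *\<^sub>R z"] by simp
qed

text \<open>Differentiation under the integral by Taylor's formula: the remainder of the kernel is
  at most C e^2 uniformly in its argument, and convolving with an integrable g keeps it
  O(e^2).\<close>

lemma convol_gauss_derivative:
  fixes g :: "'a::euclidean_space \<Rightarrow> real"
  assumes t: "t > 0" and g: "integrable lborel g"
  shows "((\<lambda>e. convol (gauss t) g (x + e *\<^sub>R a)) has_real_derivative convol (dgauss a t) g x) (at 0)"
proof -
  define C where "C = dgauss_const a * norm a * t powr (- 1) * t powr (- real DIM('a) / 2)"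
  have C: "\<bar>d2gauss a a t w\<bar> \<le> C" for w
  proof -
    have "\<bar>d2gauss a a t w\<bar> \<le> dgauss_const a * norm a * t powr (- 1) * gauss (2 * t) w"
      using abs_d2gauss_le[OF t, of a a w] by (simp add: ac_simps)
    also have "\<dots> \<le> C" unfolding C_def using dgauss_const_nonneg[of a] by (intro mult_left_mono gauss_double_le t) auto
    finally show ?thesis .
  qed
  have dlip: "\<bar>dgauss a t (w + e *\<^sub>R a) - dgauss a t w\<bar> \<le> C * \<bar>e\<bar>" for w e
  proof -
    have "norm (dgauss a t (w + e *\<^sub>R a) - dgauss a t (w + 0 *\<^sub>R a)) \<le> C * norm (e - 0)"
      by (rule field_differentiable_bound[of UNIV "\<lambda>e. dgauss a t (w + e *\<^sub>R a)" "\<lambda>e. d2gauss a a t (w + e *\<^sub>R a)"])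
         (use dgauss_line_derivative[OF t] C in auto)
    thus ?thesis by simp
  qed
  \<comment> \<open>The mean value inequality is applied to the remainder itself, whose derivative
    in r is at most C |e| by \<open>dlip\<close>.\<close>
  have rem: "\<bar>gauss t (w + e *\<^sub>R a) - gauss t w - e * dgauss a t w\<bar> \<le> C * \<bar>e\<bar> * \<bar>e\<bar>" for w e
  proof -
    have "norm ((\<lambda>r. gauss t (w + r *\<^sub>R a) - r * dgauss a t w) e - (\<lambda>r. gauss t (w + r *\<^sub>R a) - r * dgauss a t w) 0) \<le> (C * \<bar>e\<bar>) * norm (e - 0)"
    proof (rule field_differentiable_bound[of "{-\<bar>e\<bar>..\<bar>e\<bar>}" _ "\<lambda>r. dgauss a t (w + r *\<^sub>R a) - dgauss a t w"])
      show "((\<lambda>r. gauss t (w + r *\<^sub>R a) - r * dgauss a t w) has_field_derivative dgauss a t (w + r *\<^sub>R a) - dgauss a t w)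
         (at r within {- \<bar>e\<bar>..\<bar>e\<bar>})" for r
        by (auto intro!: derivative_eq_intros gauss_line_derivative[OF t])
      show "norm (dgauss a t (w + r *\<^sub>R a) - dgauss a t w) \<le> C * \<bar>e\<bar>" if "r \<in> {- \<bar>e\<bar>..\<bar>e\<bar>}" for r
      proof -
        have "0 \<le> C" using C[of 0] by linarith
        moreover have "\<bar>r\<bar> \<le> \<bar>e\<bar>" using that by auto
        ultimately have "C * \<bar>r\<bar> \<le> C * \<bar>e\<bar>" by (intro mult_left_mono)
        thus ?thesis using dlip[of w r] by simp
      qed
    qed auto
    thus ?thesis by simp
  qed
  define N where "N = (LINT y|lborel. \<bar>g y\<bar>)"
  have est: "\<bar>(convol (gauss t) g (x + e *\<^sub>R a) - convol (gauss t) g x) / e - convol (dgauss a t) g x\<bar> \<le> C * N * \<bar>e\<bar>" if "e \<noteq> 0" for e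
  proof -
    let ?R = "\<lambda>w. gauss t (w + e *\<^sub>R a) - gauss t w - e * dgauss a t w"
    have i1: "integrable lborel (\<lambda>y. gauss t (x + e *\<^sub>R a - y) * g y)" for e
      by (rule convol_integrable[OF _ L1LinfD(4)[OF L1Linf_gauss[OF t]] g]) measurable
    have i2: "integrable lborel (\<lambda>y. dgauss a t (x - y) * g y)"
      by (rule convol_integrable[OF _ abs_dgauss_le_sup[OF t] g]) measurable
    have "convol ?R g x = (LINT y|lborel. gauss t (x + e *\<^sub>R a - y) * g y - gauss t (x + 0 *\<^sub>R a - y) * g y - e * (dgauss a t (x - y) * g y))"
      unfolding convol_def by (intro Bochner_Integration.integral_cong) (auto simp: algebra_simps)
    also have "\<dots> = convol (gauss t) g (x + e *\<^sub>R a) - convol (gauss t) g x - e * convol (dgauss a t) g x"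
      using i1[of e] i1[of 0] i2 unfolding convol_def by simp
    finally have eq: "convol ?R g x = convol (gauss t) g (x + e *\<^sub>R a) - convol (gauss t) g x - e * convol (dgauss a t) g x" .
    have "\<bar>convol ?R g x\<bar> \<le> C * \<bar>e\<bar> * \<bar>e\<bar> * N"
      unfolding N_def by (rule abs_convol_le[OF _ rem g]) measurable
    hence "\<bar>convol ?R g x\<bar> / \<bar>e\<bar> \<le> C * N * \<bar>e\<bar>" using that by (simp add: divide_simps) (simp add: ac_simps)
    moreover have "(convol (gauss t) g (x + e *\<^sub>R a) - convol (gauss t) g x) / e - convol (dgauss a t) g x = convol ?R g x / e"
      unfolding eq using that by (simp add: field_simps)
    ultimately show ?thesis by (simp add: abs_divide)
  qed
  have "((\<lambda>e. (convol (gauss t) g (x + e *\<^sub>R a) - convol (gauss t) g x) / e - convol (dgauss a t) g x) \<longlongrightarrow> 0) (at 0)"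
  proof (rule Lim_null_comparison)
    show "\<forall>\<^sub>F e in at 0. norm ((convol (gauss t) g (x + e *\<^sub>R a) - convol (gauss t) g x) / e - convol (dgauss a t) g x) \<le> C * N * \<bar>e\<bar>"
      using est by (auto simp: eventually_at_filter)
    have "((\<lambda>e. C * N * \<bar>e\<bar>) \<longlongrightarrow> C * N * \<bar>0\<bar>) (at (0::real))" by (intro tendsto_intros)
    thus "((\<lambda>e. C * N * \<bar>e\<bar>) \<longlongrightarrow> 0) (at (0::real))" by simp
  qed
  thus ?thesis unfolding DERIV_def by (subst Lim_null) simp
qed

section \<open>Passage from Lebesgue measurable functions to Borel representatives\<close>

lemma heat_eq_convol:
  assumes t: "t > 0" and g: "g \<in> borel_measurable lebesgue" and h: "h \<in> borel_measurable borel" and eq: "AE y in lebesgue. g y = h y"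
  shows "heat t g x = convol (gauss t) h x"
proof -
  have h': "h \<in> borel_measurable lebesgue" using h by (intro measurable_completion) simp
  have gm: "(\<lambda>y. gauss t (x - y)) \<in> borel_measurable borel" by measurable
  hence gm': "(\<lambda>y. gauss t (x - y)) \<in> borel_measurable lebesgue" by (intro measurable_completion) simp
  have "heat t g x = (LINT y|lebesgue. gauss t (x - y) * h y)"
    unfolding heat_def using t eq g h' gm' by (auto intro!: integral_cong_AE)
  also have "\<dots> = convol (gauss t) h x"
    unfolding convol_def using h gm by (subst integral_completion) auto
  finally show ?thesis .
qed

lemma dderiv_heat_eq_convol:
  assumes t: "t > 0" and g: "g \<in> borel_measurable lebesgue" and h: "integrable lborel h" and eq: "AE y in lebesgue. g y = h y"
  shows "dderiv a (heat t g) x = convol (dgauss a t) h x"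
proof -
  have "h \<in> borel_measurable borel" using h by auto
  hence "heat t g = convol (gauss t) h" using heat_eq_convol[OF t g _ eq] by auto
  thus ?thesis unfolding dderiv_def using DERIV_imp_deriv[OF convol_gauss_derivative[OF t h]] by simp
qed

section \<open>The Duhamel integral\<close>

lemma has_integral_powr_reflect:
  assumes "b > - 1" "t \<ge> 0"
  shows "((\<lambda>s. (t - s) powr b) has_integral (t powr (b + 1) / (b + 1))) {0..t::real}"
proof -
  have "((\<lambda>x. (- 1 *\<^sub>R x + t) powr b) has_integral (1 / \<bar>- 1\<bar> ^ DIM(real)) *\<^sub>R (t powr (b + 1) / (b + 1)))
      ((\<lambda>x. (1 / - 1) *\<^sub>R x + - ((1 / - 1) *\<^sub>R t)) ` cbox 0 t)"
    by (rule has_integral_affinity[of "\<lambda>s. s powr b"]) (use has_integral_powr_from_0[OF assms] in auto)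
  moreover have "(\<lambda>x. (1 / - 1) *\<^sub>R x + - ((1 / - 1) *\<^sub>R t)) ` cbox 0 t = {0..t}"
  proof -
    have "(\<lambda>x. t - x) ` {0..t} = {0..t}" by (simp add: image_diff_atLeastAtMost)
    moreover have "(\<lambda>x. (1 / - 1) *\<^sub>R x + - ((1 / - 1) *\<^sub>R t)) = (\<lambda>x. t - x)" by auto
    ultimately show ?thesis by simp
  qed
  ultimately show ?thesis by simp
qed

lemma set_integral_split:
  fixes F :: "real \<Rightarrow> real"
  assumes c: "0 < c" "c < t" and F: "set_integrable lborel {0<..<t} F"
  shows "(LBINT s:{0<..<t}. F s) = (LBINT s:{0<..<c}. F s) + (LBINT s:{c<..<t}. F s)"
proof -
  have i: "set_integrable lborel {0<..<c} F" "set_integrable lborel {c<..<t} F"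
    by (rule set_integrable_subset[OF F]; use c in auto)+
  have m: "(\<lambda>s. indicator {0<..<t} s *\<^sub>R F s) \<in> borel_measurable lborel"
    using F unfolding set_integrable_def by (rule borel_measurable_integrable)
  have m': "(\<lambda>s. indicator ({0<..<c} \<union> {c<..<t}) s *\<^sub>R F s) \<in> borel_measurable lborel"
    using set_integrable_Un[OF i] unfolding set_integrable_def by (intro borel_measurable_integrable) auto
  have "(LBINT s:{0<..<t}. F s) = (LBINT s:{0<..<c} \<union> {c<..<t}. F s)"
    unfolding set_lebesgue_integral_def
  proof (rule integral_cong_AE[OF m m'])
    have "AE s in lborel. s \<noteq> c" by (rule AE_lborel_singleton)
    thus "AE s in lborel. indicator {0<..<t} s *\<^sub>R F s = indicator ({0<..<c} \<union> {c<..<t}) s *\<^sub>R F s"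
      by eventually_elim (use c in \<open>auto simp: indicator_def\<close>)
  qed
  also have "\<dots> = (LBINT s:{0<..<c}. F s) + (LBINT s:{c<..<t}. F s)" by (rule set_integral_Un) (use i in auto)
  finally show ?thesis .
qed

text \<open>The derivative sits on the kernel, so g needs no smoothness; integrability in s near t
  rests on the L1 norm (t - s)^(-1/2) of the kernel.\<close>

definition duhamel :: "'a::euclidean_space \<Rightarrow> (real \<Rightarrow> 'a \<Rightarrow> real) \<Rightarrow> real \<Rightarrow> 'a \<Rightarrow> real" where
  "duhamel a g t x = (LBINT s:{0<..<t}. convol (dgauss a (t - s)) (g s) x)"

lemma convol_dgauss_measurable:
  assumes [measurable]: "(\<lambda>(s,x). g s x) \<in> borel_measurable (borel \<Otimes>\<^sub>M borel)"
    "\<tau> \<in> borel_measurable M" "\<sigma> \<in> borel_measurable M" "\<xi> \<in> borel_measurable M"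
  shows "(\<lambda>w. convol (dgauss a (\<tau> w)) (g (\<sigma> w)) (\<xi> w :: 'a::euclidean_space)) \<in> borel_measurable M"
  by (rule convol_measurable) measurable

lemma convol_dgauss_joint_measurable:
  assumes "(\<lambda>(s,x). g s x) \<in> borel_measurable (borel \<Otimes>\<^sub>M borel)"
  shows "(\<lambda>(s,x). convol (dgauss a (t - s)) (g s) (x :: 'a::euclidean_space)) \<in> borel_measurable (borel \<Otimes>\<^sub>M borel)"
  using convol_dgauss_measurable[OF assms, of "\<lambda>w. t - fst w" "borel \<Otimes>\<^sub>M borel" fst snd a] by (simp add: case_prod_unfold)

lemma duhamel_measurable:
  assumes [measurable]: "(\<lambda>(s,x). g s x) \<in> borel_measurable (borel \<Otimes>\<^sub>M borel)"
  shows "(\<lambda>(t,x). duhamel a g t (x :: 'a::euclidean_space)) \<in> borel_measurable (borel \<Otimes>\<^sub>M borel)"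
proof -
  have [measurable]: "(\<lambda>w. convol (dgauss a (fst (fst w) - snd w)) (g (snd w)) (snd (fst w) :: 'a)) \<in> borel_measurable ((borel \<Otimes>\<^sub>M borel) \<Otimes>\<^sub>M borel)"
    by (rule convol_dgauss_measurable) measurable
  have [measurable]: "(\<lambda>w. indicator {0<..<fst (fst w) :: real} (snd w) :: real) \<in> borel_measurable ((borel \<Otimes>\<^sub>M (borel :: 'a measure)) \<Otimes>\<^sub>M borel)"
    unfolding indicator_def greaterThanLessThan_iff by measurable
  have "(\<lambda>z. LINT s|lborel. (\<lambda>w. indicator {0<..<fst (fst w)} (snd w) *\<^sub>R convol (dgauss a (fst (fst w) - snd w)) (g (snd w)) (snd (fst w))) (z, s))
     \<in> borel_measurable (borel \<Otimes>\<^sub>M borel)"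
    by measurable
  thus ?thesis unfolding duhamel_def set_lebesgue_integral_def by (simp add: case_prod_unfold)
qed

lemma L1Linf_convol_dgauss:
  fixes a :: "'a::euclidean_space"
  assumes "t > 0" "L1Linf g A B"
  shows "L1Linf (convol (dgauss a t) g) (dgauss_const a * t powr (- 1 / 2) * A) (dgauss_const a * t powr (- 1 / 2) * B)"
  using L1LinfD[OF L1Linf_dgauss[OF assms(1), of a]] assms(2) by (intro L1Linf_convol) auto

lemma L1Linf_convol_gauss:
  assumes "t > 0" "L1Linf g A B"
  shows "L1Linf (convol (gauss t) g) A B"
  using L1Linf_convol[of "gauss t" 1 g A B] L1LinfD[OF L1Linf_gauss[OF assms(1)]] assms(2) by auto

text \<open>Smoothing from L1 to the sup norm. Its singularity is not integrable in time, so it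
  serves only away from s = t or after interpolation.\<close>

lemma abs_convol_dgauss_le_L1:
  fixes a :: "'a::euclidean_space"
  assumes t: "t > 0" and g: "L1Linf g A B"
  shows "\<bar>convol (dgauss a t) g x\<bar> \<le> dgauss_const a * t powr (- 1 / 2 - real DIM('a) / 2) * A"
proof -
  have "\<bar>convol (dgauss a t) g x\<bar> \<le> dgauss_const a * t powr (- 1 / 2 - real DIM('a) / 2) * (LINT x|lborel. \<bar>g x\<bar>)"
    by (rule abs_convol_le[OF _ abs_dgauss_le_sup[OF t] L1LinfD(6)[OF g]]) measurable
  also have "\<dots> \<le> dgauss_const a * t powr (- 1 / 2 - real DIM('a) / 2) * A"
    using L1LinfD(8)[OF g] dgauss_const_nonneg[of a] by (intro mult_left_mono) auto
  finally show ?thesis .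
qed

lemma L1Linf_duhamel:
  fixes a :: "'a::euclidean_space"
  assumes gm: "(\<lambda>(s,x). g s x) \<in> borel_measurable (borel \<Otimes>\<^sub>M borel)"
    and g: "\<And>s. 0 < s \<Longrightarrow> s < t \<Longrightarrow> L1Linf (g s) A A" and A: "0 \<le> A" and t: "0 \<le> t"
  shows "L1Linf (duhamel a g t) (2 * dgauss_const a * A * t powr (1 / 2)) (2 * dgauss_const a * A * t powr (1 / 2))"
    "set_integrable lborel {0<..<t} (\<lambda>s. convol (dgauss a (t - s)) (g s) x)"
proof -
  have \<beta>: "((\<lambda>s. dgauss_const a * A * (t - s) powr (- 1 / 2)) has_integral dgauss_const a * A * (t powr (- 1 / 2 + 1) / (- 1 / 2 + 1))) {0..t}"
    using t by (intro has_integral_mult_right has_integral_powr_reflect) auto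
  have m: "(\<lambda>(s,x). convol (dgauss a (t - s)) (g s) x) \<in> borel_measurable (borel \<Otimes>\<^sub>M borel)"
    by (rule convol_dgauss_joint_measurable[OF gm])
  have bd: "L1Linf (\<lambda>x. convol (dgauss a (t - s)) (g s) x) (dgauss_const a * A * (t - s) powr (- 1 / 2)) (1 * (dgauss_const a * A * (t - s) powr (- 1 / 2)))"
    if "0 < s" "s < t" for s
    using L1Linf_convol_dgauss[OF _ g[OF that], of "t - s" a] that by (simp add: ac_simps)
  have nn: "0 \<le> dgauss_const a * A * (t - s) powr (- 1 / 2)" for s
    using A dgauss_const_nonneg[of a] by simp
  note r = L1Linf_time_integral[OF m bd \<beta> nn zero_le_one]
  show "L1Linf (duhamel a g t) (2 * dgauss_const a * A * t powr (1 / 2)) (2 * dgauss_const a * A * t powr (1 / 2))"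
    unfolding duhamel_def[abs_def] using r(1) by (simp add: mult.assoc mult.left_commute[of 2] mult.commute[of _ 2])
  show "set_integrable lborel {0<..<t} (\<lambda>s. convol (dgauss a (t - s)) (g s) x)" using r(2) .
qed

text \<open>Applying the heat flow for time h to the formula at t0, the semigroup laws advance all
  kernel times by h. What is then missing from the formula at t0 + h is the source integral over
  (t0, t0 + h), which a shift in time turns into a Duhamel integral started at t0.\<close>

lemma duhamel_restart:
  fixes a :: "'a::euclidean_space"
  assumes gm: "(\<lambda>(s,x). g s x) \<in> borel_measurable (borel \<Otimes>\<^sub>M borel)"
    and g: "\<And>s. 0 < s \<Longrightarrow> L1Linf (g s) A A" and v0: "L1Linf v0 B1 B2"
    and V: "\<And>t x. 0 < t \<Longrightarrow> V t x = convol (gauss t) v0 x + duhamel a g t x"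
    and t0: "t0 > 0" and h: "h > 0"
  shows "V (t0 + h) x = convol (gauss h) (V t0) x + duhamel a (\<lambda>s. g (t0 + s)) h x"
proof -
  note [measurable] = gm
  have A: "0 \<le> A" using L1LinfD(2)[OF g[of 1]] by simp
  let ?G = "\<lambda>s y. indicator {0<..<t0} s * convol (dgauss a (t0 - s)) (g s) y"
  have m0: "(\<lambda>(s,x). convol (dgauss a (t0 - s)) (g s) x) \<in> borel_measurable (borel \<Otimes>\<^sub>M borel)"
    by (rule convol_dgauss_joint_measurable[OF gm])
  note [measurable] = m0
  have du: "L1Linf (duhamel a g t0) (2 * dgauss_const a * A * t0 powr (1 / 2)) (2 * dgauss_const a * A * t0 powr (1 / 2))"
    by (rule L1Linf_duhamel(1)[OF gm g A]) (use t0 in auto)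
  have gh: "\<bar>gauss h y\<bar> \<le> (4 * pi * h) powr (- real DIM('a) / 2)" for y :: 'a
    by (rule L1LinfD(4)[OF L1Linf_gauss[OF h]])
  have hv: "integrable lborel (convol (gauss t0) v0)" by (rule L1LinfD(6)[OF L1Linf_convol_gauss[OF t0 v0]])
  have "convol (gauss h) (V t0) x = convol (gauss h) (\<lambda>y. convol (gauss t0) v0 y + duhamel a g t0 y) x"
    using V[OF t0] by presburger
  also have "\<dots> = convol (gauss h) (convol (gauss t0) v0) x + convol (gauss h) (duhamel a g t0) x"
    unfolding convol_def[of "gauss h"]
    using convol_integrable[of "gauss h", OF _ gh hv, where x=x] convol_integrable[of "gauss h", OF _ gh L1LinfD(6)[OF du], where x=x]
    by (simp add: distrib_left)
  also have "convol (gauss h) (convol (gauss t0) v0) x = convol (gauss (t0 + h)) v0 x"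
  proof -
    have "convol (gauss h) (gauss t0) = (gauss (t0 + h) :: 'a \<Rightarrow> real)"
      using convol_gauss_gauss[OF h t0] by (auto simp: add.commute)
    thus ?thesis using convol_assoc[OF _ gh L1Linf_gauss[OF t0] L1LinfD(6)[OF v0], where x=x] by simp
  qed
  also have "convol (gauss h) (duhamel a g t0) x = (LBINT s:{0<..<t0}. convol (dgauss a (t0 + h - s)) (g s) x)"
  proof -
    have "convol (gauss h) (duhamel a g t0) x = (LINT y|lborel. LINT s|lborel. gauss h (x - y) * ?G s y)"
      unfolding convol_def[of "gauss h"] duhamel_def set_lebesgue_integral_def by simp
    also have "\<dots> = (LINT s|lborel. LINT y|lborel. gauss h (x - y) * ?G s y)"
    \<comment> \<open>Fubini is justified by the sup of \<open>gauss h\<close>, finite because h >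
      0, and the integrable singularity (t0 - s)^(-1/2).\<close>
    proof (rule integral_lborel_swap)
      show "(\<lambda>(s, y). gauss h (x - y) * (indicator {0<..<t0} s * convol (dgauss a (t0 - s)) (g s) y)) \<in> borel_measurable (borel \<Otimes>\<^sub>M borel)"
        by measurable
      define c where "c = (4 * pi * h) powr (- real DIM('a) / 2)"
      define \<beta> where "\<beta> s = dgauss_const a * A * (t0 - s) powr (- 1 / 2)" for s
      have c: "0 \<le> c" by (simp add: c_def)
      have \<beta>: "0 \<le> \<beta> s" for s using A dgauss_const_nonneg[of a] by (simp add: \<beta>_def)
      have "(\<integral>\<^sup>+ s. \<integral>\<^sup>+ y. ennreal \<bar>gauss h (x - y) * ?G s y\<bar> \<partial>lborel \<partial>lborel) \<le> (\<integral>\<^sup>+ s. ennreal c * ennreal (indicator {0<..<t0} s * \<beta> s) \<partial>lborel)"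
      proof (rule nn_integral_mono)
        fix s
        show "(\<integral>\<^sup>+ y. ennreal \<bar>gauss h (x - y) * ?G s y\<bar> \<partial>lborel) \<le> ennreal c * ennreal (indicator {0<..<t0} s * \<beta> s)"
        proof (cases "s \<in> {0<..<t0}")
          case False thus ?thesis by simp
        next
          case True
          have L: "L1Linf (convol (dgauss a (t0 - s)) (g s)) (\<beta> s) (\<beta> s)"
            using L1Linf_convol_dgauss[of "t0 - s" "g s" A A a] g[of s] True by (simp add: \<beta>_def ac_simps)
          have Lm: "convol (dgauss a (t0 - s)) (g s) \<in> borel_measurable borel" by (rule L1LinfD(1)[OF L])
          have "(\<integral>\<^sup>+ y. ennreal \<bar>gauss h (x - y) * ?G s y\<bar> \<partial>lborel) \<le> (\<integral>\<^sup>+ y. ennreal c * ennreal \<bar>convol (dgauss a (t0 - s)) (g s) y\<bar> \<partial>lborel)"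
            using True gh c by (intro nn_integral_mono) (auto simp: ennreal_mult[symmetric] abs_mult c_def intro!: ennreal_leI mult_right_mono)
          also have "\<dots> = ennreal c * (\<integral>\<^sup>+ y. ennreal \<bar>convol (dgauss a (t0 - s)) (g s) y\<bar> \<partial>lborel)"
            using Lm by (intro nn_integral_cmult) auto
          also have "\<dots> \<le> ennreal c * ennreal (\<beta> s)" by (intro mult_left_mono L1LinfD(3)[OF L]) auto
          finally show ?thesis using True by simp
        qed
      qed
      also have "\<dots> = ennreal c * (\<integral>\<^sup>+ s. ennreal (indicator {0<..<t0} s * \<beta> s) \<partial>lborel)"
        by (rule nn_integral_cmult) (unfold \<beta>_def, measurable)
      also have "\<dots> < \<infinity>"
      proof -
        have hi: "(\<beta> has_integral dgauss_const a * A * (t0 powr (- 1 / 2 + 1) / (- 1 / 2 + 1))) {0..t0}"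
          unfolding \<beta>_def[abs_def] using t0 by (intro has_integral_mult_right has_integral_powr_reflect) auto
        show ?thesis using nn_integral_has_integral_indicator(1)[OF hi \<beta>]
          by (auto simp: ennreal_mult_less_top intro: le_less_trans)
      qed
      finally show "(\<integral>\<^sup>+ s. \<integral>\<^sup>+ y. ennreal \<bar>gauss h (x - y) * ?G s y\<bar> \<partial>lborel \<partial>lborel) < \<infinity>" .
    qed
    also have "\<dots> = (LINT s|lborel. indicator {0<..<t0} s *\<^sub>R convol (dgauss a (t0 + h - s)) (g s) x)"
    proof (rule Bochner_Integration.integral_cong[OF refl])
      fix s
      show "(LINT y|lborel. gauss h (x - y) * ?G s y) = indicator {0<..<t0} s *\<^sub>R convol (dgauss a (t0 + h - s)) (g s) x"
      proof (cases "s \<in> {0<..<t0}")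
        case True
        hence ts: "t0 - s > 0" by simp
        have "convol (gauss h) (dgauss a (t0 - s)) = dgauss a (t0 + h - s)"
          using convol_gauss_dgauss[OF h ts, of a] by (auto simp: algebra_simps)
        hence "convol (gauss h) (convol (dgauss a (t0 - s)) (g s)) x = convol (dgauss a (t0 + h - s)) (g s) x"
          using convol_assoc[OF _ gh L1Linf_dgauss[OF ts, of a] L1LinfD(6)[OF g[of s]], where x=x] True by simp
        thus ?thesis using True unfolding convol_def[of "gauss h"] by simp
      qed simp
    qed
    finally show ?thesis unfolding set_lebesgue_integral_def .
  qed
  finally have 1: "convol (gauss h) (V t0) x = convol (gauss (t0 + h)) v0 x + (LBINT s:{0<..<t0}. convol (dgauss a (t0 + h - s)) (g s) x)" .
  let ?F = "\<lambda>s. convol (dgauss a (t0 + h - s)) (g s) x"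
  have mF: "?F \<in> borel_measurable borel" by (rule convol_dgauss_measurable[OF gm]) measurable
  have si: "set_integrable lborel {0<..<t0 + h} ?F"
    by (rule L1Linf_duhamel(2)[OF gm g A]) (use t0 h in auto)
  have "duhamel a g (t0 + h) x = (LBINT s:{0<..<t0}. ?F s) + (LBINT s:{t0<..<t0 + h}. ?F s)"
    unfolding duhamel_def by (rule set_integral_split[OF t0 _ si]) (use h in simp)
  also have "(LBINT s:{t0<..<t0 + h}. ?F s) = duhamel a (\<lambda>s. g (t0 + s)) h x"
  proof -
    have "(LINT s|lborel. indicator {t0<..<t0 + h} s *\<^sub>R ?F s) = (LINT s|lborel. indicator {t0<..<t0 + h} (s + t0) *\<^sub>R ?F (s + t0))"
      by (rule integral_lborel_shift[symmetric, of "\<lambda>s. indicator {t0<..<t0 + h} s *\<^sub>R ?F s"]) (use mF in measurable)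
    also have "\<dots> = (LINT s|lborel. indicator {0<..<h} s *\<^sub>R convol (dgauss a (h - s)) (g (t0 + s)) x)"
      by (intro Bochner_Integration.integral_cong refl) (auto simp: indicator_def add.commute)
    finally show ?thesis unfolding duhamel_def set_lebesgue_integral_def .
  qed
  finally have 2: "duhamel a g (t0 + h) x = (LBINT s:{0<..<t0}. ?F s) + duhamel a (\<lambda>s. g (t0 + s)) h x" .
  show ?thesis using 1 2 V[of "t0 + h" x] t0 h by simp
qed

section \<open>A jointly measurable, everywhere bounded representative of the solution\<close>

lemma Lnorm_1_iff:
  assumes "g \<in> borel_measurable lebesgue" "0 \<le> A"
  shows "Lnorm 1 g \<le> ereal A \<longleftrightarrow> (\<integral>\<^sup>+x. ennreal \<bar>g x\<bar> \<partial>lebesgue) \<le> ennreal A"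
proof -
  define I where "I = (\<integral>\<^sup>+x. ennreal \<bar>g x\<bar> \<partial>lebesgue)"
  have "Lnorm 1 g = (if I \<noteq> \<infinity> then ereal (enn2real I) else \<infinity>)"
    using assms by (simp add: Lnorm_def I_def Let_def)
  thus ?thesis unfolding I_def[symmetric] using assms(2)
    by (cases I) (auto simp: top_unique)
qed

lemma Lnorm_inf_AE: "Lnorm \<infinity> g \<le> ereal A \<Longrightarrow> AE x in lebesgue. \<bar>g x\<bar> \<le> A"
  using esssup_AE[of "\<lambda>x. ereal \<bar>g x\<bar>" lebesgue] unfolding Lnorm_def
  by (auto elim!: eventually_mono dest: order_trans)

lemma lip_local:
  fixes f :: "real \<Rightarrow> real"
  assumes lip: "\<And>\<xi> \<eta>. \<bar>f \<xi> - f \<eta>\<bar> \<le> L * (\<bar>\<xi>\<bar> powr (p - 1) + \<bar>\<eta>\<bar> powr (p - 1)) * \<bar>\<xi> - \<eta>\<bar>"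
    and L: "0 \<le> L" and p: "p > 1" and "\<bar>\<xi>\<bar> \<le> R" "\<bar>\<eta>\<bar> \<le> R"
  shows "\<bar>f \<xi> - f \<eta>\<bar> \<le> 2 * L * R powr (p - 1) * \<bar>\<xi> - \<eta>\<bar>"
proof -
  have "\<bar>\<xi>\<bar> powr (p - 1) + \<bar>\<eta>\<bar> powr (p - 1) \<le> R powr (p - 1) + R powr (p - 1)"
    using assms by (intro add_mono powr_mono2) auto
  hence "L * (\<bar>\<xi>\<bar> powr (p - 1) + \<bar>\<eta>\<bar> powr (p - 1)) * \<bar>\<xi> - \<eta>\<bar> \<le> L * (R powr (p - 1) + R powr (p - 1)) * \<bar>\<xi> - \<eta>\<bar>"
    using L by (intro mult_right_mono mult_left_mono) auto
  thus ?thesis using lip[of \<xi> \<eta>] by (simp add: algebra_simps)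
qed

text \<open>The triple w stands for (t, s, x). A change of g s is controlled by the sup of the
  kernel and the L1 continuity of g, a change of the kernel by dominated convergence.\<close>

lemma convol_dgauss_continuous:
  fixes a :: "'a::euclidean_space" and g :: "real \<Rightarrow> 'a \<Rightarrow> real"
  assumes gi: "\<And>s. 0 < s \<Longrightarrow> integrable lborel (g s)"
    and gc: "\<And>s0 S. 0 < s0 \<Longrightarrow> (\<And>m. 0 < S m) \<Longrightarrow> S \<longlonglongrightarrow> s0 \<Longrightarrow> (\<lambda>m. LINT y|lborel. \<bar>g (S m) y - g s0 y\<bar>) \<longlonglongrightarrow> 0"
  shows "continuous_on {w. 0 < fst (snd w) \<and> fst (snd w) < fst w} (\<lambda>w. convol (dgauss a (fst w - fst (snd w))) (g (fst (snd w))) (snd (snd w)))"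
  unfolding continuous_on_sequentially
proof (intro allI ballI impI)
  fix W :: "nat \<Rightarrow> real \<times> real \<times> 'a" and w0
  assume w0: "w0 \<in> {w. 0 < fst (snd w) \<and> fst (snd w) < fst w}"
    and W: "(\<forall>n. W n \<in> {w. 0 < fst (snd w) \<and> fst (snd w) < fst w}) \<and> W \<longlonglongrightarrow> w0"
  define \<tau> where "\<tau> m = fst (W m) - fst (snd (W m))" for m
  define S where "S m = fst (snd (W m))" for m
  define X where "X m = snd (snd (W m))" for m
  define \<tau>0 where "\<tau>0 = fst w0 - fst (snd w0)"
  define s0 where "s0 = fst (snd w0)"
  define x0 where "x0 = snd (snd w0)"
  have lim: "\<tau> \<longlonglongrightarrow> \<tau>0" "S \<longlonglongrightarrow> s0" "X \<longlonglongrightarrow> x0"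
    using W unfolding \<tau>_def \<tau>0_def S_def s0_def X_def x0_def by (auto intro!: tendsto_intros)
  have pos: "\<tau>0 > 0" "s0 > 0" "\<And>m. \<tau> m > 0" "\<And>m. S m > 0"
    using w0 W unfolding \<tau>_def \<tau>0_def S_def s0_def by auto
  note g0 = gi[OF pos(2)]
  have g0m[measurable]: "g s0 \<in> borel_measurable borel" using g0 by auto
  define q where "q m = dgauss_const a * \<tau> m powr (- 1 / 2 - real DIM('a) / 2)" for m
  have ql: "q \<longlonglongrightarrow> dgauss_const a * \<tau>0 powr (- 1 / 2 - real DIM('a) / 2)"
    unfolding q_def using pos(1) by (intro tendsto_intros lim) auto
  have qb: "\<bar>dgauss a (\<tau> m) z\<bar> \<le> q m" for m z
    unfolding q_def by (rule abs_dgauss_le_sup[OF pos(3)])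
  obtain Q where Q: "\<And>m. norm (q m) \<le> Q" using convergent_imp_Bseq[OF convergentI[OF ql]] by (auto simp: Bseq_def)
  have l1: "(\<lambda>m. convol (dgauss a (\<tau> m)) (\<lambda>y. g (S m) y - g s0 y) (X m)) \<longlonglongrightarrow> 0"
  proof (rule Lim_null_comparison)
    show "\<forall>\<^sub>F m in sequentially. norm (convol (dgauss a (\<tau> m)) (\<lambda>y. g (S m) y - g s0 y) (X m)) \<le> q m * (LINT y|lborel. \<bar>g (S m) y - g s0 y\<bar>)"
    proof (rule eventuallyI)
      fix m
      show "norm (convol (dgauss a (\<tau> m)) (\<lambda>y. g (S m) y - g s0 y) (X m)) \<le> q m * (LINT y|lborel. \<bar>g (S m) y - g s0 y\<bar>)"
        unfolding real_norm_def by (rule abs_convol_le[OF _ qb]) (use gi[OF pos(4)] g0 in auto)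
    qed
    show "(\<lambda>m. q m * (LINT y|lborel. \<bar>g (S m) y - g s0 y\<bar>)) \<longlonglongrightarrow> 0"
      using tendsto_mult[OF ql gc[OF pos(2) pos(4) lim(2)]] by simp
  qed
  have l2: "(\<lambda>m. convol (dgauss a (\<tau> m)) (g s0) (X m)) \<longlonglongrightarrow> convol (dgauss a \<tau>0) (g s0) x0"
    unfolding convol_def
  proof (rule integral_dominated_convergence[where w="\<lambda>y. Q * \<bar>g s0 y\<bar>"])
    show "AE y in lborel. (\<lambda>m. dgauss a (\<tau> m) (X m - y) * g s0 y) \<longlonglongrightarrow> dgauss a \<tau>0 (x0 - y) * g s0 y"
      unfolding dgauss_def gauss_def using pos(1) by (intro AE_I2 tendsto_intros lim) auto
    show "AE y in lborel. norm (dgauss a (\<tau> m) (X m - y) * g s0 y) \<le> Q * \<bar>g s0 y\<bar>" for m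
    proof (rule AE_I2)
      fix y
      have "\<bar>dgauss a (\<tau> m) (X m - y)\<bar> \<le> Q" using qb[of m "X m - y"] Q[of m] by simp
      thus "norm (dgauss a (\<tau> m) (X m - y) * g s0 y) \<le> Q * \<bar>g s0 y\<bar>" by (simp add: abs_mult mult_right_mono)
    qed
  qed (use g0 in auto)
  have "convol (dgauss a (\<tau> m)) (g (S m)) (X m) = convol (dgauss a (\<tau> m)) (\<lambda>y. g (S m) y - g s0 y) (X m) + convol (dgauss a (\<tau> m)) (g s0) (X m)" for m
    using convol_diff_right[of "dgauss a (\<tau> m)" "q m", OF _ qb gi[OF pos(4)] g0] by simp
  hence "(\<lambda>m. convol (dgauss a (\<tau> m)) (g (S m)) (X m)) \<longlonglongrightarrow> convol (dgauss a \<tau>0) (g s0) x0"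
    using tendsto_add[OF l1 l2] by simp
  thus "((\<lambda>w. convol (dgauss a (fst w - fst (snd w))) (g (fst (snd w))) (snd (snd w))) \<circ> W) \<longlonglongrightarrow>
      convol (dgauss a (fst w0 - fst (snd w0))) (g (fst (snd w0))) (snd (snd w0))"
    unfolding comp_def \<tau>_def S_def X_def \<tau>0_def s0_def x0_def .
qed

text \<open>The representative is defined by the Duhamel formula itself, which therefore holds pointwise; it is jointly
  measurable because the Duhamel integrand is continuous in all variables.\<close>

lemma mild_solution_representative:
  fixes a :: "'a::euclidean_space" and f :: "real \<Rightarrow> real"
  assumes f_cont: "continuous_on UNIV f" and f_0: "f 0 = 0"
    and lip: "\<And>\<xi> \<eta>. \<bar>f \<xi> - f \<eta>\<bar> \<le> L * (\<bar>\<xi>\<bar> powr (p - 1) + \<bar>\<eta>\<bar> powr (p - 1)) * \<bar>\<xi> - \<eta>\<bar>"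
    and L: "0 \<le> L" and p: "p > 1"
    and v0: "L1Linf v0 M0 M0" and u0: "u0 \<in> borel_measurable lebesgue" "AE x in lebesgue. u0 x = v0 x"
    and sol: "is_global_solution a f u0 u"
  obtains v M where
    "(\<lambda>(t,x). v t x) \<in> borel_measurable (borel \<Otimes>\<^sub>M borel)"
    "\<And>t. 0 < t \<Longrightarrow> AE x in lebesgue. u t x = v t x"
    "\<And>t. 0 < t \<Longrightarrow> L1Linf (v t) M M"
    "\<And>t x. 0 < t \<Longrightarrow> v t x = convol (gauss t) v0 x + duhamel a (\<lambda>s y. f (v s y)) t x"
proof -
  have fm[measurable]: "f \<in> borel_measurable borel" using f_cont by (rule borel_measurable_continuous_onI)
  have v0m[measurable]: "v0 \<in> borel_measurable borel" by (rule L1LinfD(1)[OF v0])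
  have ui: "\<And>t. t \<ge> 0 \<Longrightarrow> integrable lebesgue (u t)"
    and uc: "\<And>t0. t0 \<ge> 0 \<Longrightarrow> ((\<lambda>t. Lnorm 1 (\<lambda>x. u t x - u t0 x)) \<longlongrightarrow> 0) (at t0 within {0..})"
    and dsol: "\<And>t. t > 0 \<Longrightarrow> AE x in lebesgue.
        u t x = heat t u0 x + (LBINT s=ereal 0..ereal t. dderiv a (heat (t - s) (\<lambda>y. f (u s y))) x)"
    using sol unfolding is_global_solution_def by auto
  obtain A1 where A1: "\<And>t. t \<ge> 0 \<Longrightarrow> Lnorm 1 (u t) \<le> ereal A1"
    using sol unfolding is_global_solution_def by blast
  obtain A2 where A2: "\<And>t. t > 0 \<Longrightarrow> Lnorm \<infinity> (u t) \<le> ereal A2"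
    using sol unfolding is_global_solution_def by blast
  define M1 where "M1 = max 0 (max A1 A2)"
  have M1: "0 \<le> M1" by (simp add: M1_def)
  have um: "u t \<in> borel_measurable lebesgue" if "t > 0" for t using ui[of t] that by auto
  have uL1: "(\<integral>\<^sup>+x. ennreal \<bar>u t x\<bar> \<partial>lebesgue) \<le> ennreal M1" if "t > 0" for t
  proof -
    have "ereal A1 \<le> ereal M1" by (simp add: M1_def del: ereal_max)
    hence "Lnorm 1 (u t) \<le> ereal M1" using A1[of t] that by (simp add: order_trans)
    thus ?thesis using Lnorm_1_iff[OF um[OF that] M1] by simp
  qed
  have uLi: "AE x in lebesgue. \<bar>u t x\<bar> \<le> M1" if "t > 0" for t
  proof (rule Lnorm_inf_AE)
    have "ereal A2 \<le> ereal M1" by (simp add: M1_def del: ereal_max)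
    thus "Lnorm \<infinity> (u t) \<le> ereal M1" using A2[OF that] by (simp add: order_trans)
  qed
  have "\<exists>w. w \<in> borel_measurable borel \<and> (AE x in lebesgue. u t x = w x) \<and> (\<forall>x. \<bar>w x\<bar> \<le> M1)" if "t > 0" for t
  proof -
    obtain w where w: "w \<in> borel_measurable lborel" "AE x in lborel. u t x = w x"
      using completion_ex_borel_measurable_real[OF um[OF \<open>t > 0\<close>]] by blast
    have "AE x in lebesgue. u t x = w x" using w(2) by (rule AE_completion)
    \<comment> \<open>Clipping at the essential bound makes the representative bounded at every
      point.\<close>
    hence "AE x in lebesgue. u t x = max (- M1) (min M1 (w x))"
      using uLi[OF that] by eventually_elim auto
    moreover have "(\<lambda>x. max (- M1) (min M1 (w x))) \<in> borel_measurable borel" using w(1) by simp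
    ultimately show ?thesis using M1 by (intro exI[of _ "\<lambda>x. max (- M1) (min M1 (w x))"]) auto
  qed
  then obtain w where w: "\<And>t. t > 0 \<Longrightarrow> w t \<in> borel_measurable borel" "\<And>t. t > 0 \<Longrightarrow> AE x in lebesgue. u t x = w t x"
      "\<And>t x. t > 0 \<Longrightarrow> \<bar>w t x\<bar> \<le> M1"
    by metis
  have wL: "L1Linf (w t) M1 M1" if "t > 0" for t
  proof -
    have "(\<integral>\<^sup>+x. ennreal \<bar>w t x\<bar> \<partial>lborel) = (\<integral>\<^sup>+x. ennreal \<bar>w t x\<bar> \<partial>lebesgue)" by (simp add: nn_integral_completion)
    also have "\<dots> = (\<integral>\<^sup>+x. ennreal \<bar>u t x\<bar> \<partial>lebesgue)"
      using w(2)[OF that] by (intro nn_integral_cong_AE) (auto elim: eventually_mono)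
    finally show ?thesis using uL1[OF that] w(1,3)[OF that] M1 by (auto simp: L1Linf_def)
  qed
  define \<Lambda> where "\<Lambda> = 2 * L * M1 powr (p - 1)"
  have \<Lambda>: "0 \<le> \<Lambda>" using L by (simp add: \<Lambda>_def)
  have fl: "\<bar>f \<xi> - f \<eta>\<bar> \<le> \<Lambda> * \<bar>\<xi> - \<eta>\<bar>" if "\<bar>\<xi>\<bar> \<le> M1" "\<bar>\<eta>\<bar> \<le> M1" for \<xi> \<eta>
    unfolding \<Lambda>_def using lip_local[OF lip L p that] .
  have f1: "\<bar>f \<xi>\<bar> \<le> \<Lambda> * \<bar>\<xi>\<bar>" if "\<bar>\<xi>\<bar> \<le> M1" for \<xi> using fl[OF that, of 0] M1 f_0 by simp
  have gL: "L1Linf (\<lambda>y. f (w s y)) (\<Lambda> * M1) (\<Lambda> * M1)" if "s > 0" for s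
    by (rule L1Linf_dominated[OF wL[OF that]]) (use w(1)[OF that] f1 w(3)[OF that] \<Lambda> in auto)
  have gc: "(\<lambda>m. LINT y|lborel. \<bar>f (w (S m) y) - f (w s0 y)\<bar>) \<longlonglongrightarrow> 0"
    if s0: "0 < s0" and S: "\<And>m. 0 < S m" "S \<longlonglongrightarrow> s0" for s0 S
  proof -
    \<comment> \<open>The limit in the definition of a solution leaves out s0 itself, whereas S may
      hit s0. As the norm of the difference is 0 at s0, the limit is continuity at s0 and passes to
      every sequence.\<close>
    have lim: "(\<lambda>m. Lnorm 1 (\<lambda>x. u (S m) x - u s0 x)) \<longlonglongrightarrow> 0"
    proof -
      have "((\<lambda>t. Lnorm 1 (\<lambda>x. u t x - u s0 x)) \<longlongrightarrow> Lnorm 1 (\<lambda>x. u s0 x - u s0 x)) (at s0 within {0..})"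
        using uc[of s0] s0 by (simp add: Lnorm_def zero_ereal_def)
      hence "continuous (at s0 within {0..}) (\<lambda>t. Lnorm 1 (\<lambda>x. u t x - u s0 x))" by (simp add: continuous_within)
      hence "((\<lambda>t. Lnorm 1 (\<lambda>x. u t x - u s0 x)) \<circ> S) \<longlonglongrightarrow> Lnorm 1 (\<lambda>x. u s0 x - u s0 x)"
        using S s0 unfolding continuous_within_sequentially by (auto intro: less_imp_le)
      thus ?thesis by (simp add: comp_def Lnorm_def zero_ereal_def)
    qed
    define D where "D m = (LINT y|lborel. \<bar>w (S m) y - w s0 y\<bar>)" for m
    have DL: "Lnorm 1 (\<lambda>x. u (S m) x - u s0 x) = ereal (D m)" for m
    proof -
      have i: "integrable lborel (\<lambda>y. \<bar>w (S m) y - w s0 y\<bar>)"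
        using L1LinfD(6)[OF wL[OF S(1)[of m]]] L1LinfD(6)[OF wL[OF s0]] by auto
      have "(\<integral>\<^sup>+x. ennreal \<bar>u (S m) x - u s0 x\<bar> \<partial>lebesgue) = (\<integral>\<^sup>+x. ennreal \<bar>w (S m) x - w s0 x\<bar> \<partial>lebesgue)"
      proof (rule nn_integral_cong_AE)
        show "AE x in lebesgue. ennreal \<bar>u (S m) x - u s0 x\<bar> = ennreal \<bar>w (S m) x - w s0 x\<bar>"
          using w(2)[OF S(1)[of m]] w(2)[OF s0] by eventually_elim auto
      qed
      also have "\<dots> = ennreal (D m)"
        unfolding D_def using i by (simp add: nn_integral_completion nn_integral_eq_integral)
      finally have 1: "(\<integral>\<^sup>+x. ennreal \<bar>u (S m) x - u s0 x\<bar> \<partial>lebesgue) = ennreal (D m)" .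
      have "0 \<le> D m" unfolding D_def by (rule integral_nonneg_AE) auto
      thus ?thesis using 1 um[OF S(1)[of m]] um[OF s0] by (simp add: Lnorm_def Let_def)
    qed
    have D0: "D \<longlonglongrightarrow> 0" using lim unfolding DL zero_ereal_def by simp
    show ?thesis
    proof (rule Lim_null_comparison)
      show "(\<lambda>m. \<Lambda> * D m) \<longlonglongrightarrow> 0" using tendsto_mult_left[OF D0, of \<Lambda>] by simp
      show "\<forall>\<^sub>F m in sequentially. norm (LINT y|lborel. \<bar>f (w (S m) y) - f (w s0 y)\<bar>) \<le> \<Lambda> * D m"
      proof (rule eventuallyI)
        fix m
        have "(LINT y|lborel. \<bar>f (w (S m) y) - f (w s0 y)\<bar>) \<le> (LINT y|lborel. \<Lambda> * \<bar>w (S m) y - w s0 y\<bar>)"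
          using L1LinfD(6)[OF wL[OF S(1)[of m]]] L1LinfD(6)[OF wL[OF s0]] L1LinfD(6)[OF gL[OF S(1)[of m]]] L1LinfD(6)[OF gL[OF s0]]
            w(3) S(1) s0
          by (intro integral_mono fl) auto
        thus "norm (LINT y|lborel. \<bar>f (w (S m) y) - f (w s0 y)\<bar>) \<le> \<Lambda> * D m" unfolding D_def by simp
      qed
    qed
  qed
  let ?S = "{q::real \<times> real \<times> 'a. 0 < fst (snd q) \<and> fst (snd q) < fst q}"
  let ?\<Phi> = "\<lambda>q. convol (dgauss a (fst q - fst (snd q))) (\<lambda>y. f (w (fst (snd q)) y)) (snd (snd q))"
  have "continuous_on ?S ?\<Phi>"
    by (rule convol_dgauss_continuous) (use L1LinfD(6)[OF gL] gc in auto)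
  moreover have "?S \<in> sets borel"
    by (intro borel_open open_Collect_conj open_Collect_less continuous_intros)
  ultimately have \<Psi>0: "(\<lambda>q. indicator ?S q *\<^sub>R ?\<Phi> q) \<in> borel_measurable borel"
    by (intro borel_measurable_continuous_on_indicator)
  define \<Psi> where "\<Psi> = (\<lambda>q. indicator ?S q *\<^sub>R ?\<Phi> q)"
  have \<Psi>m[measurable]: "\<Psi> \<in> borel_measurable (borel \<Otimes>\<^sub>M (borel \<Otimes>\<^sub>M borel))"
    using \<Psi>0 by (simp add: borel_prod \<Psi>_def)
  \<comment> \<open>\<open>w t\<close> is chosen separately for every t and need not be measurable
    in t; only the measurable \<Psi> enters \<open>v\<close>.\<close>
  define v where "v t x = (if t > 0 then convol (gauss t) v0 x + (LINT s|lborel. \<Psi> (t, s, x)) else 0)" for t x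
  have m1: "(\<lambda>z. (LINT s|lborel. \<Psi> (fst z, s, snd z))) \<in> borel_measurable (borel \<Otimes>\<^sub>M borel)"
    by measurable
  have m2: "(\<lambda>z. convol (gauss (fst z)) v0 (snd z)) \<in> borel_measurable (borel \<Otimes>\<^sub>M borel)"
    by (rule convol_measurable) measurable
  have m3: "{z \<in> space (borel \<Otimes>\<^sub>M (borel :: 'a measure)). (0::real) < fst z} \<in> sets (borel \<Otimes>\<^sub>M borel)"
    by measurable
  have vm: "(\<lambda>(t,x). v t x) \<in> borel_measurable (borel \<Otimes>\<^sub>M borel)"
    unfolding v_def case_prod_unfold by (rule measurable_If[OF borel_measurable_add[OF m2 m1] borel_measurable_const m3])
  note [measurable] = vm
  have v_w: "v t x = convol (gauss t) v0 x + (LBINT s:{0<..<t}. convol (dgauss a (t - s)) (\<lambda>y. f (w s y)) x)" if "t > 0" for t x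
  proof -
    have "\<Psi> (t, s, x) = indicator {0<..<t} s *\<^sub>R convol (dgauss a (t - s)) (\<lambda>y. f (w s y)) x" for s
      by (simp add: \<Psi>_def indicator_def)
    thus ?thesis unfolding v_def set_lebesgue_integral_def using that by presburger
  qed
  have u_v: "AE x in lebesgue. u t x = v t x" if t: "t > 0" for t
    using dsol[OF t]
  proof eventually_elim
    case (elim x)
    have "heat t u0 x = convol (gauss t) v0 x" by (rule heat_eq_convol[OF t u0(1) v0m u0(2)])
    moreover have "(LBINT s=ereal 0..ereal t. dderiv a (heat (t - s) (\<lambda>y. f (u s y))) x) = (LBINT s:{0<..<t}. convol (dgauss a (t - s)) (\<lambda>y. f (w s y)) x)"
    proof -
      have "dderiv a (heat (t - s) (\<lambda>y. f (u s y))) x = convol (dgauss a (t - s)) (\<lambda>y. f (w s y)) x" if "s \<in> {0<..<t}" for s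
      proof (rule dderiv_heat_eq_convol)
        show "(\<lambda>y. f (u s y)) \<in> borel_measurable lebesgue" using um[of s] that by simp
        show "AE y in lebesgue. f (u s y) = f (w s y)" using w(2)[of s] that by (auto elim: eventually_mono)
      qed (use that L1LinfD(6)[OF gL] in auto)
      thus ?thesis using t unfolding interval_lebesgue_integral_def
        by (auto intro!: set_lebesgue_integral_cong)
    qed
    ultimately show ?case using elim v_w[OF t] by simp
  qed
  have vL1: "(\<integral>\<^sup>+x. ennreal \<bar>v t x\<bar> \<partial>lborel) \<le> ennreal M1" if "t > 0" for t
  proof -
    have "(\<integral>\<^sup>+x. ennreal \<bar>v t x\<bar> \<partial>lborel) = (\<integral>\<^sup>+x. ennreal \<bar>v t x\<bar> \<partial>lebesgue)" by (simp add: nn_integral_completion)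
    also have "\<dots> = (\<integral>\<^sup>+x. ennreal \<bar>u t x\<bar> \<partial>lebesgue)"
      using u_v[OF that] by (intro nn_integral_cong_AE) (auto elim: eventually_mono)
    finally show ?thesis using uL1[OF that] by simp
  qed
  have w_v: "AE x in lborel. w t x = v t x" if "t > 0" for t
  proof -
    have "AE x in lebesgue. w t x = v t x" using u_v[OF that] w(2)[OF that] by eventually_elim auto
    thus ?thesis by (simp add: AE_completion_iff)
  qed
  \<comment> \<open>At this stage the bound M1 for \<open>v\<close> is known only almost everywhere.
    Clipping before applying f gives a source bounded at every point and leaves all convolutions
    unchanged.\<close>
  define g where "g s y = f (max (- M1) (min M1 (v s y)))" for s y
  have gm[measurable]: "(\<lambda>(s,y). g s y) \<in> borel_measurable (borel \<Otimes>\<^sub>M borel)" unfolding g_def by measurable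
  have conv_wv: "convol (dgauss a \<tau>) (\<lambda>y. f (w s y)) x = convol (dgauss a \<tau>) (\<lambda>y. f (v s y)) x"
     "convol (dgauss a \<tau>) (\<lambda>y. f (w s y)) x = convol (dgauss a \<tau>) (g s) x" if "s > 0" for s \<tau> x
  proof -
    have [measurable]: "w s \<in> borel_measurable borel" by (rule w(1)[OF that])
    have [measurable]: "g s \<in> borel_measurable borel" by measurable
    show "convol (dgauss a \<tau>) (\<lambda>y. f (w s y)) x = convol (dgauss a \<tau>) (\<lambda>y. f (v s y)) x"
      using w_v[OF that] by (intro convol_cong_AE) (auto elim: eventually_mono)
    have "AE y in lborel. f (w s y) = g s y" using w_v[OF that]
    proof eventually_elim
      case (elim y) thus ?case using w(3)[OF that, of y] unfolding g_def by (auto simp: max_def min_def)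
    qed
    thus "convol (dgauss a \<tau>) (\<lambda>y. f (w s y)) x = convol (dgauss a \<tau>) (g s) x"
      by (intro convol_cong_AE) auto
  qed
  have v_g: "v t x = convol (gauss t) v0 x + duhamel a g t x" if "t > 0" for t x
    unfolding v_w[OF that] duhamel_def using conv_wv(2) by (auto intro!: set_lebesgue_integral_cong)
  have v_v: "v t x = convol (gauss t) v0 x + duhamel a (\<lambda>s y. f (v s y)) t x" if "t > 0" for t x
    unfolding v_w[OF that] duhamel_def using conv_wv(1) by (auto intro!: set_lebesgue_integral_cong)
  have gL2: "L1Linf (g s) (\<Lambda> * M1) (\<Lambda> * M1)" if "s > 0" for s
  proof -
    have 1: "\<bar>g s y\<bar> \<le> \<Lambda> * \<bar>max (- M1) (min M1 (v s y))\<bar>" for y unfolding g_def by (rule f1) (use M1 in auto)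
    have 2: "\<bar>max (- M1) (min M1 (v s y))\<bar> \<le> \<bar>v s y\<bar>" for y using M1 by auto
    have "L1Linf (\<lambda>y. max (- M1) (min M1 (v s y))) M1 M1"
      unfolding L1Linf_def using M1 by (auto intro!: order.trans[OF nn_integral_mono vL1[OF that]] ennreal_leI)
    thus ?thesis by (rule L1Linf_dominated) (use 1 \<Lambda> in auto)
  qed
  have A: "0 \<le> \<Lambda> * M1" using \<Lambda> M1 by simp
  define B where "B = 2 * dgauss_const a * (\<Lambda> * M1) * 1"
  have duB: "\<bar>duhamel a g' t x\<bar> \<le> B"
    if "0 < t" "t \<le> 1" "(\<lambda>(s,y). g' s y) \<in> borel_measurable (borel \<Otimes>\<^sub>M borel)" "\<And>s. 0 < s \<Longrightarrow> L1Linf (g' s) (\<Lambda> * M1) (\<Lambda> * M1)" for g' t x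
  proof -
    have "\<bar>duhamel a g' t x\<bar> \<le> 2 * dgauss_const a * (\<Lambda> * M1) * t powr (1 / 2)"
      using L1LinfD(4)[OF L1Linf_duhamel(1)[OF that(3) that(4) A]] that by auto
    also have "\<dots> \<le> B" unfolding B_def
      by (intro mult_left_mono) (use that A dgauss_const_nonneg[of a] in \<open>auto simp: powr_le1\<close>)
    finally show ?thesis .
  qed
  \<comment> \<open>The bound for a Duhamel integral from 0 grows like t^(1/2). Beyond t = 1 the
    formula is restarted at t - 1, so that only a window of unit length contributes.\<close>
  have vB: "\<bar>v t x\<bar> \<le> M0 + M1 + B" if t: "t > 0" for t x
  proof (cases "t \<le> 1")
    case True
    have "\<bar>convol (gauss t) v0 x\<bar> \<le> M0" by (rule L1LinfD(4)[OF L1Linf_convol_gauss[OF t v0]])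
    thus ?thesis using v_g[OF t, of x] duB[OF t True gm gL2, of x] M1 by linarith
  next
    case False
    define s where "s = t - 1"
    have s: "s > 0" "t = s + 1" using False by (auto simp: s_def)
    have "v (s + 1) x = convol (gauss 1) (v s) x + duhamel a (\<lambda>r. g (s + r)) 1 x"
      by (rule duhamel_restart[OF gm gL2 v0 v_g s(1)]) auto
    moreover have "\<bar>duhamel a (\<lambda>r. g (s + r)) 1 x\<bar> \<le> B"
      by (rule duB) (use gL2 s in auto)
    moreover have "convol (gauss 1) (v s) x = convol (gauss 1) (w s) x"
      using w_v[OF s(1)] w(1)[OF s(1)] by (intro convol_cong_AE) (auto elim: eventually_mono)
    moreover have "\<bar>convol (gauss 1) (w s) x\<bar> \<le> M1" by (rule L1LinfD(4)[OF L1Linf_convol_gauss[OF _ wL[OF s(1)]]]) simp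
    ultimately show ?thesis using s(2) L1LinfD(2)[OF v0] by simp
  qed
  have B0: "0 \<le> B" using A dgauss_const_nonneg[of a] by (simp add: B_def)
  have "L1Linf (v t) (M0 + M1 + B) (M0 + M1 + B)" if "t > 0" for t
  proof -
    have "ennreal M1 \<le> ennreal (M0 + M1 + B)" using L1LinfD(2)[OF v0] B0 by (intro ennreal_leI) simp
    thus ?thesis unfolding L1Linf_def using vB[OF that] vL1[OF that] M1 B0 L1LinfD(2)[OF v0] by (auto intro: order_trans)
  qed
  thus ?thesis using that[OF vm u_v _ v_v] by blast
qed

section \<open>Hoelder regularity of the solution\<close>

lemma min_le_geometric:
  fixes A B \<theta> :: real
  assumes "0 \<le> A" "0 \<le> B" "0 \<le> \<theta>" "\<theta> \<le> 1"
  shows "min A B \<le> A powr (1 - \<theta>) * B powr \<theta>"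
proof (cases "A = 0 \<or> B = 0")
  case False
  let ?m = "min A B"
  have m: "?m > 0" using assms False by auto
  have "?m = ?m powr (1 - \<theta>) * ?m powr \<theta>" using m by (simp add: powr_add[symmetric])
  also have "\<dots> \<le> A powr (1 - \<theta>) * B powr \<theta>" using assms m by (intro mult_mono powr_mono2) auto
  finally show ?thesis .
qed (use assms in auto)

lemma ennreal_le_geometric:
  assumes "X \<le> ennreal A" "X \<le> ennreal B" "0 \<le> A" "0 \<le> B" "0 \<le> \<theta>" "\<theta> \<le> 1"
  shows "X \<le> ennreal (A powr (1 - \<theta>) * B powr \<theta>)"
proof -
  have "X \<le> ennreal (min A B)" using assms by (auto simp: min_def)
  also have "\<dots> \<le> ennreal (A powr (1 - \<theta>) * B powr \<theta>)" using assms by (intro ennreal_leI min_le_geometric)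
  finally show ?thesis .
qed

lemma abs_integral_le:
  fixes \<phi> :: "'a::euclidean_space \<Rightarrow> real"
  assumes "\<phi> \<in> borel_measurable borel" "(\<integral>\<^sup>+x. ennreal \<bar>\<phi> x\<bar> \<partial>lborel) \<le> ennreal C" "0 \<le> C"
  shows "integrable lborel \<phi>" "\<bar>LINT x|lborel. \<phi> x\<bar> \<le> C"
proof -
  show i: "integrable lborel \<phi>" using assms by (intro integrableI_bounded) (auto simp: le_less_trans)
  have "ennreal \<bar>LINT x|lborel. \<phi> x\<bar> \<le> ennreal C"
    using order.trans[OF integral_norm_bound_ennreal[OF i]] assms(2) by simp
  thus "\<bar>LINT x|lborel. \<phi> x\<bar> \<le> C" using assms(3) by simp
qed

lemma nn_integral_abs_diff_le:
  fixes K :: "'a::euclidean_space \<Rightarrow> real"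
  assumes "L1Linf K A B"
  shows "(\<integral>\<^sup>+x. ennreal \<bar>K (x + z) - K x\<bar> \<partial>lborel) \<le> ennreal (2 * A)"
  using L1LinfD(3)[OF L1Linf_diff[OF L1Linf_shift[OF assms] assms]] by (simp only: mult_2)

text \<open>Interpolation with weight 3/4 between the trivial bound 2 \<kappa> t^(-1/2) and the
  gradient bound \<kappa> |z|/t. The power of t is -1/8 - 3/4 = -7/8, still integrable at 0.\<close>

lemma dgauss_diff_holder:
  fixes a z :: "'a::euclidean_space"
  assumes t: "t > 0"
  shows "(\<integral>\<^sup>+x. ennreal \<bar>dgauss a t (x + z) - dgauss a t x\<bar> \<partial>lborel) \<le> ennreal (2 * dgauss_const a * norm z powr (3/4) * t powr (- 7 / 8))"
proof -
  define \<kappa> where "\<kappa> = dgauss_const a"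
  have \<kappa>: "0 \<le> \<kappa>" unfolding \<kappa>_def by (rule dgauss_const_nonneg)
  have "(\<integral>\<^sup>+x. ennreal \<bar>dgauss a t (x + z) - dgauss a t x\<bar> \<partial>lborel)
     \<le> ennreal ((2 * (\<kappa> * t powr (- 1 / 2))) powr (1 - 3/4) * (\<kappa> * norm z * t powr (- 1)) powr (3/4))"
    by (rule ennreal_le_geometric[OF nn_integral_abs_diff_le[OF L1Linf_dgauss[OF t, of a], of z, folded \<kappa>_def] nn_integral_dgauss_diff[OF t, of a z, folded \<kappa>_def]])
       (use \<kappa> in simp_all)
  also have "\<dots> \<le> ennreal (2 * \<kappa> * norm z powr (3/4) * t powr (- 7 / 8))"
  proof (rule ennreal_leI)
    have "(2 * (\<kappa> * t powr (- 1 / 2))) powr (1 - 3/4) * (\<kappa> * norm z * t powr (- 1)) powr (3/4)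
      = 2 powr (1/4) * (\<kappa> powr (1/4) * \<kappa> powr (3/4)) * norm z powr (3/4) * (t powr (- 1 / 8) * t powr (- 3 / 4))"
      unfolding powr_mult powr_powr by (simp add: ac_simps)
    also have "\<kappa> powr (1/4) * \<kappa> powr (3/4) = \<kappa>" using \<kappa> by (simp add: powr_add[symmetric])
    also have "t powr (- 1 / 8) * t powr (- 3 / 4) = t powr (- 7 / 8)" by (simp add: powr_add[symmetric])
    also have "2 powr (1/4) * \<kappa> * norm z powr (3/4) * t powr (- 7 / 8) \<le> 2 * \<kappa> * norm z powr (3/4) * t powr (- 7 / 8)"
      using \<kappa> powr_mono[of "1/4" 1 "2::real"] by (intro mult_right_mono) auto
    finally show "(2 * (\<kappa> * t powr (- 1 / 2))) powr (1 - 3/4) * (\<kappa> * norm z * t powr (- 1)) powr (3/4)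
      \<le> 2 * \<kappa> * norm z powr (3/4) * t powr (- 7 / 8)" .
  qed
  finally show ?thesis unfolding \<kappa>_def .
qed

lemma gauss1_diff_holder:
  fixes z :: "'a::euclidean_space"
  shows "(\<integral>\<^sup>+x. ennreal \<bar>gauss 1 (x + z) - gauss 1 x\<bar> \<partial>lborel) \<le> ennreal (2 powr (1/4) * moment_const TYPE('a) powr (3/4) * norm z powr (3/4))"
proof -
  have "(\<integral>\<^sup>+x. ennreal \<bar>gauss 1 (x + z) - gauss 1 x\<bar> \<partial>lborel)
     \<le> ennreal ((2 * 1) powr (1 - 3/4) * (norm z * moment_const TYPE('a) * 1 powr (- 1 / 2)) powr (3/4))"
    by (rule ennreal_le_geometric[OF nn_integral_abs_diff_le[OF L1Linf_gauss[OF zero_less_one], of z] nn_integral_gauss_diff[OF zero_less_one, of z]])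
       (use moment_const_pos[where ?'a='a] in simp_all)
  thus ?thesis using moment_const_pos[where ?'a='a] by (simp add: powr_mult ac_simps)
qed

lemma L1Linf_convol_diff:
  assumes K: "L1Linf K A B" and \<kappa>: "(\<integral>\<^sup>+x. ennreal \<bar>K (x + z) - K x\<bar> \<partial>lborel) \<le> ennreal \<kappa>" "0 \<le> \<kappa>" and g: "L1Linf g A' B'"
  shows "L1Linf (\<lambda>x. convol K g (x + z) - convol K g x) (\<kappa> * A') (\<kappa> * B')"
proof -
  have [measurable]: "K \<in> borel_measurable borel" by (rule L1LinfD(1)[OF K])
  have "convol K g (x + z) - convol K g x = convol (\<lambda>y. K (y + z) - K y) g x" for x
    unfolding convol_shift
    by (rule convol_diff_left[symmetric, OF _ L1LinfD(4)[OF K] _ L1LinfD(4)[OF K] L1LinfD(6)[OF g]]) measurable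
  moreover have "L1Linf (convol (\<lambda>y. K (y + z) - K y) g) (\<kappa> * A') (\<kappa> * B')"
    by (rule L1Linf_convol[OF _ \<kappa> g]) measurable
  ultimately show ?thesis by simp
qed

text \<open>As the kernel has mass one, the change of w under the heat flow is an average of spatial
  increments; this turns regularity in space into regularity in time.\<close>

lemma convol_gauss_minus_id:
  fixes w :: "'a::euclidean_space \<Rightarrow> real"
  assumes t: "t > 0" and w: "L1Linf w A B"
  shows "convol (gauss t) w x - w x = (LINT z|lborel. gauss t z * (w (x - z) - w x))"
proof -
  have [measurable]: "w \<in> borel_measurable borel" by (rule L1LinfD(1)[OF w])
  have "integrable lborel (\<lambda>z. gauss t (x - z) * w z)"
    by (rule convol_integrable[of "gauss t", OF _ L1LinfD(4)[OF L1Linf_gauss[OF t]] L1LinfD(6)[OF w]]) measurable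
  from integrable_lborel_reflect[OF this, of x] have "integrable lborel (\<lambda>z. gauss t z * w (x - z))" by simp
  moreover have "integrable lborel (\<lambda>z. gauss t (z::'a) * w x)" using gauss_integrable[OF t, where ?'a='a] by auto
  ultimately have "(LINT z|lborel. gauss t z * (w (x - z) - w x)) = (LINT z|lborel. gauss t z * w (x - z)) - (LINT z|lborel. gauss t (z::'a) * w x)"
    by (simp add: right_diff_distrib)
  thus ?thesis using gauss_integral[OF t, where ?'a='a] by (simp add: convol_alt)
qed

text \<open>The setting of the representative: all facts hold at every point, so the estimates made
  inside never meet a null set.\<close>

locale mild_solution =
  fixes a :: "'a::euclidean_space" and f :: "real \<Rightarrow> real" and L p M M0 :: real
    and v0 :: "'a \<Rightarrow> real" and v :: "real \<Rightarrow> 'a \<Rightarrow> real"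
  assumes f_cont: "continuous_on UNIV f" and f_0: "f 0 = 0"
    and lip: "\<And>\<xi> \<eta>. \<bar>f \<xi> - f \<eta>\<bar> \<le> L * (\<bar>\<xi>\<bar> powr (p - 1) + \<bar>\<eta>\<bar> powr (p - 1)) * \<bar>\<xi> - \<eta>\<bar>"
    and L: "0 \<le> L" and p: "p > 1"
    and v0L: "L1Linf v0 M0 M0"
    and vm [measurable]: "(\<lambda>(t,x). v t x) \<in> borel_measurable (borel \<Otimes>\<^sub>M borel)"
    and vL: "\<And>t. 0 < t \<Longrightarrow> L1Linf (v t) M M"
    and v_duhamel: "\<And>t x. 0 < t \<Longrightarrow> v t x = convol (gauss t) v0 x + duhamel a (\<lambda>s y. f (v s y)) t x"
begin

lemma fm [measurable]: "f \<in> borel_measurable borel"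
  using f_cont by (rule borel_measurable_continuous_onI)

lemma M_nonneg: "0 \<le> M" using L1LinfD(2)[OF vL[of 1]] by simp

lemma v_bound: "0 < t \<Longrightarrow> \<bar>v t x\<bar> \<le> M" by (rule L1LinfD(4)[OF vL])

text \<open>A Lipschitz constant of f on [-M, M], which contains all values of v at positive
  times.\<close>

definition \<Lambda> :: real where "\<Lambda> = 2 * L * M powr (p - 1)"

lemma \<Lambda>_nonneg: "0 \<le> \<Lambda>" using L by (simp add: \<Lambda>_def)

lemma f_lip: "\<bar>\<xi>\<bar> \<le> M \<Longrightarrow> \<bar>\<eta>\<bar> \<le> M \<Longrightarrow> \<bar>f \<xi> - f \<eta>\<bar> \<le> \<Lambda> * \<bar>\<xi> - \<eta>\<bar>"
  unfolding \<Lambda>_def by (rule lip_local[OF lip L p])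

lemma f_le: "\<bar>\<xi>\<bar> \<le> M \<Longrightarrow> \<bar>f \<xi>\<bar> \<le> \<Lambda> * \<bar>\<xi>\<bar>"
  using f_lip[of \<xi> 0] M_nonneg f_0 by simp

lemma f_le_powr: "\<bar>f \<xi>\<bar> \<le> L * \<bar>\<xi>\<bar> powr (p - 1) * \<bar>\<xi>\<bar>"
  using lip[of \<xi> 0] f_0 by simp

lemma gm [measurable]: "(\<lambda>(s,y). f (v s y)) \<in> borel_measurable (borel \<Otimes>\<^sub>M borel)"
  by measurable

lemma gL: "0 < s \<Longrightarrow> L1Linf (\<lambda>y. f (v s y)) (\<Lambda> * M) (\<Lambda> * M)"
  by (rule L1Linf_dominated[OF vL]) (use f_le v_bound \<Lambda>_nonneg in auto)

lemma restart:
  assumes "t > 0" "h > 0"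
  shows "v (t + h) x = convol (gauss h) (v t) x + duhamel a (\<lambda>s y. f (v (t + s) y)) h x"
  by (rule duhamel_restart[OF gm gL v0L v_duhamel assms]) auto

lemma gm_shift: "(\<lambda>(s,y). f (v (t + s) y)) \<in> borel_measurable (borel \<Otimes>\<^sub>M borel)"
  by measurable

text \<open>Restarting at t - 1 puts a full unit of heat flow on the old value and confines the
  source to a unit window, where (1 - s)^(-7/8) is integrable. The constant is therefore uniform in
  t > 1.\<close>

lemma holder_space:
  obtains C where "0 \<le> C" "\<And>t z. t > 1 \<Longrightarrow> L1Linf (\<lambda>x. v t (x + z) - v t x) (C * norm z powr (3/4)) (C * norm z powr (3/4))"
proof
  define c1 where "c1 = 2 powr (1/4) * moment_const TYPE('a) powr (3/4) * M"
  define c2 where "c2 = 2 * dgauss_const a * (\<Lambda> * M)"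
  \<comment> \<open>8 is the integral of (1 - s)^(-7/8) over the unit interval.\<close>
  let ?C = "c1 + 8 * c2"
  have c: "0 \<le> c1" "0 \<le> c2" using M_nonneg \<Lambda>_nonneg dgauss_const_nonneg[of a] by (auto simp: c1_def c2_def)
  show "0 \<le> ?C" using c by simp
  fix t :: real and z :: 'a assume t: "t > 1"
  let ?r = "norm z powr (3/4)"
  let ?F = "\<lambda>s. convol (dgauss a (1 - s)) (\<lambda>y. f (v (t - 1 + s) y))"
  have t1: "t - 1 > 0" using t by simp
  have Fi: "set_integrable lborel {0<..<1} (\<lambda>s. ?F s x)" for x
    by (rule L1Linf_duhamel(2)[OF gm_shift gL]) (use t1 \<Lambda>_nonneg M_nonneg in auto)
  have eq: "v t (x + z) - v t x = (convol (gauss 1) (v (t - 1)) (x + z) - convol (gauss 1) (v (t - 1)) x)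
      + (LBINT s:{0<..<1}. ?F s (x + z) - ?F s x)" for x
    using restart[OF t1, of 1 x] restart[OF t1, of 1 "x + z"] set_integral_diff(2)[OF Fi[of "x+z"] Fi[of x]]
    by (simp add: duhamel_def)
  have 1: "L1Linf (\<lambda>x. convol (gauss 1) (v (t - 1)) (x + z) - convol (gauss 1) (v (t - 1)) x) (c1 * ?r) (c1 * ?r)"
    using L1Linf_convol_diff[OF L1Linf_gauss[of 1] gauss1_diff_holder _ vL[OF t1], of z] unfolding c1_def by (simp add: ac_simps)
  have m[measurable]: "(\<lambda>(s,x). ?F s x) \<in> borel_measurable (borel \<Otimes>\<^sub>M borel)"
    by (rule convol_dgauss_joint_measurable[OF gm_shift])
  have hi: "((\<lambda>s. c2 * ?r * (1 - s) powr (- 7 / 8)) has_integral (c2 * ?r * (1 powr (- 7 / 8 + 1) / (- 7 / 8 + 1)))) {0..1}"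
    by (intro has_integral_mult_right has_integral_powr_reflect) auto
  have 2: "L1Linf (\<lambda>x. LBINT s:{0<..<1}. ?F s (x + z) - ?F s x) (c2 * ?r * (1 powr (- 7 / 8 + 1) / (- 7 / 8 + 1))) (1 * (c2 * ?r * (1 powr (- 7 / 8 + 1) / (- 7 / 8 + 1))))"
  proof (rule L1Linf_time_integral(1)[OF _ _ hi])
    show "(\<lambda>(s,x). ?F s (x + z) - ?F s x) \<in> borel_measurable (borel \<Otimes>\<^sub>M borel)" by measurable
    fix s :: real assume s: "0 < s" "s < 1"
    have "L1Linf (\<lambda>x. ?F s (x + z) - ?F s x) (2 * dgauss_const a * ?r * (1 - s) powr (- 7 / 8) * (\<Lambda> * M)) (2 * dgauss_const a * ?r * (1 - s) powr (- 7 / 8) * (\<Lambda> * M))"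
      by (rule L1Linf_convol_diff[OF L1Linf_dgauss dgauss_diff_holder _ gL]) (use s t1 dgauss_const_nonneg[of a] in auto)
    thus "L1Linf (\<lambda>x. ?F s (x + z) - ?F s x) (c2 * ?r * (1 - s) powr (- 7 / 8)) (1 * (c2 * ?r * (1 - s) powr (- 7 / 8)))"
      by (simp add: c2_def ac_simps)
  qed (use c in auto)
  show "L1Linf (\<lambda>x. v t (x + z) - v t x) (?C * ?r) (?C * ?r)"
    unfolding eq using L1Linf_add[OF 1 2] by (simp add: algebra_simps)
qed

text \<open>Parabolic scaling: the moment of order 3/4 of \<open>gauss s\<close> is of order
  s^(3/8). The Duhamel term is O(s^(1/2)), which is smaller for s \<le> 1.\<close>

lemma holder_time:
  obtains C where "0 \<le> C" "\<And>t s. t > 1 \<Longrightarrow> 0 < s \<Longrightarrow> s \<le> 1 \<Longrightarrow> L1Linf (\<lambda>x. v (t + s) x - v t x) (C * s powr (3/8)) (C * s powr (3/8))"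
proof -
  obtain C where C: "0 \<le> C" "\<And>t z. t > 1 \<Longrightarrow> L1Linf (\<lambda>x. v t (x + z) - v t x) (C * norm z powr (3/4)) (C * norm z powr (3/4))"
    using holder_space by blast
  define c1 where "c1 = C * moment_const TYPE('a)"
  define c2 where "c2 = 2 * dgauss_const a * (\<Lambda> * M)"
  have c: "0 \<le> c1" "0 \<le> c2" using C M_nonneg \<Lambda>_nonneg dgauss_const_nonneg[of a] moment_const_pos[where ?'a='a] by (auto simp: c1_def c2_def)
  have "L1Linf (\<lambda>x. v (t + s) x - v t x) ((c1 + c2) * s powr (3/8)) ((c1 + c2) * s powr (3/8))" if t: "t > 1" and s: "0 < s" "s \<le> 1" for t s
  proof -
    have t0: "t > 0" using t by simp
    have [measurable]: "v t \<in> borel_measurable borel" by (rule L1LinfD(1)[OF vL[OF t0]])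
    have nn: "(\<integral>\<^sup>+z. ennreal (gauss s z * (C * norm (z::'a) powr (3/4))) \<partial>lborel) \<le> ennreal (c1 * s powr (3/8))"
    proof (rule nn_integral_le_gauss[of "2 * s"])
      fix z :: 'a
      have "C * (norm z powr (3/4) * gauss s z) \<le> C * (moment_const TYPE('a) * s powr ((3/4)/2) * gauss (2 * s) z)"
        by (intro mult_left_mono gauss_moment C) (use s in auto)
      thus "gauss s z * (C * norm z powr (3/4)) \<le> c1 * s powr (3/8) * gauss (2 * s) z" by (simp add: c1_def ac_simps)
    qed (use s c in auto)
    have 1: "L1Linf (\<lambda>x. LINT z|lborel. gauss s z * (v t (x - z) - v t x)) (c1 * s powr (3/8)) (c1 * s powr (3/8))"
    proof (rule L1Linf_integral(1)[OF _ _ nn _ nn])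
      show "(\<lambda>(z, x). gauss s z * (v t (x - z) - v t x)) \<in> borel_measurable (borel \<Otimes>\<^sub>M borel)" by measurable
      show "L1Linf (\<lambda>x. gauss s z * (v t (x - z) - v t x)) (gauss s z * (C * norm z powr (3/4))) (gauss s z * (C * norm z powr (3/4)))" for z
        using L1Linf_cmult[OF C(2)[OF t, of "-z"], of "gauss s z"] by (simp add: gauss_nonneg)
    qed (use c in auto)
    have 2: "L1Linf (duhamel a (\<lambda>r y. f (v (t + r) y)) s) (c2 * s powr (1/2)) (c2 * s powr (1/2))"
      unfolding c2_def by (rule L1Linf_duhamel(1)[OF gm_shift gL]) (use s t0 \<Lambda>_nonneg M_nonneg in auto)
    have 3: "s powr (1/2) \<le> s powr (3/8)" using s by (intro powr_mono') auto
    have 4: "L1Linf (duhamel a (\<lambda>r y. f (v (t + r) y)) s) (c2 * s powr (3/8)) (c2 * s powr (3/8))"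
      by (rule L1Linf_mono[OF 2]) (use 3 c in \<open>auto intro!: mult_left_mono\<close>)
    have eq: "v (t + s) x - v t x = (LINT z|lborel. gauss s z * (v t (x - z) - v t x)) + duhamel a (\<lambda>r y. f (v (t + r) y)) s x" for x
      using restart[OF t0 s(1), of x] convol_gauss_minus_id[OF s(1) vL[OF t0], of x] by simp
    show ?thesis unfolding eq using L1Linf_add[OF 1 4] by (simp add: algebra_simps)
  qed
  thus ?thesis using that[of "c1 + c2"] c by simp
qed

end

section \<open>Energy inequality\<close>

text \<open>Fubini moves the kernel outside; the inner integral is the correlation of w and q at lag
  z, so only the dependence of that correlation on z has to be estimated.\<close>

lemma integral_mult_convol:
  assumes K: "L1Linf K A B" and w: "L1Linf w A1 B1" and q: "L1Linf q A2 B2"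
  shows "(LINT x|lborel. w x * convol K q x) = (LINT z|lborel. K z * (LINT y|lborel. w (y + z) * q y))"
proof -
  note [measurable] = L1LinfD(1)[OF K] L1LinfD(1)[OF w] L1LinfD(1)[OF q]
  have "(LINT x|lborel. w x * convol K q x) = (LINT x|lborel. LINT z|lborel. w x * (K z * q (x - z)))"
    by (simp add: convol_alt)
  also have "\<dots> = (LINT z|lborel. LINT x|lborel. w x * (K z * q (x - z)))"
  proof (rule integral_lborel_swap)
    show "(\<lambda>(z, x). w x * (K z * q (x - z))) \<in> borel_measurable (borel \<Otimes>\<^sub>M borel)" by measurable
    have "(\<integral>\<^sup>+z. \<integral>\<^sup>+x. ennreal \<bar>w x * (K z * q (x - z))\<bar> \<partial>lborel \<partial>lborel) \<le> (\<integral>\<^sup>+z. \<integral>\<^sup>+x. ennreal (\<bar>K z\<bar> * B2) * ennreal \<bar>w x\<bar> \<partial>lborel \<partial>lborel)"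
    proof (intro nn_integral_mono)
      fix z x
      have "\<bar>w x\<bar> * (\<bar>K z\<bar> * \<bar>q (x - z)\<bar>) \<le> \<bar>w x\<bar> * (\<bar>K z\<bar> * B2)"
        by (intro mult_left_mono L1LinfD(4)[OF q]) auto
      thus "ennreal \<bar>w x * (K z * q (x - z))\<bar> \<le> ennreal (\<bar>K z\<bar> * B2) * ennreal \<bar>w x\<bar>"
        using L1LinfD(5)[OF q] by (simp add: ennreal_mult[symmetric] abs_mult ac_simps ennreal_leI)
    qed
    also have "\<dots> = (\<integral>\<^sup>+z. ennreal (\<bar>K z\<bar> * B2) \<partial>lborel) * (\<integral>\<^sup>+x. ennreal \<bar>w x\<bar> \<partial>lborel)"
      by (simp add: nn_integral_cmult nn_integral_multc)
    also have "(\<integral>\<^sup>+z. ennreal (\<bar>K z\<bar> * B2) \<partial>lborel) = (\<integral>\<^sup>+z. ennreal \<bar>K z\<bar> \<partial>lborel) * ennreal B2"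
      using L1LinfD(5)[OF q] by (simp add: ennreal_mult nn_integral_multc)
    also have "(\<integral>\<^sup>+z. ennreal \<bar>K z\<bar> \<partial>lborel) * ennreal B2 * (\<integral>\<^sup>+x. ennreal \<bar>w x\<bar> \<partial>lborel) < \<infinity>"
      using le_less_trans[OF L1LinfD(3)[OF K] ennreal_less_top] le_less_trans[OF L1LinfD(3)[OF w] ennreal_less_top]
      by (simp add: ennreal_mult_less_top)
    finally show "(\<integral>\<^sup>+z. \<integral>\<^sup>+x. ennreal \<bar>w x * (K z * q (x - z))\<bar> \<partial>lborel \<partial>lborel) < \<infinity>" .
  qed
  also have "\<dots> = (LINT z|lborel. K z * (LINT y|lborel. w (y + z) * q y))"
  proof (rule Bochner_Integration.integral_cong[OF refl])
    fix z
    have "(LINT x|lborel. w x * (K z * q (x - z))) = K z * (LINT x|lborel. w x * q (x - z))"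
      by (simp add: mult.left_commute)
    also have "(LINT x|lborel. w x * q (x - z)) = (LINT y|lborel. w (y + z) * q y)"
      using integral_lborel_shift[of "\<lambda>x. w x * q (x - z)" z] by simp
    finally show "(LINT x|lborel. w x * (K z * q (x - z))) = K z * (LINT y|lborel. w (y + z) * q y)" .
  qed
  finally show ?thesis .
qed

context mild_solution
begin

text \<open>Taylor's formula for the antiderivative of f; the quadratic remainder rests on the
  Lipschitz bound for f on [-M, M].\<close>

lemma antiderivative:
  obtains F where "F \<in> borel_measurable borel" "F 0 = 0"
    "\<And>\<xi> \<eta>. \<bar>\<xi>\<bar> \<le> M \<Longrightarrow> \<bar>\<eta>\<bar> \<le> M \<Longrightarrow> \<bar>F \<eta> - F \<xi> - f \<xi> * (\<eta> - \<xi>)\<bar> \<le> \<Lambda> * (\<eta> - \<xi>)\<^sup>2"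
proof -
  obtain G where G: "\<And>x. x \<in> {-M..M} \<Longrightarrow> (G has_vector_derivative f x) (at x within {-M..M})"
    using antiderivative_continuous[OF continuous_on_subset[OF f_cont], of "-M" M] by blast
  have Gd: "(G has_field_derivative f x) (at x within {-M..M})" if "x \<in> {-M..M}" for x
    using G[OF that] by (simp add: has_real_derivative_iff_has_vector_derivative)
  have Gc: "continuous_on {-M..M} G" using Gd by (rule DERIV_continuous_on)
  \<comment> \<open>The cut-off outside [-M, M] provides Borel measurability on the whole line; F is
    evaluated only at values inside the interval.\<close>
  define F where "F \<xi> = indicator {-M..M} \<xi> *\<^sub>R (G \<xi> - G 0)" for \<xi>
  show ?thesis
  proof
    show "F \<in> borel_measurable borel"
      unfolding F_def[abs_def] by (intro borel_measurable_continuous_on_indicator continuous_intros Gc) auto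
    show "F 0 = 0" by (simp add: F_def)
    fix \<xi> \<eta> :: real assume b: "\<bar>\<xi>\<bar> \<le> M" "\<bar>\<eta>\<bar> \<le> M"
    let ?S = "{min \<xi> \<eta>..max \<xi> \<eta>}"
    have S: "?S \<subseteq> {-M..M}" using b by auto
    have "norm ((\<lambda>r. G r - r * f \<xi>) \<eta> - (\<lambda>r. G r - r * f \<xi>) \<xi>) \<le> (\<Lambda> * \<bar>\<eta> - \<xi>\<bar>) * norm (\<eta> - \<xi>)"
    proof (rule field_differentiable_bound[of ?S _ "\<lambda>r. f r - f \<xi>"])
      fix r assume r: "r \<in> ?S"
      hence rM: "r \<in> {-M..M}" using S by auto
      have "(G has_field_derivative f r) (at r within ?S)" using DERIV_subset[OF Gd[OF rM] S] .
      thus "((\<lambda>r. G r - r * f \<xi>) has_field_derivative f r - f \<xi>) (at r within ?S)"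
        by (auto intro!: derivative_eq_intros)
      have "\<bar>f r - f \<xi>\<bar> \<le> \<Lambda> * \<bar>r - \<xi>\<bar>" using f_lip[of r \<xi>] rM b by auto
      also have "\<dots> \<le> \<Lambda> * \<bar>\<eta> - \<xi>\<bar>" using r \<Lambda>_nonneg by (intro mult_left_mono) auto
      finally show "norm (f r - f \<xi>) \<le> \<Lambda> * \<bar>\<eta> - \<xi>\<bar>" by simp
    qed auto
    moreover have "F \<eta> - F \<xi> - f \<xi> * (\<eta> - \<xi>) = (\<lambda>r. G r - r * f \<xi>) \<eta> - (\<lambda>r. G r - r * f \<xi>) \<xi>"
      using b by (auto simp: F_def indicator_def algebra_simps)
    ultimately show "\<bar>F \<eta> - F \<xi> - f \<xi> * (\<eta> - \<xi>)\<bar> \<le> \<Lambda> * (\<eta> - \<xi>)\<^sup>2"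
      by (simp add: power2_eq_square)
  qed
qed

text \<open>The divergence form enters here: with \<open>F' = f\<close> the leading part of the integrand is
  \<open>F (w (y + z)) - F (w y)\<close>, whose integral vanishes by translation invariance.\<close>

lemma shift_integral_le:
  assumes w: "L1Linf w A B" "B \<le> M" and d: "L1Linf (\<lambda>y. w (y + z) - w y) d d"
  shows "\<bar>LINT y|lborel. (w (y + z) - w y) * f (w y)\<bar> \<le> \<Lambda> * (d * d)"
proof -
  obtain F where F[measurable]: "F \<in> borel_measurable borel" and F0: "F 0 = 0"
    and FT: "\<And>\<xi> \<eta>. \<bar>\<xi>\<bar> \<le> M \<Longrightarrow> \<bar>\<eta>\<bar> \<le> M \<Longrightarrow> \<bar>F \<eta> - F \<xi> - f \<xi> * (\<eta> - \<xi>)\<bar> \<le> \<Lambda> * (\<eta> - \<xi>)\<^sup>2"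
    using antiderivative by blast
  note [measurable] = L1LinfD(1)[OF w(1)]
  have wM: "\<bar>w y\<bar> \<le> M" for y using L1LinfD(4)[OF w(1), of y] w(2) by linarith
  have Fi: "integrable lborel (\<lambda>y. F (w y))"
  proof (rule Bochner_Integration.integrable_bound[of _ "\<lambda>y. \<Lambda> * (w y * w y)"])
    show "integrable lborel (\<lambda>y. \<Lambda> * (w y * w y))" using L1Linf_mult_integrable(1)[OF w(1) w(1)] by auto
    \<comment> \<open>The Taylor bound at \<xi> = 0, where F and f both vanish, dominates F(w) by
      the integrable w^2.\<close>
    have "\<bar>F (w y)\<bar> \<le> \<Lambda> * (w y * w y)" for y using FT[of 0 "w y"] wM[of y] M_nonneg F0 f_0 by (simp add: power2_eq_square)
    thus "AE y in lborel. norm (F (w y)) \<le> norm (\<Lambda> * (w y * w y))" by (intro AE_I2) (simp add: order_trans[OF _ abs_ge_self])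
  qed measurable
  have Fi2: "integrable lborel (\<lambda>y. F (w (y + z)))" using integrable_lborel_shift[OF Fi, of z] .
  have F_eq: "(LINT y|lborel. F (w (y + z))) = (LINT y|lborel. F (w y))"
    by (rule integral_lborel_shift[of "\<lambda>y. F (w y)"]) measurable
  have fw: "L1Linf (\<lambda>y. f (w y)) (\<Lambda> * A) (\<Lambda> * B)"
    by (rule L1Linf_dominated[OF w(1)]) (use f_le wM \<Lambda>_nonneg in auto)
  have i1: "integrable lborel (\<lambda>y. (w (y + z) - w y) * f (w y))" by (rule L1Linf_mult_integrable(1)[OF d fw])
  have i2: "integrable lborel (\<lambda>y. \<Lambda> * \<bar>(w (y + z) - w y) * (w (y + z) - w y)\<bar>)" using L1Linf_mult_integrable(1)[OF d d] by auto
  have "(LINT y|lborel. (w (y + z) - w y) * f (w y)) = (LINT y|lborel. (w (y + z) - w y) * f (w y) - (F (w (y + z)) - F (w y)))"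
    using i1 Fi Fi2 F_eq by simp
  also have "\<bar>\<dots>\<bar> \<le> (LINT y|lborel. \<bar>(w (y + z) - w y) * f (w y) - (F (w (y + z)) - F (w y))\<bar>)"
    by (rule integral_abs_bound)
  also have "\<dots> \<le> (LINT y|lborel. \<Lambda> * \<bar>(w (y + z) - w y) * (w (y + z) - w y)\<bar>)"
  proof (rule integral_mono)
    fix y
    show "\<bar>(w (y + z) - w y) * f (w y) - (F (w (y + z)) - F (w y))\<bar> \<le> \<Lambda> * \<bar>(w (y + z) - w y) * (w (y + z) - w y)\<bar>"
      using FT[OF wM[of y] wM[of "y + z"]] by (simp add: power2_eq_square abs_minus_commute mult.commute)
  qed (use i1 i2 Fi Fi2 in auto)
  \<comment> \<open>Hoelder splits the squared increment: one factor is measured in L1, the other in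
    the sup norm.\<close>
  also have "\<dots> \<le> \<Lambda> * (d * d)" using L1Linf_mult_integrable(2)[OF d d] \<Lambda>_nonneg by (simp add: mult_left_mono)
  finally show ?thesis .
qed

text \<open>\<open>dgauss\<close> has integral zero, so the correlation J enters only through J z -
  J 0. With w = v (t + h), replacing q by f(w) costs a time increment times a space increment,
  \<tau>^(3/8) |z|^(3/4); the part with f(w) is O(|z|^(3/2)) by \<open>shift_integral_le\<close>. As
  the kernel moment of order b is of order \<tau>^((b - 1)/2), both parts give \<tau>^(1/4).\<close>

lemma cross_term:
  obtains C where "0 \<le> C" "\<And>t h s. t > 1 \<Longrightarrow> 0 < s \<Longrightarrow> s < h \<Longrightarrow> h \<le> 1 \<Longrightarrow>
     \<bar>LINT x|lborel. v (t + h) x * convol (dgauss a (h - s)) (\<lambda>y. f (v (t + s) y)) x\<bar> \<le> C * (h - s) powr (1/4)"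
proof -
  obtain C1 where C1: "0 \<le> C1" "\<And>t z. t > 1 \<Longrightarrow> L1Linf (\<lambda>x. v t (x + z) - v t x) (C1 * norm z powr (3/4)) (C1 * norm z powr (3/4))"
    using holder_space by blast
  obtain C2 where C2: "0 \<le> C2" "\<And>t s. t > 1 \<Longrightarrow> 0 < s \<Longrightarrow> s \<le> 1 \<Longrightarrow> L1Linf (\<lambda>x. v (t + s) x - v t x) (C2 * s powr (3/8)) (C2 * s powr (3/8))"
    using holder_time by blast
  define C where "C = dgauss_const a * (C1 * \<Lambda> * C2) + dgauss_const a * (\<Lambda> * C1 * C1)"
  have C0: "0 \<le> C" using C1 C2 \<Lambda>_nonneg dgauss_const_nonneg[of a] by (simp add: C_def)
  have "\<bar>LINT x|lborel. v (t + h) x * convol (dgauss a (h - s)) (\<lambda>y. f (v (t + s) y)) x\<bar> \<le> C * (h - s) powr (1/4)"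
    if t: "t > 1" and s: "0 < s" "s < h" "h \<le> 1" for t h s
  proof -
    define \<tau> where "\<tau> = h - s"
    define w where "w = v (t + h)"
    define q where "q y = f (v (t + s) y)" for y
    define K where "K = dgauss a \<tau>"
    define J where "J z = (LINT y|lborel. w (y + z) * q y)" for z
    have \<tau>: "\<tau> > 0" "\<tau> \<le> 1" using s by (auto simp: \<tau>_def)
    have ths: "t + s > 0" "t + h > 0" "t + s > 1" "t + h > 1" using t s by auto
    have w: "L1Linf w M M" unfolding w_def by (rule vL[OF ths(2)])
    have wv: "L1Linf (\<lambda>y. w (y + z) - w y) (C1 * norm z powr (3/4)) (C1 * norm z powr (3/4))" for z
      unfolding w_def by (rule C1(2)[OF ths(4)])
    have q: "L1Linf q (\<Lambda> * M) (\<Lambda> * M)" unfolding q_def by (rule gL[OF ths(1)])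
    have K: "L1Linf K (dgauss_const a * \<tau> powr (- 1 / 2)) (dgauss_const a * \<tau> powr (- 1 / 2 - real DIM('a) / 2))"
      unfolding K_def by (rule L1Linf_dgauss[OF \<tau>(1)])
    note [measurable] = L1LinfD(1)[OF K] L1LinfD(1)[OF w] L1LinfD(1)[OF q]
    have Jm[measurable]: "J \<in> borel_measurable borel" unfolding J_def[abs_def] by measurable
    have fw: "L1Linf (\<lambda>y. f (w y)) (\<Lambda> * M) (\<Lambda> * M)" unfolding w_def by (rule gL[OF ths(2)])
    have qw: "L1Linf (\<lambda>y. q y - f (w y)) (\<Lambda> * (C2 * \<tau> powr (3/8))) (\<Lambda> * (C2 * \<tau> powr (3/8)))"
    proof (rule L1Linf_dominated)
      show "L1Linf (\<lambda>x. v (t + s + \<tau>) x - v (t + s) x) (C2 * \<tau> powr (3/8)) (C2 * \<tau> powr (3/8))" by (rule C2(2)[OF ths(3) \<tau>])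
      show "\<bar>q y - f (w y)\<bar> \<le> \<Lambda> * \<bar>v (t + s + \<tau>) y - v (t + s) y\<bar>" for y
        unfolding q_def w_def \<tau>_def using f_lip[OF v_bound[OF ths(1)] v_bound[OF ths(2)], of y y] by (simp add: abs_minus_commute)
    qed (use \<Lambda>_nonneg in auto)
    have JJ: "\<bar>J z - J 0\<bar> \<le> (C1 * \<Lambda> * C2) * \<tau> powr (3/8) * norm z powr (3/4) + (\<Lambda> * C1 * C1) * norm z powr (3/2)" for z
    proof -
      have i1: "integrable lborel (\<lambda>y. w (y + z) * q y)" by (rule L1Linf_mult_integrable(1)[OF L1Linf_shift[OF w] q])
      have i2: "integrable lborel (\<lambda>y. w y * q y)" by (rule L1Linf_mult_integrable(1)[OF w q])
      have i3: "integrable lborel (\<lambda>y. (w (y + z) - w y) * (q y - f (w y)))" by (rule L1Linf_mult_integrable(1)[OF wv qw])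
      have i4: "integrable lborel (\<lambda>y. (w (y + z) - w y) * f (w y))" by (rule L1Linf_mult_integrable(1)[OF wv fw])
      have "J z - J 0 = (LINT y|lborel. w (y + z) * q y - w y * q y)" using i1 i2 by (simp add: J_def)
      also have "\<dots> = (LINT y|lborel. (w (y + z) - w y) * (q y - f (w y)) + (w (y + z) - w y) * f (w y))"
        by (intro Bochner_Integration.integral_cong refl) (simp add: algebra_simps)
      also have "\<dots> = (LINT y|lborel. (w (y + z) - w y) * (q y - f (w y))) + (LINT y|lborel. (w (y + z) - w y) * f (w y))"
        using i3 i4 by simp
      finally have "\<bar>J z - J 0\<bar> \<le> \<bar>LINT y|lborel. (w (y + z) - w y) * (q y - f (w y))\<bar> + \<bar>LINT y|lborel. (w (y + z) - w y) * f (w y)\<bar>"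
        by linarith
      also have "\<dots> \<le> (C1 * norm z powr (3/4)) * (\<Lambda> * (C2 * \<tau> powr (3/8))) + \<Lambda> * ((C1 * norm z powr (3/4)) * (C1 * norm z powr (3/4)))"
        by (intro add_mono L1Linf_mult_integrable(3)[OF wv qw] shift_integral_le[OF w order_refl wv])
      also have "\<dots> = (C1 * \<Lambda> * C2) * \<tau> powr (3/8) * norm z powr (3/4) + (\<Lambda> * C1 * C1) * (norm z powr (3/4) * norm z powr (3/4))"
        by simp
      also have "norm z powr (3/4) * norm z powr (3/4) = norm z powr (3/2)" by (simp add: powr_add[symmetric])
      finally show ?thesis .
    qed
    have Ki: "integrable lborel K" by (rule L1LinfD(6)[OF K])
    have nn: "(\<integral>\<^sup>+z. ennreal \<bar>K z * (J z - J 0)\<bar> \<partial>lborel) \<le> ennreal (C * \<tau> powr (1/4))"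
    proof (rule nn_integral_le_gauss[of "2 * \<tau>"])
      fix z :: 'a
      have m: "norm z powr b * \<bar>K z\<bar> \<le> dgauss_const a * \<tau> powr ((b - 1) / 2) * gauss (2 * \<tau>) z" if "0 \<le> b" "b \<le> 3" for b
        unfolding K_def by (rule dgauss_moment[OF \<tau>(1) that])
      have "\<bar>K z * (J z - J 0)\<bar> \<le> \<bar>K z\<bar> * ((C1 * \<Lambda> * C2) * \<tau> powr (3/8) * norm z powr (3/4) + (\<Lambda> * C1 * C1) * norm z powr (3/2))"
        unfolding abs_mult by (intro mult_left_mono JJ) auto
      also have "\<dots> = (C1 * \<Lambda> * C2) * \<tau> powr (3/8) * (norm z powr (3/4) * \<bar>K z\<bar>) + (\<Lambda> * C1 * C1) * (norm z powr (3/2) * \<bar>K z\<bar>)"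
        by (simp add: algebra_simps)
      also have "\<dots> \<le> (C1 * \<Lambda> * C2) * \<tau> powr (3/8) * (dgauss_const a * \<tau> powr ((3/4 - 1) / 2) * gauss (2 * \<tau>) z)
          + (\<Lambda> * C1 * C1) * (dgauss_const a * \<tau> powr ((3/2 - 1) / 2) * gauss (2 * \<tau>) z)"
        by (intro add_mono mult_left_mono m) (use C1 C2 \<Lambda>_nonneg in auto)
      also have "\<dots> = (dgauss_const a * (C1 * \<Lambda> * C2) * (\<tau> powr (3/8) * \<tau> powr (- 1 / 8)) + dgauss_const a * (\<Lambda> * C1 * C1) * \<tau> powr (1/4)) * gauss (2 * \<tau>) z"
        by (simp add: algebra_simps)
      also have "\<tau> powr (3/8) * \<tau> powr (- 1 / 8) = \<tau> powr (1/4)" by (simp add: powr_add[symmetric])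
      finally show "\<bar>K z * (J z - J 0)\<bar> \<le> C * \<tau> powr (1/4) * gauss (2 * \<tau>) z"
        by (simp add: C_def algebra_simps)
    qed (use \<tau> C0 in auto)
    have mKJ: "(\<lambda>z. K z * (J z - J 0)) \<in> borel_measurable borel" by measurable
    have C\<tau>: "0 \<le> C * \<tau> powr (1/4)" using C0 by simp
    note iKJ = abs_integral_le(1)[OF mKJ nn C\<tau>] and bKJ = abs_integral_le(2)[OF mKJ nn C\<tau>]
    have "(LINT x|lborel. w x * convol K q x) = (LINT z|lborel. K z * J z)"
      unfolding J_def by (rule integral_mult_convol[OF K w q])
    also have "\<dots> = (LINT z|lborel. K z * (J z - J 0) + K z * J 0)" by (simp add: algebra_simps)
    also have "\<dots> = (LINT z|lborel. K z * (J z - J 0)) + (LINT z|lborel. K z) * J 0"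
      using iKJ Ki by simp
    also have "(LINT z|lborel. K z) = 0" unfolding K_def by (rule dgauss_integral)
    finally show ?thesis using bKJ unfolding w_def q_def K_def \<tau>_def by simp
  qed
  thus ?thesis using that C0 by blast
qed

definition energy :: "real \<Rightarrow> real" where
  "energy t = (LINT x|lborel. v t x * v t x)"

text \<open>With w = y + D, where y is the heat flow of \<open>v t\<close> and D the Duhamel part,
  w^2 = y^2 + 2 w D - D^2. Dropping D^2 leaves D paired with the final value w, which is the pairing
  that \<open>cross_term\<close> estimates.\<close>

lemma energy_step:
  obtains C where "0 \<le> C" "\<And>t h. t > 1 \<Longrightarrow> 0 < h \<Longrightarrow> h \<le> 1 \<Longrightarrow>
     energy (t + h) \<le> (LINT x|lborel. convol (gauss h) (v t) x * convol (gauss h) (v t) x) + C * h powr (5/4)"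
proof -
  obtain C where C: "0 \<le> C" "\<And>t h s. t > 1 \<Longrightarrow> 0 < s \<Longrightarrow> s < h \<Longrightarrow> h \<le> 1 \<Longrightarrow>
     \<bar>LINT x|lborel. v (t + h) x * convol (dgauss a (h - s)) (\<lambda>y. f (v (t + s) y)) x\<bar> \<le> C * (h - s) powr (1/4)"
    using cross_term by blast
  have "energy (t + h) \<le> (LINT x|lborel. convol (gauss h) (v t) x * convol (gauss h) (v t) x) + 2 * C * h powr (5/4)"
    if t: "t > 1" and h: "0 < h" "h \<le> 1" for t h
  proof -
    have t0: "t > 0" "t + h > 0" using t h by auto
    define w where "w = v (t + h)"
    define y where "y = convol (gauss h) (v t)"
    define D where "D = duhamel a (\<lambda>s y. f (v (t + s) y)) h"
    define G where "G s = convol (dgauss a (h - s)) (\<lambda>y. f (v (t + s) y))" for s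
    have w: "L1Linf w M M" unfolding w_def by (rule vL[OF t0(2)])
    have y: "L1Linf y M M" unfolding y_def by (rule L1Linf_convol_gauss[OF h(1) vL[OF t0(1)]])
    define B where "B = 2 * dgauss_const a * (\<Lambda> * M) * h powr (1 / 2)"
    have D: "L1Linf D B B" unfolding D_def B_def
      by (rule L1Linf_duhamel(1)[OF gm_shift gL]) (use h t0 \<Lambda>_nonneg M_nonneg in auto)
    note [measurable] = L1LinfD(1)[OF w] L1LinfD(1)[OF y] L1LinfD(1)[OF D]
    have Gm[measurable]: "(\<lambda>(s,x). G s x) \<in> borel_measurable (borel \<Otimes>\<^sub>M borel)"
      unfolding G_def by (rule convol_dgauss_joint_measurable[OF gm_shift])
    have wyD: "w x = y x + D x" for x unfolding w_def y_def D_def by (rule restart[OF t0(1) h(1)])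
    have iww: "integrable lborel (\<lambda>x. w x * w x)" by (rule L1Linf_mult_integrable(1)[OF w w])
    have iyy: "integrable lborel (\<lambda>x. y x * y x)" by (rule L1Linf_mult_integrable(1)[OF y y])
    have iwD: "integrable lborel (\<lambda>x. w x * D x)" by (rule L1Linf_mult_integrable(1)[OF w D])
    have "(LINT x|lborel. w x * w x) \<le> (LINT x|lborel. y x * y x + 2 * (w x * D x))"
    proof (rule integral_mono)
      fix x
      have "0 \<le> D x * D x" by simp
      thus "w x * w x \<le> y x * y x + 2 * (w x * D x)" unfolding wyD by (simp add: algebra_simps)
    qed (use iww iyy iwD in auto)
    also have "\<dots> = (LINT x|lborel. y x * y x) + 2 * (LINT x|lborel. w x * D x)" using iyy iwD by simp
    also have "(LINT x|lborel. w x * D x) \<le> C * h powr (5/4)"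
    proof -
      define \<beta> where "\<beta> s = dgauss_const a * (\<Lambda> * M) * (h - s) powr (- 1 / 2)" for s
      have \<beta>0: "0 \<le> \<beta> s" for s using \<Lambda>_nonneg M_nonneg dgauss_const_nonneg[of a] by (simp add: \<beta>_def)
      have hi\<beta>: "(\<beta> has_integral dgauss_const a * (\<Lambda> * M) * (h powr (- 1 / 2 + 1) / (- 1 / 2 + 1))) {0..h}"
        unfolding \<beta>_def[abs_def] using h by (intro has_integral_mult_right has_integral_powr_reflect) auto
      have "(LINT x|lborel. w x * D x) = (LINT x|lborel. LINT s|lborel. w x * (indicator {0<..<h} s * G s x))"
        unfolding D_def duhamel_def set_lebesgue_integral_def G_def by simp
      also have "\<dots> = (LINT s|lborel. LINT x|lborel. w x * (indicator {0<..<h} s * G s x))"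
      proof (rule integral_lborel_swap)
        show "(\<lambda>(s, x). w x * (indicator {0<..<h} s * G s x)) \<in> borel_measurable (borel \<Otimes>\<^sub>M borel)" by measurable
        have "(\<integral>\<^sup>+s. \<integral>\<^sup>+x. ennreal \<bar>w x * (indicator {0<..<h} s * G s x)\<bar> \<partial>lborel \<partial>lborel) \<le> (\<integral>\<^sup>+s. ennreal M * ennreal (indicator {0<..<h} s * \<beta> s) \<partial>lborel)"
        proof (rule nn_integral_mono)
          fix s
          show "(\<integral>\<^sup>+x. ennreal \<bar>w x * (indicator {0<..<h} s * G s x)\<bar> \<partial>lborel) \<le> ennreal M * ennreal (indicator {0<..<h} s * \<beta> s)"
          proof (cases "s \<in> {0<..<h}")
            case True
            have Gs: "L1Linf (G s) (\<beta> s) (\<beta> s)"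
              using L1Linf_convol_dgauss[of "h - s" "\<lambda>y. f (v (t + s) y)" "\<Lambda> * M" "\<Lambda> * M" a] gL[of "t + s"] True t0
              by (simp add: \<beta>_def G_def ac_simps)
            have "(\<integral>\<^sup>+x. ennreal \<bar>w x * (indicator {0<..<h} s * G s x)\<bar> \<partial>lborel) \<le> (\<integral>\<^sup>+x. ennreal M * ennreal \<bar>G s x\<bar> \<partial>lborel)"
              using True L1LinfD(4)[OF w] M_nonneg
              by (intro nn_integral_mono) (auto simp: ennreal_mult[symmetric] abs_mult intro!: ennreal_leI mult_right_mono)
            also have "\<dots> = ennreal M * (\<integral>\<^sup>+x. ennreal \<bar>G s x\<bar> \<partial>lborel)" by (intro nn_integral_cmult) (use L1LinfD(1)[OF Gs] in auto)
            also have "\<dots> \<le> ennreal M * ennreal (\<beta> s)" by (intro mult_left_mono L1LinfD(3)[OF Gs]) auto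
            finally show ?thesis using True by simp
          qed simp
        qed
        also have "\<dots> = ennreal M * (\<integral>\<^sup>+s. ennreal (indicator {0<..<h} s * \<beta> s) \<partial>lborel)"
          by (rule nn_integral_cmult) (unfold \<beta>_def, measurable)
        also have "\<dots> < \<infinity>"
          using le_less_trans[OF nn_integral_has_integral_indicator(1)[OF hi\<beta> \<beta>0] ennreal_less_top] by (simp add: ennreal_mult_less_top)
        finally show "(\<integral>\<^sup>+s. \<integral>\<^sup>+x. ennreal \<bar>w x * (indicator {0<..<h} s * G s x)\<bar> \<partial>lborel \<partial>lborel) < \<infinity>" .
      qed
      also have "\<dots> = (LBINT s:{0<..<h}. LINT x|lborel. w x * G s x)"
        unfolding set_lebesgue_integral_def by (intro Bochner_Integration.integral_cong refl) (simp add: indicator_def)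
      also have "\<dots> \<le> \<bar>\<dots>\<bar>" by simp
      \<comment> \<open>The time integral of (h - s)^(1/4) is (4/5) h^(5/4); the cancellation in
        \<open>cross_term\<close> is what makes it smaller than h.\<close>
      also have "\<dots> \<le> C * (h powr (1/4 + 1) / (1/4 + 1))"
      proof (rule abs_time_integral_le(1)[where \<beta>="\<lambda>s. C * (h - s) powr (1/4)"])
        show "(\<lambda>s. LINT x|lborel. w x * G s x) \<in> borel_measurable borel" by measurable
        show "((\<lambda>s. C * (h - s) powr (1/4)) has_integral C * (h powr (1/4 + 1) / (1/4 + 1))) {0..h}"
          using h by (intro has_integral_mult_right has_integral_powr_reflect) auto
        show "\<bar>LINT x|lborel. w x * G s x\<bar> \<le> C * (h - s) powr (1/4)" if "0 < s" "s < h" for s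
          unfolding w_def G_def using C(2)[OF t that h(2)] .
      qed (use C in auto)
      also have "\<dots> \<le> C * h powr (5/4)" using C(1) by (intro mult_left_mono) auto
      finally show ?thesis .
    qed
    finally show ?thesis unfolding energy_def w_def y_def by simp
  qed
  thus ?thesis using that[of "2 * C"] C(1) by simp
qed

end

section \<open>Decay of the energy\<close>

lemma integral_Cauchy_Schwarz:
  fixes \<phi> \<psi> :: "'a::euclidean_space \<Rightarrow> real"
  assumes "integrable lborel (\<lambda>x. \<phi> x * \<phi> x)" "integrable lborel (\<lambda>x. \<psi> x * \<psi> x)" "integrable lborel (\<lambda>x. \<phi> x * \<psi> x)"
  shows "(LINT x|lborel. \<phi> x * \<psi> x)\<^sup>2 \<le> (LINT x|lborel. \<phi> x * \<phi> x) * (LINT x|lborel. \<psi> x * \<psi> x)"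
proof -
  define A B C where "A = (LINT x|lborel. \<phi> x * \<phi> x)" and "B = (LINT x|lborel. \<psi> x * \<psi> x)" and "C = (LINT x|lborel. \<phi> x * \<psi> x)"
  have q: "0 \<le> A + 2 * r * C + r\<^sup>2 * B" for r
  proof -
    have "0 \<le> (LINT x|lborel. (\<phi> x + r * \<psi> x) * (\<phi> x + r * \<psi> x))" by (intro integral_nonneg_AE AE_I2) simp
    also have "\<dots> = (LINT x|lborel. \<phi> x * \<phi> x + (2 * r * (\<phi> x * \<psi> x) + r\<^sup>2 * (\<psi> x * \<psi> x)))"
      by (intro Bochner_Integration.integral_cong refl) (simp add: algebra_simps power2_eq_square)
    also have "\<dots> = A + 2 * r * C + r\<^sup>2 * B" using assms by (simp add: A_def B_def C_def)
    finally show ?thesis .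
  qed
  have "0 \<le> B" unfolding B_def by (intro integral_nonneg_AE AE_I2) simp
  have "C\<^sup>2 \<le> A * B"
  proof (cases "B = 0")
    case True
    have "C = 0"
    proof (rule ccontr)
      assume "C \<noteq> 0"
      \<comment> \<open>This value of r makes the quadratic form equal to -1.\<close>
      thus False using q[of "- (A + 1) / (2 * C)"] True by (simp add: field_simps)
    qed
    thus ?thesis using True by simp
  next
    case False
    hence "B > 0" using \<open>0 \<le> B\<close> by simp
    have "0 \<le> A + 2 * (- C / B) * C + (- C / B)\<^sup>2 * B" by (rule q)
    also have "\<dots> = A - C\<^sup>2 / B" using False by (simp add: field_simps power2_eq_square)
    finally show ?thesis using \<open>B > 0\<close> by (simp add: field_simps)
  qed
  thus ?thesis by (simp add: A_def B_def C_def)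
qed

text \<open>Cauchy-Schwarz, the squared L2 norm of the kernel being at most the product of its L1
  and sup bounds.\<close>

lemma abs_convol_le_L2:
  assumes K: "L1Linf K A B" and g: "L1Linf g A' B'"
  shows "\<bar>convol K g x\<bar> \<le> sqrt (A * B) * sqrt (LINT y|lborel. g y * g y)"
proof -
  note [measurable] = L1LinfD(1)[OF K] L1LinfD(1)[OF g]
  have "integrable lborel (\<lambda>y. K (x - y) * K (x - y))"
    using integrable_lborel_reflect[OF L1Linf_mult_integrable(1)[OF K K], of x] .
  hence "(convol K g x)\<^sup>2 \<le> (LINT y|lborel. K (x - y) * K (x - y)) * (LINT y|lborel. g y * g y)"
    unfolding convol_def
    by (intro integral_Cauchy_Schwarz L1Linf_mult_integrable(1)[OF g g] convol_integrable[OF _ L1LinfD(4)[OF K] L1LinfD(6)[OF g]]) measurable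
  also have "(LINT y|lborel. K (x - y) * K (x - y)) = (LINT y|lborel. K y * K y)"
    by (rule integral_lborel_reflect[of "\<lambda>y. K y * K y"]) measurable
  also have "(LINT y|lborel. K y * K y) * (LINT y|lborel. g y * g y) \<le> A * B * (LINT y|lborel. g y * g y)"
    using L1Linf_mult_integrable(3)[OF K K] by (intro mult_right_mono integral_nonneg_AE AE_I2) auto
  finally have "(convol K g x)\<^sup>2 \<le> A * B * (LINT y|lborel. g y * g y)" .
  hence "sqrt ((convol K g x)\<^sup>2) \<le> sqrt (A * B * (LINT y|lborel. g y * g y))" by (rule real_sqrt_le_mono)
  thus ?thesis by (simp add: real_sqrt_mult)
qed

text \<open>Evenness of the kernel: reflecting the lag z exchanges the roles of w and q in the
  correlation formula.\<close>

lemma convol_gauss_self_adjoint: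
  fixes w q :: "'a::euclidean_space \<Rightarrow> real"
  assumes t: "t > 0" and w: "L1Linf w A B" and q: "L1Linf q A' B'"
  shows "(LINT x|lborel. w x * convol (gauss t) q x) = (LINT x|lborel. convol (gauss t) w x * q x)"
proof -
  note [measurable] = L1LinfD(1)[OF w] L1LinfD(1)[OF q]
  have "(LINT x|lborel. w x * convol (gauss t) q x) = (LINT z|lborel. gauss t z * (LINT y|lborel. w (y + z) * q y))"
    by (rule integral_mult_convol[OF L1Linf_gauss[OF t] w q])
  also have "\<dots> = (LINT z|lborel. gauss t (0 - z) * (LINT y|lborel. w (y + (0 - z)) * q y))"
    by (rule integral_lborel_reflect[symmetric]) measurable
  also have "\<dots> = (LINT z|lborel. gauss t z * (LINT y|lborel. q (y + z) * w y))"
  proof (rule Bochner_Integration.integral_cong[OF refl])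
    fix z
    have "(LINT y|lborel. w (y + (0 - z)) * q y) = (LINT y|lborel. q (y + z) * w y)"
      using integral_lborel_shift[of "\<lambda>y. w (y + (0 - z)) * q y" z] by (simp add: mult.commute)
    thus "gauss t (0 - z) * (LINT y|lborel. w (y + (0 - z)) * q y) = gauss t z * (LINT y|lborel. q (y + z) * w y)"
      by (simp add: gauss_minus)
  qed
  also have "\<dots> = (LINT x|lborel. q x * convol (gauss t) w x)"
    by (rule integral_mult_convol[OF L1Linf_gauss[OF t] q w, symmetric])
  finally show ?thesis by (simp add: mult.commute)
qed

definition heat_energy :: "('a::euclidean_space \<Rightarrow> real) \<Rightarrow> real \<Rightarrow> real" where
  "heat_energy w h = (LINT x|lborel. convol (gauss h) w x * convol (gauss h) w x)"

lemma heat_energy_nonneg: "0 \<le> heat_energy w h"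
  unfolding heat_energy_def by (intro integral_nonneg_AE AE_I2) simp

text \<open>Log-convexity of \<open>h \<mapsto> \<parallel>e\<^bsup>h\<Delta>\<^esup>w\<parallel>\<^sub>2\<^sup>2\<close>; together with the bound at one large time it replaces Nash's inequality.\<close>

lemma heat_energy_doubling:
  assumes h: "h > 0" and w: "L1Linf w A B"
  shows "(heat_energy w h)\<^sup>2 \<le> (LINT x|lborel. w x * w x) * heat_energy w (2 * h)"
proof -
  have h2: "2 * h > 0" using h by simp
  have G1: "L1Linf (convol (gauss h) w) A B" by (rule L1Linf_convol_gauss[OF h w])
  have G2: "L1Linf (convol (gauss (2 * h)) w) A B" by (rule L1Linf_convol_gauss[OF h2 w])
  have gg: "convol (gauss h) (convol (gauss h) w) x = convol (gauss (2 * h)) w x" for x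
  proof -
    have "convol (gauss h) (convol (gauss h) w) x = convol (convol (gauss h) (gauss h)) w x"
      by (rule convol_assoc[OF _ L1LinfD(4)[OF L1Linf_gauss[OF h]] L1Linf_gauss[OF h] L1LinfD(6)[OF w]]) measurable
    moreover have "convol (gauss h) (gauss h) = (gauss (2 * h) :: 'a \<Rightarrow> real)"
      using convol_gauss_gauss[OF h h, where ?'a='a] by (simp only: fun_eq_iff mult_2 simp_thms)
    ultimately show ?thesis by simp
  qed
  have "heat_energy w h = (LINT x|lborel. convol (gauss h) (convol (gauss h) w) x * w x)"
    unfolding heat_energy_def by (rule convol_gauss_self_adjoint[OF h G1 w])
  also have "\<dots> = (LINT x|lborel. w x * convol (gauss (2 * h)) w x)" by (simp add: gg mult.commute)
  finally have "heat_energy w h = (LINT x|lborel. w x * convol (gauss (2 * h)) w x)" .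
  thus ?thesis unfolding heat_energy_def[of w "2 * h"]
    using integral_Cauchy_Schwarz[OF L1Linf_mult_integrable(1)[OF w w] L1Linf_mult_integrable(1)[OF G2 G2] L1Linf_mult_integrable(1)[OF w G2]] by simp
qed

lemma heat_energy_le:
  fixes w :: "'a::euclidean_space \<Rightarrow> real"
  assumes t: "t > 0" and w: "L1Linf w A B"
  shows "heat_energy w t \<le> (4 * pi * t) powr (- real DIM('a) / 2) * A\<^sup>2"
proof -
  let ?c = "(4 * pi * t) powr (- real DIM('a) / 2)"
  have G1: "L1Linf (convol (gauss t) w) A B" by (rule L1Linf_convol_gauss[OF t w])
  have "\<bar>convol (gauss t) w x\<bar> \<le> ?c * A" for x
  proof -
    have "\<bar>convol (gauss t) w x\<bar> \<le> ?c * (LINT x|lborel. \<bar>w x\<bar>)"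
      by (rule abs_convol_le[OF _ L1LinfD(4)[OF L1Linf_gauss[OF t]] L1LinfD(6)[OF w]]) measurable
    also have "\<dots> \<le> ?c * A" using L1LinfD(8)[OF w] by (intro mult_left_mono) auto
    finally show ?thesis .
  qed
  hence G2: "L1Linf (convol (gauss t) w) A (?c * A)" using G1 by (auto simp: L1Linf_def)
  show ?thesis using L1Linf_mult_integrable(3)[OF G2 G2] unfolding heat_energy_def by (simp add: power2_eq_square ac_simps)
qed

text \<open>With E for the heat energy, doubling gives E(T/2^(m+1))^2 \<le> e E(T/2^m), and R m =
  (1/4)^(1/2^m) solves R m = R (m + 1)^2 exactly. A step of length T/2^m thus gains a factor whose
  2^m-th power is 1/4.\<close>

lemma heat_energy_dyadic:
  assumes T: "T > 0" and w: "L1Linf w A B" and e: "(LINT x|lborel. w x * w x) \<le> e" "heat_energy w T \<le> e / 4"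
  shows "heat_energy w (T / 2 ^ m) \<le> e * (1/4) powr (1 / 2 ^ m)"
proof -
  define R where "R m = (1/4::real) powr (1 / 2 ^ m)" for m :: nat
  have R0: "R 0 = 1/4" by (simp add: R_def)
  have Rpos: "0 \<le> R m" for m by (simp add: R_def)
  have RS: "R m = R (Suc m) * R (Suc m)" for m
  proof -
    have half: "1 / 2 ^ Suc m + 1 / 2 ^ Suc m = (1 / 2 ^ m :: real)" by (simp add: field_simps)
    show ?thesis unfolding R_def powr_add[symmetric] half ..
  qed
  have e0: "0 \<le> e" using heat_energy_nonneg[of w T] e(2) by linarith
  have "heat_energy w (T / 2 ^ m) \<le> e * R m"
  proof (induction m)
    case 0 thus ?case using e by (simp add: R0)
  next
    case (Suc m)
    have half: "2 * (T / 2 ^ Suc m) = T / 2 ^ m" by (simp add: field_simps)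
    have "(heat_energy w (T / 2 ^ Suc m))\<^sup>2 \<le> (LINT x|lborel. w x * w x) * heat_energy w (T / 2 ^ m)"
      using heat_energy_doubling[OF _ w, of "T / 2 ^ Suc m"] T unfolding half by simp
    also have "\<dots> \<le> e * (e * R m)"
      by (rule mult_mono[OF e(1) Suc e0 heat_energy_nonneg])
    also have "\<dots> = (e * R (Suc m))\<^sup>2" unfolding RS[of m] by (simp add: power2_eq_square)
    finally show ?case by (rule power2_le_imp_le) (use e0 Rpos in simp)
  qed
  thus ?thesis by (simp add: R_def)
qed

context mild_solution
begin

lemma energy_nonneg: "0 \<le> energy t"
  unfolding energy_def by (intro integral_nonneg_AE AE_I2) simp

lemma energy_le: "0 < t \<Longrightarrow> energy t \<le> M\<^sup>2"
  using L1Linf_mult_integrable(3)[OF vL vL, of t t] unfolding energy_def by (simp add: power2_eq_square)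

text \<open>The interval [t, t + T] is cut into 2^m steps. Each step replaces the energy, or the
  floor 4c if that is larger, by r times it plus an error C h^(5/4), where r^(2^m) = 1/4. The errors
  add up to at most C T h^(1/4), which vanishes as m grows.\<close>

lemma energy_dissipation:
  assumes t: "t > 1" and T: "T > 0"
  shows "energy (t + T) \<le> max (energy t / 4) (4 * ((4 * pi * T) powr (- real DIM('a) / 2) * M\<^sup>2))"
proof -
  obtain C where C: "0 \<le> C" "\<And>t h. t > 1 \<Longrightarrow> 0 < h \<Longrightarrow> h \<le> 1 \<Longrightarrow> energy (t + h) \<le> heat_energy (v t) h + C * h powr (5/4)"
    using energy_step unfolding heat_energy_def by blast
  define c where "c = (4 * pi * T) powr (- real DIM('a) / 2) * M\<^sup>2"
  have c0: "0 \<le> c" by (simp add: c_def)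
  have bound: "energy (t + T) \<le> max (energy t / 4) (4 * c) + C * T * (T / 2 ^ m) powr (1/4)" if m: "T / 2 ^ m \<le> 1" for m
  proof -
    define h where "h = T / 2 ^ m"
    define r where "r = (1/4::real) powr (1 / 2 ^ m)"
    have h: "0 < h" "h \<le> 1" using T m by (auto simp: h_def)
    have r: "0 \<le> r" "r \<le> 1" by (auto simp: r_def powr_le1)
    have step: "energy (s + h) \<le> max (energy s) (4 * c) * r + C * h powr (5/4)" if s: "s > 1" for s
    proof -
      have s0: "s > 0" using s by simp
      have "heat_energy (v s) T \<le> c" unfolding c_def by (rule heat_energy_le[OF T vL[OF s0]])
      \<comment> \<open>The floor 4c makes the heat bound c at time T at most a quarter of the
        maximum, as the dyadic lemma requires.\<close>
      hence "heat_energy (v s) T \<le> max (energy s) (4 * c) / 4" by (simp add: max_def)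
      moreover have "(LINT x|lborel. v s x * v s x) \<le> max (energy s) (4 * c)" by (simp add: energy_def)
      ultimately have "heat_energy (v s) (T / 2 ^ m) \<le> max (energy s) (4 * c) * (1/4) powr (1 / 2 ^ m)"
        by (intro heat_energy_dyadic[OF T vL[OF s0]])
      thus ?thesis using C(2)[OF s h] unfolding h_def r_def by linarith
    qed
    have iter: "energy (t + real i * h) \<le> max (energy t * r ^ i) (4 * c) + real i * (C * h powr (5/4))" for i
    proof (induction i)
      case 0 thus ?case by simp
    next
      case (Suc i)
      define \<epsilon> where "\<epsilon> = C * h powr (5/4)"
      have \<epsilon>: "0 \<le> \<epsilon>" using C(1) by (simp add: \<epsilon>_def)
      have "0 \<le> real i * h" using h by simp
      hence ti: "t + real i * h > 1" using t by linarith
      have "energy (t + real (Suc i) * h) = energy (t + real i * h + h)" by (simp add: algebra_simps)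
      also have "\<dots> \<le> max (energy (t + real i * h)) (4 * c) * r + \<epsilon>" unfolding \<epsilon>_def by (rule step[OF ti])
      also have "max (energy (t + real i * h)) (4 * c) \<le> max (energy t * r ^ i) (4 * c) + real i * \<epsilon>"
      proof (rule max.boundedI)
        show "energy (t + real i * h) \<le> max (energy t * r ^ i) (4 * c) + real i * \<epsilon>" using Suc unfolding \<epsilon>_def .
        have "0 \<le> real i * \<epsilon>" using \<epsilon> by simp
        thus "4 * c \<le> max (energy t * r ^ i) (4 * c) + real i * \<epsilon>" by linarith
      qed
      hence "max (energy (t + real i * h)) (4 * c) * r \<le> (max (energy t * r ^ i) (4 * c) + real i * \<epsilon>) * r"
        using r by (intro mult_right_mono)
      also have "\<dots> = max (energy t * r ^ Suc i) (4 * c * r) + real i * \<epsilon> * r"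
        using r by (simp add: distrib_right max_mult_distrib_right mult.assoc mult.commute[of r])
      also have "\<dots> \<le> max (energy t * r ^ Suc i) (4 * c) + real i * \<epsilon>"
      proof (intro add_mono max.mono order_refl)
        show "4 * c * r \<le> 4 * c" using c0 r by (simp add: mult_left_le)
        show "real i * \<epsilon> * r \<le> real i * \<epsilon>" using \<epsilon> r by (simp add: mult_left_le)
      qed
      finally show ?case unfolding \<epsilon>_def[symmetric] by (simp add: algebra_simps)
    qed
    have rN: "r ^ (2 ^ m) = 1 / 4" by (simp add: r_def powr_realpow[symmetric] powr_powr)
    have hN: "real (2 ^ m) * h = T" by (simp add: h_def)
    have "h powr (1 + 1/4) = h powr 1 * h powr (1/4)" by (rule powr_add)
    hence "real (2 ^ m) * (C * h powr (5/4)) = C * (real (2 ^ m) * h) * h powr (1/4)" using h by simp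
    hence "real (2 ^ m) * (C * h powr (5/4)) = C * T * h powr (1/4)" unfolding hN .
    hence "energy (t + T) \<le> max (energy t * (1 / 4)) (4 * c) + C * T * h powr (1/4)"
      using iter[of "2 ^ m"] unfolding rN hN by linarith
    thus ?thesis by (simp add: h_def)
  qed
  have "(\<lambda>m. max (energy t / 4) (4 * c) + C * T * (T / 2 ^ m) powr (1/4)) \<longlonglongrightarrow> max (energy t / 4) (4 * c) + C * T * 0"
  proof (intro tendsto_intros)
    have "(\<lambda>m. T / 2 ^ m) \<longlonglongrightarrow> 0" using tendsto_mult[OF tendsto_const[of T] LIMSEQ_inverse_realpow_zero[of 2]] by (simp add: divide_inverse)
    thus "(\<lambda>m. (T / 2 ^ m) powr (1/4)) \<longlonglongrightarrow> 0" using T by (intro tendsto_zero_powrI[where b="1/4"]) auto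
  qed
  moreover have "\<exists>N. \<forall>m\<ge>N. energy (t + T) \<le> max (energy t / 4) (4 * c) + C * T * (T / 2 ^ m) powr (1/4)"
  proof -
    obtain N where N: "T < 2 ^ N" using real_arch_pow[of 2 T] by auto
    have "T / 2 ^ m \<le> 1" if "m \<ge> N" for m
    proof -
      have "(2::real) ^ N \<le> 2 ^ m" using that by (intro power_increasing) auto
      hence "T \<le> 2 ^ m" using N by linarith
      thus ?thesis by simp
    qed
    thus ?thesis using bound by blast
  qed
  ultimately have "energy (t + T) \<le> max (energy t / 4) (4 * c) + C * T * 0" by (rule LIMSEQ_le_const)
  thus ?thesis unfolding c_def by simp
qed

text \<open>Dyadic induction over the interval [t/2, t]: the factor 1/4 beats the loss 2^(1/2) from
  halving the time, and the floor is O(t^(-n/2)), hence O(t^(-1/2)). A dimension-free exponent is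
  enough for the bootstrap that follows.\<close>

lemma energy_decay:
  assumes "t > 1"
  shows "energy t \<le> 4 * M\<^sup>2 * t powr (- 1 / 2)"
proof -
  have base: "energy t \<le> 4 * M\<^sup>2 * t powr (- 1 / 2)" if "1 < t" "t \<le> 2" for t
  proof -
    have "(1/4::real) = 4 powr (- 1)" by (simp add: powr_minus)
    also have "\<dots> \<le> 4 powr (- 1 / 2)" by (intro powr_mono) auto
    also have "\<dots> \<le> t powr (- 1 / 2)" using that by (intro powr_mono2') auto
    finally have "M\<^sup>2 * 1 \<le> M\<^sup>2 * (4 * t powr (- 1 / 2))" by (intro mult_left_mono) auto
    thus ?thesis using energy_le[of t] that by (simp add: ac_simps)
  qed
  have "\<forall>t. 1 < t \<longrightarrow> t \<le> 2 * 2 ^ j \<longrightarrow> energy t \<le> 4 * M\<^sup>2 * t powr (- 1 / 2)" for j :: nat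
  proof (induction j)
    case 0 thus ?case using base by simp
  next
    case (Suc j)
    show ?case
    proof (intro allI impI)
      fix t :: real assume t: "1 < t" "t \<le> 2 * 2 ^ Suc j"
      show "energy t \<le> 4 * M\<^sup>2 * t powr (- 1 / 2)"
      proof (cases "t \<le> 2")
        case True thus ?thesis using base t by simp
      next
        case False
        hence t2: "1 < t / 2" "0 < t / 2" "t / 2 \<le> 2 * 2 ^ j" using t by auto
        have "energy (t / 2 + t / 2) \<le> max (energy (t / 2) / 4) (4 * ((4 * pi * (t / 2)) powr (- real DIM('a) / 2) * M\<^sup>2))"
          by (rule energy_dissipation[OF t2(1,2)])
        also have "\<dots> \<le> 4 * M\<^sup>2 * t powr (- 1 / 2)"
        proof (rule max.boundedI)
          have "(t / 2) powr (- 1 / 2) = t powr (- 1 / 2) * 2 powr (1/2)"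
            using t by (simp add: powr_divide powr_minus field_simps)
          also have "\<dots> \<le> t powr (- 1 / 2) * 2 powr 1" by (intro mult_left_mono powr_mono) auto
          finally have "(t / 2) powr (- 1 / 2) \<le> t powr (- 1 / 2) * 2" by simp
          hence "(t / 2) powr (- 1 / 2) / 4 \<le> t powr (- 1 / 2)" using powr_ge_zero[of t "- 1 / 2"] by linarith
          hence "4 * M\<^sup>2 * ((t / 2) powr (- 1 / 2) / 4) \<le> 4 * M\<^sup>2 * t powr (- 1 / 2)" by (intro mult_left_mono) auto
          moreover have "energy (t / 2) \<le> 4 * M\<^sup>2 * (t / 2) powr (- 1 / 2)" using Suc t2 by blast
          ultimately show "energy (t / 2) / 4 \<le> 4 * M\<^sup>2 * t powr (- 1 / 2)" by linarith
          have ge1: "4 * pi * (t / 2) \<ge> t" using t pi_gt3 by (simp add: field_simps)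
          have "(4 * pi * (t / 2)) powr (- real DIM('a) / 2) \<le> (4 * pi * (t / 2)) powr (- 1 / 2)"
            by (rule powr_mono) (use ge1 t DIM_positive[where ?'a='a] in linarith)+
          also have "\<dots> \<le> t powr (- 1 / 2)" using ge1 t by (intro powr_mono2') auto
          finally show "4 * ((4 * pi * (t / 2)) powr (- real DIM('a) / 2) * M\<^sup>2) \<le> 4 * M\<^sup>2 * t powr (- 1 / 2)"
            by (simp add: mult_left_mono mult.commute)
        qed
        finally show ?thesis by simp
      qed
    qed
  qed
  moreover obtain j :: nat where "t < 2 ^ j" using real_arch_pow[of 2 t] by auto
  moreover have "(2::real) ^ j \<le> 2 * 2 ^ j" by simp
  ultimately show ?thesis using assms less_imp_le order_trans by metis
qed

end

section \<open>Decay of the sup norm\<close>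

text \<open>Trades decay for a weaker singularity: Q carries the harmless singularity, y both the
  decay and the excess singularity, and \<theta> selects how much of y is kept.\<close>

lemma interpolate_le:
  fixes Q X y \<theta> :: real
  assumes "0 \<le> Q" "0 \<le> y" "0 \<le> \<theta>" "\<theta> \<le> 1" "X \<le> Q" "X \<le> Q * y"
  shows "X \<le> Q * y powr \<theta>"
proof (cases "y = 0")
  case False
  hence y: "y > 0" using assms by simp
  show ?thesis
  proof (cases "y \<ge> 1")
    case True
    hence "Q * 1 \<le> Q * y powr \<theta>" using assms by (intro mult_left_mono ge_one_powr_ge_zero) auto
    thus ?thesis using assms by simp
  next
    case False
    hence "y powr 1 \<le> y powr \<theta>" using y assms by (intro powr_mono') auto
    hence "Q * y \<le> Q * y powr \<theta>" using y assms by (intro mult_left_mono) auto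
    thus ?thesis using assms by simp
  qed
qed (use assms in auto)

lemma powr_half_le:
  fixes s t e :: real
  assumes "t > 0" "t / 2 \<le> s" "0 \<le> e"
  shows "s powr (- e) \<le> 2 powr e * t powr (- e)"
proof -
  have "s powr (- e) \<le> (t / 2) powr (- e)" using assms by (intro powr_mono2') auto
  also have "\<dots> = 2 powr e * t powr (- e)" using assms by (simp add: powr_divide powr_minus field_simps)
  finally show ?thesis .
qed

context mild_solution
begin

text \<open>Restart at t - 1, so that the energy decay is used on the last unit of time. From L2 to
  the sup norm the kernel costs \<tau>^(-1/2 - n/4), not integrable for n \<ge> 2; interpolating
  with weight 1/n against the sup bound leaves \<tau>^(-3/4), at the price of the small exponent
  1/(4n).\<close>

lemma sup_decay_weak:
  obtains C where "0 < C" "\<And>t x. t > 2 \<Longrightarrow> \<bar>v t x\<bar> \<le> C * t powr (- (1 / (4 * real DIM('a))))"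
proof -
  define n where "n = real DIM('a)"
  have n: "n \<ge> 1" using DIM_positive[where ?'a='a] by (simp add: n_def Suc_le_eq)
  \<comment> \<open>The 3 bounds sqrt 8: a factor 4 comes from \<open>energy_decay\<close> and a
    factor at most 2 from s \<ge> t/2.\<close>
  have se: "sqrt (energy s) \<le> 3 * M * t powr (- (1/4))" if "t > 2" "t / 2 \<le> s" for s t
  proof (rule real_le_lsqrt)
    have "energy s \<le> 4 * M\<^sup>2 * s powr (- (1 / 2))" using energy_decay[of s] that by simp
    also have "\<dots> \<le> 4 * M\<^sup>2 * (2 powr (1/2) * t powr (- (1 / 2)))"
      using that by (intro mult_left_mono powr_half_le) auto
    also have "\<dots> \<le> 4 * M\<^sup>2 * (2 * t powr (- (1 / 2)))"
      using powr_mono[of "1/2" 1 "2::real"] by (intro mult_left_mono mult_right_mono) auto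
    also have "\<dots> \<le> 9 * M\<^sup>2 * t powr (- (1 / 2))" by (simp add: mult_right_mono)
    also have "\<dots> = (3 * M * t powr (- (1/4)))\<^sup>2"
    proof -
      have "t powr (- (1/2)) = t powr (- (1/4)) * t powr (- (1/4))" by (simp add: powr_add[symmetric])
      thus ?thesis by (simp add: power2_eq_square)
    qed
    finally show "energy s \<le> (3 * M * t powr (- (1/4)))\<^sup>2" .
  qed (use M_nonneg in auto)
  define \<kappa> where "\<kappa> = dgauss_const a"
  have \<kappa>: "0 \<le> \<kappa>" unfolding \<kappa>_def by (rule dgauss_const_nonneg)
  \<comment> \<open>12 is 3 times the integral 4 of (1 - s)^(-3/4); the summand 1 makes the constant
    positive.\<close>
  have "\<bar>v t x\<bar> \<le> (3 * M + 12 * \<kappa> * \<Lambda> * M + 1) * t powr (- (1 / (4 * n)))" if t: "t > 2" for t x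
  proof -
    have t1: "t - 1 > 0" "t / 2 \<le> t - 1" using t by auto
    have tn: "t powr (- (1/4)) \<le> t powr (- (1 / (4 * n)))" using t n by (intro powr_mono) (auto simp: field_simps)
    have "\<bar>convol (gauss 1) (v (t - 1)) x\<bar> \<le> sqrt (1 * (4 * pi * 1) powr (- real DIM('a) / 2)) * sqrt (energy (t - 1))"
      unfolding energy_def by (rule abs_convol_le_L2[OF L1Linf_gauss vL[OF t1(1)]]) simp
    also have "\<dots> \<le> 1 * (3 * M * t powr (- (1/4)))"
    proof (rule mult_mono)
      have "(4 * pi * 1) powr (- real DIM('a) / 2) \<le> (4 * pi * 1) powr 0" using pi_gt3 by (intro powr_mono) auto
      thus "sqrt (1 * (4 * pi * 1) powr (- real DIM('a) / 2)) \<le> 1" by simp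
    qed (use se[OF t t1(2)] energy_nonneg in auto)
    also have "\<dots> \<le> 3 * M * t powr (- (1 / (4 * n)))" using tn M_nonneg by (simp add: mult_left_mono)
    finally have 1: "\<bar>convol (gauss 1) (v (t - 1)) x\<bar> \<le> 3 * M * t powr (- (1 / (4 * n)))" .
    let ?F = "\<lambda>s. convol (dgauss a (1 - s)) (\<lambda>y. f (v (t - 1 + s) y)) x"
    have "\<bar>LBINT s:{0<..<1}. ?F s\<bar> \<le> 3 * \<kappa> * \<Lambda> * M * t powr (- (1 / (4 * n))) * (1 powr (- 3 / 4 + 1) / (- 3 / 4 + 1))"
    proof (rule abs_time_integral_le(1))
      show "?F \<in> borel_measurable borel" by (rule convol_dgauss_measurable[OF gm_shift]) measurable
      show "((\<lambda>s. 3 * \<kappa> * \<Lambda> * M * t powr (- (1 / (4 * n))) * (1 - s) powr (- 3 / 4)) has_integral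
          3 * \<kappa> * \<Lambda> * M * t powr (- (1 / (4 * n))) * (1 powr (- 3 / 4 + 1) / (- 3 / 4 + 1))) {0..1}"
        by (intro has_integral_mult_right has_integral_powr_reflect) auto
      fix s :: real assume s: "0 < s" "s < 1"
      define \<tau> where "\<tau> = 1 - s"
      have \<tau>: "\<tau> > 0" using s by (simp add: \<tau>_def)
      have s0: "t - 1 + s > 0" "t / 2 \<le> t - 1 + s" using t1 s by auto
      note g = gL[OF s0(1)]
      define Q where "Q = 3 * \<kappa> * \<Lambda> * M * \<tau> powr (- 1 / 2)"
      have Q: "0 \<le> Q" using \<kappa> \<Lambda>_nonneg M_nonneg by (simp add: Q_def)
      have X1: "\<bar>?F s\<bar> \<le> Q"
      proof -
        have "\<bar>?F s\<bar> \<le> \<kappa> * \<tau> powr (- 1 / 2) * (\<Lambda> * M)"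
          unfolding \<kappa>_def \<tau>_def[symmetric] by (rule L1LinfD(4)[OF L1Linf_convol_dgauss[OF \<tau> g]])
        moreover have "0 \<le> \<kappa> * \<tau> powr (- 1 / 2) * (\<Lambda> * M)" using \<kappa> \<Lambda>_nonneg M_nonneg by simp
        ultimately show ?thesis unfolding Q_def by (simp add: ac_simps)
      qed
      have X2: "\<bar>?F s\<bar> \<le> Q * (\<tau> powr (- n / 4) * t powr (- (1/4)))"
      proof -
        have "\<bar>?F s\<bar> \<le> sqrt (\<kappa> * \<tau> powr (- 1 / 2) * (\<kappa> * \<tau> powr (- 1 / 2 - n / 2))) * sqrt (LINT y|lborel. f (v (t - 1 + s) y) * f (v (t - 1 + s) y))"
          unfolding \<kappa>_def \<tau>_def[symmetric] n_def by (rule abs_convol_le_L2[OF L1Linf_dgauss[OF \<tau>] g])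
        also have "\<kappa> * \<tau> powr (- 1 / 2) * (\<kappa> * \<tau> powr (- 1 / 2 - n / 2)) = (\<kappa> * \<tau> powr (- 1 / 2) * \<tau> powr (- n / 4))\<^sup>2"
        proof -
          have "\<tau> powr (- 1 / 2 - n / 2) = \<tau> powr (- 1 / 2) * (\<tau> powr (- n / 4) * \<tau> powr (- n / 4))"
            by (simp add: powr_add[symmetric] field_simps)
          thus ?thesis by (simp add: power2_eq_square)
        qed
        also have "sqrt ((\<kappa> * \<tau> powr (- 1 / 2) * \<tau> powr (- n / 4))\<^sup>2) = \<kappa> * \<tau> powr (- 1 / 2) * \<tau> powr (- n / 4)" using \<kappa> by simp
        also have "sqrt (LINT y|lborel. f (v (t - 1 + s) y) * f (v (t - 1 + s) y)) \<le> \<Lambda> * (3 * M * t powr (- (1/4)))"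
        proof -
          have "(LINT y|lborel. f (v (t - 1 + s) y) * f (v (t - 1 + s) y)) \<le> (LINT y|lborel. \<Lambda>\<^sup>2 * (v (t - 1 + s) y * v (t - 1 + s) y))"
          proof (rule integral_mono)
            fix y
            have "\<bar>f (v (t - 1 + s) y)\<bar> \<le> \<bar>\<Lambda> * v (t - 1 + s) y\<bar>"
              using f_le[OF v_bound[OF s0(1)], of y] \<Lambda>_nonneg by (simp add: abs_mult)
            hence "(f (v (t - 1 + s) y))\<^sup>2 \<le> (\<Lambda> * v (t - 1 + s) y)\<^sup>2" by (rule abs_le_square_iff[THEN iffD1])
            thus "f (v (t - 1 + s) y) * f (v (t - 1 + s) y) \<le> \<Lambda>\<^sup>2 * (v (t - 1 + s) y * v (t - 1 + s) y)"
              by (simp add: power2_eq_square ac_simps)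
          qed (use L1Linf_mult_integrable(1)[OF g g] L1Linf_mult_integrable(1)[OF vL[OF s0(1)] vL[OF s0(1)]] in auto)
          also have "\<dots> = \<Lambda>\<^sup>2 * energy (t - 1 + s)" by (simp add: energy_def)
          finally have "sqrt (LINT y|lborel. f (v (t - 1 + s) y) * f (v (t - 1 + s) y)) \<le> sqrt (\<Lambda>\<^sup>2 * energy (t - 1 + s))"
            by (rule real_sqrt_le_mono)
          also have "\<dots> = \<Lambda> * sqrt (energy (t - 1 + s))" using \<Lambda>_nonneg by (simp add: real_sqrt_mult)
          also have "\<dots> \<le> \<Lambda> * (3 * M * t powr (- (1/4)))" using \<Lambda>_nonneg by (intro mult_left_mono se t s0)
          finally show ?thesis .
        qed
        finally have "\<bar>?F s\<bar> \<le> \<kappa> * \<tau> powr (- 1 / 2) * \<tau> powr (- n / 4) * (\<Lambda> * (3 * M * t powr (- (1/4))))"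
          using \<kappa> by (simp add: mult_left_mono)
        thus ?thesis unfolding Q_def by (simp add: ac_simps)
      qed
      have "\<bar>?F s\<bar> \<le> Q * (\<tau> powr (- n / 4) * t powr (- (1/4))) powr (1 / n)"
        by (rule interpolate_le[OF Q _ _ _ X1 X2]) (use n in auto)
      also have "(\<tau> powr (- n / 4) * t powr (- (1/4))) powr (1 / n) = \<tau> powr (- 1 / 4) * t powr (- (1 / (4 * n)))"
        using n by (simp add: powr_mult powr_powr)
      also have "Q * (\<tau> powr (- 1 / 4) * t powr (- (1 / (4 * n)))) = 3 * \<kappa> * \<Lambda> * M * t powr (- (1 / (4 * n))) * (\<tau> powr (- 1 / 2) * \<tau> powr (- 1 / 4))"
        unfolding Q_def by simp
      also have "\<tau> powr (- 1 / 2) * \<tau> powr (- 1 / 4) = \<tau> powr (- 3 / 4)" by (simp add: powr_add[symmetric])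
      finally show "\<bar>?F s\<bar> \<le> 3 * \<kappa> * \<Lambda> * M * t powr (- (1 / (4 * n))) * (1 - s) powr (- 3 / 4)" unfolding \<tau>_def .
    qed (use \<kappa> \<Lambda>_nonneg M_nonneg in auto)
    hence 2: "\<bar>LBINT s:{0<..<1}. ?F s\<bar> \<le> 12 * \<kappa> * \<Lambda> * M * t powr (- (1 / (4 * n)))" by simp
    have "v t x = convol (gauss 1) (v (t - 1)) x + (LBINT s:{0<..<1}. ?F s)"
      using restart[OF t1(1), of 1 x] by (simp add: duhamel_def)
    hence "\<bar>v t x\<bar> \<le> 3 * M * t powr (- (1 / (4 * n))) + 12 * \<kappa> * \<Lambda> * M * t powr (- (1 / (4 * n)))" using 1 2 by linarith
    moreover have "(3 * M + 12 * \<kappa> * \<Lambda> * M + 1) * t powr (- (1 / (4 * n))) = 3 * M * t powr (- (1 / (4 * n))) + 12 * \<kappa> * \<Lambda> * M * t powr (- (1 / (4 * n))) + t powr (- (1 / (4 * n)))"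
      by (simp add: algebra_simps)
    ultimately show ?thesis using powr_ge_zero[of t "- (1 / (4 * n))"] by linarith
  qed
  moreover have "0 < 3 * M + 12 * \<kappa> * \<Lambda> * M + 1"
  proof -
    have "0 \<le> 12 * \<kappa> * \<Lambda> * M" using \<kappa> \<Lambda>_nonneg M_nonneg by simp
    thus ?thesis using M_nonneg by linarith
  qed
  ultimately show ?thesis using that unfolding n_def by blast
qed

text \<open>The conclusion is linear in the assumed constant N, with a factor t^(-\<delta>) that
  allows N to be absorbed. Restarting at t/2 leaves only source times s \<ge> t/2. One power of the
  sup bound of v takes the assumed rate, a further power \<omega> takes the weak decay; this surplus
  is positive because p > 1 + 1/n.\<close>

lemma sup_decay_step:
  assumes pn: "p > 1 + 1 / real DIM('a)"
  obtains C \<delta> where "0 \<le> C" "0 < \<delta>"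
    "\<And>N T t x. 0 < N \<Longrightarrow> (\<And>s x. 0 < s \<Longrightarrow> s \<le> T \<Longrightarrow> \<bar>v s x\<bar> \<le> N * s powr (- (real DIM('a) / 2))) \<Longrightarrow> 6 \<le> t \<Longrightarrow> t \<le> T \<Longrightarrow>
      \<bar>v t x\<bar> \<le> (M + C * N * t powr (- \<delta>)) * t powr (- (real DIM('a) / 2))"
proof -
  define n where "n = real DIM('a)"
  have n: "n \<ge> 1" using DIM_positive[where ?'a='a] by (simp add: n_def Suc_le_eq)
  obtain C1 where C1: "0 < C1" "\<And>t x. t > 2 \<Longrightarrow> \<bar>v t x\<bar> \<le> C1 * t powr (- (1 / (4 * n)))"
    using sup_decay_weak unfolding n_def by blast
  define \<alpha> where "\<alpha> = 1 / (4 * n)"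
  have \<alpha>: "\<alpha> > 0" using n by (simp add: \<alpha>_def)
  define \<mu> where "\<mu> = p - 1 - 1 / n"
  have \<mu>: "\<mu> > 0" using pn by (simp add: \<mu>_def n_def)
  \<comment> \<open>The weight 1/n would give the singularity \<tau>^(-1), so \<theta> stays below
    it by \<epsilon>. The bound 1/(2n) keeps \<theta> \<ge> 0; the other bound keeps the loss n
    \<epsilon>/2 below the gain \<alpha> \<omega>.\<close>
  define \<epsilon> where "\<epsilon> = min (1 / (2 * n)) (\<alpha> * \<mu> / n)"
  have \<epsilon>: "\<epsilon> > 0" using n \<alpha> \<mu> by (simp add: \<epsilon>_def)
  have \<epsilon>1: "\<epsilon> \<le> 1 / (2 * n)" unfolding \<epsilon>_def by simp
  have "\<epsilon> \<le> \<alpha> * \<mu> / n" unfolding \<epsilon>_def by simp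
  hence \<epsilon>2: "n * \<epsilon> \<le> \<alpha> * \<mu>" using n by (simp add: field_simps)
  define \<theta> where "\<theta> = 1 / n - \<epsilon>"
  have "1 / (2 * n) \<le> 1 / n" "1 / n \<le> 1" using n by (auto simp: field_simps)
  hence \<theta>: "0 \<le> \<theta>" "\<theta> \<le> 1" using \<epsilon> \<epsilon>1 by (auto simp: \<theta>_def)
  define \<omega> where "\<omega> = p - 1 - \<theta>"
  have \<omega>: "\<omega> = \<mu> + \<epsilon>" by (simp add: \<omega>_def \<theta>_def \<mu>_def)
  have \<omega>0: "\<omega> > 0" using \<mu> \<epsilon> \<omega> by simp
  define \<delta> where "\<delta> = \<alpha> * \<omega> - n * \<epsilon> / 2"
  have \<delta>: "\<delta> > 0"
  proof -
    have "\<alpha> * \<omega> = \<alpha> * \<mu> + \<alpha> * \<epsilon>" by (simp add: \<omega> algebra_simps)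
    moreover have "\<alpha> * \<mu> > 0" "\<alpha> * \<epsilon> > 0" using \<alpha> \<mu> \<epsilon> by auto
    ultimately show ?thesis using \<epsilon>2 unfolding \<delta>_def by linarith
  qed
  define \<kappa> where "\<kappa> = dgauss_const a"
  have \<kappa>: "0 \<le> \<kappa>" unfolding \<kappa>_def by (rule dgauss_const_nonneg)
  define e where "e = n / 2 + \<alpha> * \<omega>"
  have e: "e \<ge> 0" using n \<alpha> \<omega>0 by (simp add: e_def)
  define C4 where "C4 = \<kappa> * L * M powr \<theta> * C1 powr \<omega> * 2 powr e"
  have C4: "0 \<le> C4" using \<kappa> L by (simp add: C4_def)
  define C3 where "C3 = C4 / (n * \<epsilon> / 2)"
  have C3: "0 \<le> C3" using C4 n \<epsilon> by (simp add: C3_def)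
  have "\<bar>v t x\<bar> \<le> (M + C3 * N * t powr (- \<delta>)) * t powr (- (n / 2))"
    if N: "0 < N" and b: "\<And>s x. 0 < s \<Longrightarrow> s \<le> T \<Longrightarrow> \<bar>v s x\<bar> \<le> N * s powr (- (n / 2))" and t: "6 \<le> t" "t \<le> T" for N T t x
  proof -
    \<comment> \<open>t \<ge> 6 keeps all source times above the threshold 2 of the weak
      decay.\<close>
    define h where "h = t / 2"
    have h: "h > 0" "h > 2" "h + h = t" "h \<le> t" using t by (auto simp: h_def)
    have "\<bar>convol (gauss h) (v h) x\<bar> \<le> (4 * pi * h) powr (- real DIM('a) / 2) * (LINT x|lborel. \<bar>v h x\<bar>)"
      by (rule abs_convol_le[OF _ L1LinfD(4)[OF L1Linf_gauss[OF h(1)]] L1LinfD(6)[OF vL[OF h(1)]]]) measurable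
    also have "\<dots> \<le> t powr (- real DIM('a) / 2) * M"
      using L1LinfD(8)[OF vL[OF h(1)]] t pi_gt3 M_nonneg
      by (intro mult_mono powr_mono2') (auto simp: h_def field_simps intro!: integral_nonneg_AE)
    finally have 1: "\<bar>convol (gauss h) (v h) x\<bar> \<le> M * t powr (- (n / 2))" by (simp add: n_def mult.commute)
    let ?F = "\<lambda>r. convol (dgauss a (h - r)) (\<lambda>y. f (v (h + r) y)) x"
    let ?k = "C4 * N * t powr (- e)"
    have "\<bar>LBINT r:{0<..<h}. ?F r\<bar> \<le> ?k * (h powr ((- 1 + n * \<epsilon> / 2) + 1) / ((- 1 + n * \<epsilon> / 2) + 1))"
    proof (rule abs_time_integral_le(1))
      show "?F \<in> borel_measurable borel" by (rule convol_dgauss_measurable[OF gm_shift]) measurable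
      show "((\<lambda>r. ?k * (h - r) powr (- 1 + n * \<epsilon> / 2)) has_integral
          ?k * (h powr ((- 1 + n * \<epsilon> / 2) + 1) / ((- 1 + n * \<epsilon> / 2) + 1))) {0..h}"
        using h n \<epsilon> by (intro has_integral_mult_right has_integral_powr_reflect) auto
      fix r :: real assume r: "0 < r" "r < h"
      define \<tau> where "\<tau> = h - r"
      define s where "s = h + r"
      have \<tau>: "\<tau> > 0" using r by (simp add: \<tau>_def)
      have s: "s > 0" "s > 2" "s \<le> T" "t / 2 \<le> s" using h r t by (auto simp: s_def h_def)
      \<comment> \<open>The smaller of the assumed and the weak bound: m itself is later estimated
        by the first and m^\<omega> by the second.\<close>
      define m where "m = min (N * s powr (- (n / 2))) (C1 * s powr (- \<alpha>))"
      have m: "m > 0" using N C1 s by (simp add: m_def)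
      have vm': "\<bar>v s y\<bar> \<le> m" for y unfolding m_def \<alpha>_def using b[OF s(1,3), of y] C1(2)[OF s(2), of y] by simp
      have vLm: "L1Linf (v s) M m" using vL[OF s(1)] vm' by (auto simp: L1Linf_def)
      define c where "c = L * m powr (p - 1)"
      have c: "0 \<le> c" using L by (simp add: c_def)
      have g: "L1Linf (\<lambda>y. f (v s y)) (c * M) (c * m)"
      proof (rule L1Linf_dominated[OF vLm])
        show "\<bar>f (v s y)\<bar> \<le> c * \<bar>v s y\<bar>" for y
        proof -
          have "\<bar>f (v s y)\<bar> \<le> L * \<bar>v s y\<bar> powr (p - 1) * \<bar>v s y\<bar>" by (rule f_le_powr)
          also have "\<dots> \<le> c * \<bar>v s y\<bar>" unfolding c_def
            using L p vm'[of y] by (intro mult_right_mono mult_left_mono powr_mono2) auto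
          finally show ?thesis .
        qed
        show "(\<lambda>y. f (v s y)) \<in> borel_measurable borel" by measurable
      qed (use c in auto)
      define Q where "Q = \<kappa> * \<tau> powr (- 1 / 2) * (c * m)"
      have Q: "0 \<le> Q" using \<kappa> c m by (simp add: Q_def)
      have X1: "\<bar>?F r\<bar> \<le> Q"
        unfolding Q_def \<kappa>_def \<tau>_def[symmetric] s_def[symmetric] by (rule L1LinfD(4)[OF L1Linf_convol_dgauss[OF \<tau> g]])
      have X2: "\<bar>?F r\<bar> \<le> Q * (\<tau> powr (- n / 2) * M / m)"
      proof -
        have "\<bar>?F r\<bar> \<le> \<kappa> * \<tau> powr (- 1 / 2 - n / 2) * (c * M)"
          unfolding \<kappa>_def n_def \<tau>_def[symmetric] s_def[symmetric] by (rule abs_convol_dgauss_le_L1[OF \<tau> g])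
        also have "\<tau> powr (- 1 / 2 - n / 2) = \<tau> powr (- 1 / 2) * \<tau> powr (- n / 2)" by (simp add: powr_add[symmetric])
        finally show ?thesis unfolding Q_def using m by (simp add: ac_simps)
      qed
      have "\<bar>?F r\<bar> \<le> Q * (\<tau> powr (- n / 2) * M / m) powr \<theta>"
        by (rule interpolate_le[OF Q _ \<theta> X1 X2]) (use m M_nonneg in simp)
      also have "\<dots> = \<kappa> * L * M powr \<theta> * (\<tau> powr (- 1 / 2) * \<tau> powr (- n / 2 * \<theta>)) * (m * (m powr (p - 1) / m powr \<theta>))"
        unfolding Q_def c_def using m M_nonneg by (simp add: powr_mult powr_divide powr_powr)
      also have "m powr (p - 1) / m powr \<theta> = m powr \<omega>" unfolding \<omega>_def by (rule powr_diff[symmetric])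
      also have "\<tau> powr (- 1 / 2) * \<tau> powr (- n / 2 * \<theta>) = \<tau> powr (- 1 + n * \<epsilon> / 2)"
      proof -
        have "- 1 / 2 + - n / 2 * \<theta> = - 1 + n * \<epsilon> / 2" using n by (simp add: \<theta>_def field_simps)
        thus ?thesis by (simp only: powr_add[symmetric])
      qed
      also have "\<kappa> * L * M powr \<theta> * \<tau> powr (- 1 + n * \<epsilon> / 2) * (m * m powr \<omega>)
         \<le> \<kappa> * L * M powr \<theta> * \<tau> powr (- 1 + n * \<epsilon> / 2) * (N * (C1 powr \<omega> * (2 powr e * t powr (- e))))"
      proof (rule mult_left_mono)
        have "m * m powr \<omega> \<le> (N * s powr (- (n / 2))) * (C1 * s powr (- \<alpha>)) powr \<omega>"
          using m \<omega>0 N C1 by (intro mult_mono powr_mono2) (auto simp: m_def)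
        also have "\<dots> = N * (C1 powr \<omega> * (s powr (- (n / 2)) * s powr (- (\<alpha> * \<omega>))))"
          by (simp add: powr_mult powr_powr)
        also have "s powr (- (n / 2)) * s powr (- (\<alpha> * \<omega>)) = s powr (- e)" by (simp add: powr_add[symmetric] e_def)
        also have "N * (C1 powr \<omega> * s powr (- e)) \<le> N * (C1 powr \<omega> * (2 powr e * t powr (- e)))"
          using N t s e by (intro mult_left_mono powr_half_le) auto
        finally show "m * m powr \<omega> \<le> N * (C1 powr \<omega> * (2 powr e * t powr (- e)))" .
      qed (use \<kappa> L in auto)
      also have "\<dots> = ?k * (h - r) powr (- 1 + n * \<epsilon> / 2)" by (simp add: C4_def \<tau>_def)
      finally show "\<bar>?F r\<bar> \<le> ?k * (h - r) powr (- 1 + n * \<epsilon> / 2)" .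
    qed (use C4 N in auto)
    also have "\<dots> = C3 * N * t powr (- e) * h powr (n * \<epsilon> / 2)" by (simp add: C3_def)
    also have "\<dots> \<le> C3 * N * t powr (- e) * t powr (n * \<epsilon> / 2)"
      using C3 N h n \<epsilon> by (intro mult_left_mono powr_mono2) auto
    also have "\<dots> = C3 * N * (t powr (- e) * t powr (n * \<epsilon> / 2))" by simp
    also have "t powr (- e) * t powr (n * \<epsilon> / 2) = t powr (- \<delta>) * t powr (- (n / 2))"
      by (simp add: powr_add[symmetric] e_def \<delta>_def algebra_simps)
    finally have 2: "\<bar>LBINT r:{0<..<h}. ?F r\<bar> \<le> C3 * N * t powr (- \<delta>) * t powr (- (n / 2))" by simp
    have "v t x = convol (gauss h) (v h) x + (LBINT r:{0<..<h}. ?F r)"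
      using restart[OF h(1) h(1), of x] h(3) by (simp add: duhamel_def)
    hence "\<bar>v t x\<bar> \<le> M * t powr (- (n / 2)) + C3 * N * t powr (- \<delta>) * t powr (- (n / 2))" using 1 2 by linarith
    thus ?thesis by (simp add: distrib_right)
  qed
  thus ?thesis using that[of C3 \<delta>] C3 \<delta> unfolding n_def by blast
qed

text \<open>The uniform bound gives a first constant N0 that depends on the horizon t. Each use of
  the bootstrap step replaces K + N0/2^j by K + N0/2^(j+1), so N0 disappears in the limit while K
  does not depend on t.\<close>

lemma sup_decay:
  assumes pn: "p > 1 + 1 / real DIM('a)"
  obtains C where "0 < C" "\<And>t x. 0 < t \<Longrightarrow> \<bar>v t x\<bar> \<le> C * t powr (- (real DIM('a) / 2))"
proof -
  define n where "n = real DIM('a)"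
  have n: "n \<ge> 1" using DIM_positive[where ?'a='a] by (simp add: n_def Suc_le_eq)
  obtain C \<delta> where C: "0 \<le> C" "0 < \<delta>"
    and step: "\<And>N T t x. 0 < N \<Longrightarrow> (\<And>s x. 0 < s \<Longrightarrow> s \<le> T \<Longrightarrow> \<bar>v s x\<bar> \<le> N * s powr (- (n / 2))) \<Longrightarrow> 6 \<le> t \<Longrightarrow> t \<le> T \<Longrightarrow>
      \<bar>v t x\<bar> \<le> (M + C * N * t powr (- \<delta>)) * t powr (- (n / 2))"
    using sup_decay_step[OF pn] unfolding n_def by blast
  define T0 where "T0 = max 6 ((2 * C + 1) powr (1 / \<delta>))"
  have T0: "T0 \<ge> 6" by (simp add: T0_def)
  have small: "C * t powr (- \<delta>) \<le> 1 / 2" if "t \<ge> T0" for t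
  proof -
    have "2 * C + 1 = ((2 * C + 1) powr (1 / \<delta>)) powr \<delta>" using C by (simp add: powr_powr)
    also have "\<dots> \<le> t powr \<delta>" using that C by (intro powr_mono2) (auto simp: T0_def)
    finally have "2 * C \<le> t powr \<delta>" by simp
    thus ?thesis using that T0 by (simp add: powr_minus field_simps)
  qed
  define K0 where "K0 = T0 powr (n / 2) * M + 1"
  \<comment> \<open>K0 covers times up to T0 by the uniform bound; the summand 2M gives M + K/2
    \<le> K.\<close>
  define K where "K = K0 + 2 * M"
  have "0 \<le> T0 powr (n / 2) * M" using M_nonneg by simp
  hence K0: "K0 > 0" "K > 0" using M_nonneg unfolding K0_def K_def by linarith+
  have small_t: "\<bar>v s x\<bar> \<le> (R powr (n / 2) * M + 1) * s powr (- (n / 2))" if "0 < s" "s \<le> R" for s x R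
  proof -
    have "s powr (n / 2) \<le> R powr (n / 2)" using that n by (intro powr_mono2) auto
    hence "M * s powr (n / 2) \<le> M * R powr (n / 2)" using M_nonneg by (intro mult_left_mono)
    moreover have "\<bar>v s x\<bar> * s powr (n / 2) \<le> M * s powr (n / 2)" by (intro mult_right_mono v_bound that) auto
    ultimately have "\<bar>v s x\<bar> * s powr (n / 2) \<le> R powr (n / 2) * M + 1" by (simp add: mult.commute)
    thus ?thesis using that by (simp add: powr_minus field_simps)
  qed
  have "\<bar>v t x\<bar> \<le> K * t powr (- (n / 2))" if t: "0 < t" for t x
  proof -
    define N0 where "N0 = t powr (n / 2) * M + 1"
    have N0: "N0 > 0" using M_nonneg by (simp add: N0_def add_nonneg_pos)
    have iter: "\<forall>s x. 0 < s \<longrightarrow> s \<le> t \<longrightarrow> \<bar>v s x\<bar> \<le> (K + N0 / 2 ^ j) * s powr (- (n / 2))" for j :: nat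
    proof (induction j)
      case 0
      show ?case
      proof (intro allI impI)
        fix s x assume s: "0 < s" "s \<le> t"
        have "\<bar>v s x\<bar> \<le> N0 * s powr (- (n / 2))" unfolding N0_def by (rule small_t[OF s])
        also have "\<dots> \<le> (K + N0 / 2 ^ 0) * s powr (- (n / 2))" using K0 by (intro mult_right_mono) auto
        finally show "\<bar>v s x\<bar> \<le> (K + N0 / 2 ^ 0) * s powr (- (n / 2))" .
      qed
    next
      case (Suc j)
      define N where "N = K + N0 / 2 ^ j"
      have N: "N > 0" using K0 N0 by (simp add: N_def add_pos_pos)
      show ?case
      proof (intro allI impI)
        fix s x assume s: "0 < s" "s \<le> t"
        show "\<bar>v s x\<bar> \<le> (K + N0 / 2 ^ Suc j) * s powr (- (n / 2))"
        proof (cases "s \<le> T0")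
          case True
          have "\<bar>v s x\<bar> \<le> K0 * s powr (- (n / 2))" unfolding K0_def by (rule small_t[OF s(1) True])
          also have "\<dots> \<le> (K + N0 / 2 ^ Suc j) * s powr (- (n / 2))"
            using M_nonneg N0 unfolding K_def by (intro mult_right_mono) auto
          finally show ?thesis .
        next
          case False
          hence sT: "s \<ge> T0" "s \<ge> 6" using T0 by auto
          have "\<bar>v s x\<bar> \<le> (M + C * N * s powr (- \<delta>)) * s powr (- (n / 2))"
            by (rule step[OF N _ sT(2) s(2)]) (use Suc in \<open>auto simp: N_def\<close>)
          also have "\<dots> \<le> (K + N0 / 2 ^ Suc j) * s powr (- (n / 2))"
          proof (rule mult_right_mono)
            have "C * N * s powr (- \<delta>) = N * (C * s powr (- \<delta>))" by simp
            also have "\<dots> \<le> N * (1/2)" by (rule mult_left_mono[OF small[OF sT(1)]]) (use N in simp)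
            also have "\<dots> = K / 2 + N0 / 2 ^ Suc j" by (simp add: N_def field_simps)
            finally have "C * N * s powr (- \<delta>) \<le> K / 2 + N0 / 2 ^ Suc j" .
            moreover have "M \<le> K / 2" using K0(1) unfolding K_def by simp
            ultimately show "M + C * N * s powr (- \<delta>) \<le> K + N0 / 2 ^ Suc j" by argo
          qed simp
          finally show ?thesis .
        qed
      qed
    qed
    have "(\<lambda>j. (K + N0 / 2 ^ j) * t powr (- (n / 2))) \<longlonglongrightarrow> (K + N0 * 0) * t powr (- (n / 2))"
      unfolding divide_inverse by (intro tendsto_intros LIMSEQ_inverse_realpow_zero) auto
    hence "\<bar>v t x\<bar> \<le> (K + N0 * 0) * t powr (- (n / 2))"
      by (rule LIMSEQ_le_const) (use iter t in auto)
    thus ?thesis by simp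
  qed
  thus ?thesis using that[OF K0(2)] unfolding n_def by blast
qed

end

section \<open>Rates\<close>

text \<open>The three cases of the statement up to the constant; the exponent will be \<mu> = (j +
  1) \<sigma> for the j-th profile.\<close>

definition rate :: "real \<Rightarrow> real \<Rightarrow> real" where
  "rate \<mu> t = (if \<mu> < 1 / 2 then t powr (- \<mu>) else if \<mu> = 1 / 2 then t powr (- 1 / 2) * ln (2 + t) else t powr (- 1 / 2))"

lemma ln_2_plus_ge_1: "t > 1 \<Longrightarrow> 1 \<le> ln (2 + t :: real)"
  using exp_le ln_ge_iff[of "2 + t" 1] by simp

lemma rate_pos: "t > 1 \<Longrightarrow> 0 < rate \<mu> t"
  using ln_2_plus_ge_1[of t] by (auto simp: rate_def)

lemma rate_ge:
  assumes "t > 1"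
  shows "t powr (- 1 / 2) \<le> rate \<mu> t" "t powr (- \<mu>) \<le> rate \<mu> t"
proof -
  have 1: "t powr (- 1 / 2) * 1 \<le> t powr (- 1 / 2) * ln (2 + t)"
    using ln_2_plus_ge_1[OF assms] by (intro mult_left_mono) auto
  show "t powr (- 1 / 2) \<le> rate \<mu> t" using assms 1 by (auto simp: rate_def intro!: powr_mono)
  show "t powr (- \<mu>) \<le> rate \<mu> t"
  proof (cases "\<mu> = 1 / 2")
    case True
    show ?thesis using 1 unfolding True rate_def by simp
  next
    case False thus ?thesis using assms by (auto simp: rate_def intro!: powr_mono)
  qed
qed

lemma has_integral_powr_from_1:
  fixes q t :: real
  assumes "t \<ge> 1"
  shows "((\<lambda>s. s powr q) has_integral (if q = - 1 then ln t else (t powr (q + 1) - 1) / (q + 1))) {1..t}"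
proof (cases "q = - 1")
  case True
  have "((\<lambda>s. s powr q) has_integral (ln t - ln 1)) {1..t}"
    using True assms by (intro fundamental_theorem_of_calculus)
      (auto intro!: derivative_eq_intros simp: has_real_derivative_iff_has_vector_derivative[symmetric] powr_minus field_simps)
  thus ?thesis using True by simp
next
  case False
  have "((\<lambda>s. s powr q) has_integral (t powr (q + 1) / (q + 1) - 1 powr (q + 1) / (q + 1))) {1..t}"
  proof (rule fundamental_theorem_of_calculus)
    fix s assume s: "s \<in> {1..t}"
    have "((\<lambda>s. s powr (q + 1) / (q + 1)) has_real_derivative (q + 1) * s powr (q + 1 - 1) / (q + 1)) (at s within {1..t})"
      using s by (intro DERIV_cdivide DERIV_subset[OF has_real_derivative_powr]) auto
    thus "((\<lambda>s. s powr (q + 1) / (q + 1)) has_vector_derivative s powr q) (at s within {1..t})"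
      using False by (simp add: has_real_derivative_iff_has_vector_derivative)
  qed (use assms in auto)
  thus ?thesis using False by (simp add: diff_divide_distrib)
qed

text \<open>Size of the source in L1. Before time 1 only the sup decay of the functions involved is
  used, hence the exponent of f(u) alone; after time 1 the rate of the previous profile is gained on
  top.\<close>

definition source_rate :: "real \<Rightarrow> real \<Rightarrow> real \<Rightarrow> real" where
  "source_rate \<sigma> \<mu> s = (if s \<le> 1 then s powr (- 1 / 2 - \<sigma>) else s powr (- 1 / 2 - \<mu>))"

lemma source_rate_nonneg: "0 \<le> source_rate \<sigma> \<mu> s"
  by (simp add: source_rate_def)

text \<open>The integral over [0, 1] is a finite constant since \<sigma> < 1/2 and contributes
  t^(-1/2). From 1 to t the exponent -1/2 - \<mu> passes through -1 at \<mu> = 1/2, which is the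
  origin of the three cases and of the logarithm.\<close>

lemma source_rate_integral:
  assumes \<sigma>: "0 < \<sigma>" "\<sigma> < 1 / 2"
  obtains C where "0 \<le> C" "\<And>t. t > 1 \<Longrightarrow> \<exists>I. (source_rate \<sigma> \<mu> has_integral I) {0..t} \<and> t powr (- 1 / 2) * I \<le> C * rate \<mu> t"
proof -
  define c where "c = (if \<mu> = 1 / 2 then 1 else 1 / \<bar>1 / 2 - \<mu>\<bar>)"
  define C where "C = 1 / (1 / 2 - \<sigma>) + c"
  have c: "0 \<le> c" by (simp add: c_def)
  have C: "0 \<le> C" using \<sigma> c by (simp add: C_def)
  have "\<exists>I. (source_rate \<sigma> \<mu> has_integral I) {0..t} \<and> t powr (- 1 / 2) * I \<le> C * rate \<mu> t" if t: "t > 1" for t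
  proof -
    define P where "P = (if - 1 / 2 - \<mu> = - 1 then ln t else (t powr (- 1 / 2 - \<mu> + 1) - 1) / (- 1 / 2 - \<mu> + 1))"
    have h1: "(source_rate \<sigma> \<mu> has_integral (1 powr (- 1 / 2 - \<sigma> + 1) / (- 1 / 2 - \<sigma> + 1))) {0..1}"
      by (rule has_integral_eq[OF _ has_integral_powr_from_0[of "- 1 / 2 - \<sigma>" 1]]) (use \<sigma> in \<open>auto simp: source_rate_def\<close>)
    have h2: "(source_rate \<sigma> \<mu> has_integral P) {1..t}"
      unfolding P_def by (rule has_integral_eq[OF _ has_integral_powr_from_1[of t "- 1 / 2 - \<mu>"]]) (use t in \<open>auto simp: source_rate_def\<close>)
    have h: "(source_rate \<sigma> \<mu> has_integral (1 / (1 / 2 - \<sigma>) + P)) {0..t}"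
      using has_integral_combine[OF _ _ h1 h2] t by simp
    have P: "t powr (- 1 / 2) * P \<le> c * rate \<mu> t"
    proof (cases "\<mu> = 1 / 2")
      case True
      have "ln t \<le> ln (2 + t)" using t by simp
      thus ?thesis using True unfolding P_def c_def rate_def by (simp add: mult_left_mono)
    next
      case False
      show ?thesis
      proof (cases "\<mu> < 1 / 2")
        case True
        have "P \<le> t powr (1 / 2 - \<mu>) / (1 / 2 - \<mu>)" using False True unfolding P_def by (auto simp: divide_right_mono)
        hence "t powr (- 1 / 2) * P \<le> t powr (- 1 / 2) * (t powr (1 / 2 - \<mu>) / (1 / 2 - \<mu>))" by (intro mult_left_mono) auto
        also have "\<dots> = (t powr (- 1 / 2) * t powr (1 / 2 - \<mu>)) / (1 / 2 - \<mu>)" by simp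
        also have "t powr (- 1 / 2) * t powr (1 / 2 - \<mu>) = t powr (- \<mu>)" by (simp add: powr_add[symmetric])
        finally show ?thesis using True by (simp add: c_def rate_def)
      next
        case m: False
        hence \<mu>: "\<mu> - 1 / 2 > 0" using False by simp
        have "P = (1 - t powr (1 / 2 - \<mu>)) / (\<mu> - 1 / 2)" using \<mu> unfolding P_def by (simp add: field_simps)
        also have "\<dots> \<le> 1 / (\<mu> - 1 / 2)" using \<mu> by (intro divide_right_mono) auto
        finally have "t powr (- 1 / 2) * P \<le> t powr (- 1 / 2) * (1 / (\<mu> - 1 / 2))" by (intro mult_left_mono) auto
        thus ?thesis using \<mu> by (simp add: c_def rate_def abs_if)
      qed
    qed
    have "t powr (- 1 / 2) * (1 / (1 / 2 - \<sigma>)) \<le> rate \<mu> t * (1 / (1 / 2 - \<sigma>))"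
      using rate_ge(1)[OF t, of \<mu>] \<sigma> by (intro mult_right_mono) auto
    hence "t powr (- 1 / 2) * (1 / (1 / 2 - \<sigma>) + P) \<le> C * rate \<mu> t"
      using P by (simp add: C_def algebra_simps)
    thus ?thesis using h by blast
  qed
  thus ?thesis using that C by blast
qed

text \<open>For s < t/2 the kernel time is comparable with t: the kernel leaves t^(-1/2) times the
  integral of the source, and its sup bound supplies t^(-n/2). For s \<ge> t/2 the source is bounded
  by a multiple of its rate at t and supplies t^(-n/2) itself, while the singular factor of the
  kernel integrates to 2 t^(1/2).\<close>

lemma duhamel_decay:
  fixes a :: "'a::euclidean_space"
  assumes \<sigma>: "0 < \<sigma>" "\<sigma> < 1 / 2" "\<sigma> \<le> \<mu>" and B: "0 \<le> B"
    and gm: "(\<lambda>(s,x). g s x) \<in> borel_measurable (borel \<Otimes>\<^sub>M borel)"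
    and g: "\<And>s. 0 < s \<Longrightarrow> L1Linf (g s) (B * source_rate \<sigma> \<mu> s) (B * source_rate \<sigma> \<mu> s * s powr (- (real DIM('a) / 2)))"
  obtains C where "0 \<le> C" "\<And>t. t > 1 \<Longrightarrow> L1Linf (duhamel a g t) (C * rate \<mu> t) (t powr (- (real DIM('a) / 2)) * (C * rate \<mu> t))"
    "\<And>t x. t > 1 \<Longrightarrow> set_integrable lborel {0<..<t} (\<lambda>s. convol (dgauss a (t - s)) (g s) x)"
proof -
  define n where "n = real DIM('a)"
  have n: "n \<ge> 1" using DIM_positive[where ?'a='a] by (simp add: n_def Suc_le_eq)
  define H where "H = source_rate \<sigma> \<mu>"
  have H0: "0 \<le> H s" for s unfolding H_def by (rule source_rate_nonneg)
  obtain C0 where C0: "0 \<le> C0" "\<And>t. t > 1 \<Longrightarrow> \<exists>I. (H has_integral I) {0..t} \<and> t powr (- 1 / 2) * I \<le> C0 * rate \<mu> t"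
    using source_rate_integral[OF \<sigma>(1,2)] unfolding H_def by blast
  define \<kappa> where "\<kappa> = dgauss_const a"
  have \<kappa>: "0 \<le> \<kappa>" unfolding \<kappa>_def by (rule dgauss_const_nonneg)
  \<comment> \<open>Costs of replacing t/2 by t, in the powers of the kernel and in the power of the
    source.\<close>
  define d1 d2 where "d1 = (2::real) powr (1/2 + n/2)" and "d2 = (2::real) powr (1/2 + \<mu>)"
  have d: "d1 \<ge> 1" "d2 \<ge> 1" using n \<sigma> unfolding d1_def d2_def by (auto intro!: ge_one_powr_ge_zero)
  define D where "D = \<kappa> * B * d1 * d2"
  have D0: "0 \<le> D" using \<kappa> B d by (simp add: D_def)
  have D: "\<kappa> * B * d1 \<le> D" "\<kappa> * B * d2 \<le> D"
    using mult_left_mono[OF d(2), of "\<kappa> * B * d1"] mult_left_mono[OF d(1), of "\<kappa> * B * d2"] \<kappa> B d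
    by (simp_all add: D_def ac_simps)
  define C where "C = D * (C0 + 2)"
  have C: "0 \<le> C" using D0 C0 by (simp add: C_def)
  have main: "L1Linf (duhamel a g t) (C * rate \<mu> t) (t powr (- (n / 2)) * (C * rate \<mu> t)) \<and> (\<forall>x. set_integrable lborel {0<..<t} (\<lambda>s. convol (dgauss a (t - s)) (g s) x))"
    if t: "t > 1" for t
  proof -
    obtain I where I: "(H has_integral I) {0..t}" "t powr (- 1 / 2) * I \<le> C0 * rate \<mu> t" using C0(2)[OF t] by blast
    \<comment> \<open>The two summands belong to the two halves of the interval; their sum is one
      majorant on all of it.\<close>
    define \<beta> where "\<beta> s = D * (t powr (- 1 / 2) * H s + t powr (- (1/2 + \<mu>)) * (t - s) powr (- 1 / 2))" for s
    define I' where "I' = D * (t powr (- 1 / 2) * I + t powr (- (1/2 + \<mu>)) * (t powr (- 1 / 2 + 1) / (- 1 / 2 + 1)))"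
    have \<beta>I: "(\<beta> has_integral I') {0..t}"
      unfolding \<beta>_def[abs_def] I'_def using t by (intro has_integral_mult_right has_integral_add I(1) has_integral_powr_reflect) auto
    have \<beta>0: "0 \<le> \<beta> s" for s using D0 H0[of s] by (simp add: \<beta>_def)
    have m: "(\<lambda>(s,x). convol (dgauss a (t - s)) (g s) x) \<in> borel_measurable (borel \<Otimes>\<^sub>M borel)"
      by (rule convol_dgauss_joint_measurable[OF gm])
    have bd: "L1Linf (\<lambda>x. convol (dgauss a (t - s)) (g s) x) (\<beta> s) (t powr (- (n / 2)) * \<beta> s)" if s: "0 < s" "s < t" for s
    proof -
      define \<tau> where "\<tau> = t - s"
      have \<tau>: "\<tau> > 0" using s by (simp add: \<tau>_def)
      have gs: "L1Linf (g s) (B * H s) (B * H s * s powr (- (n / 2)))" using g[OF s(1)] by (simp add: H_def n_def)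
      have L0: "L1Linf (convol (dgauss a \<tau>) (g s)) (\<kappa> * \<tau> powr (- 1 / 2) * (B * H s)) (\<kappa> * \<tau> powr (- 1 / 2) * (B * H s * s powr (- (n / 2))))"
        unfolding \<kappa>_def by (rule L1Linf_convol_dgauss[OF \<tau> gs])
      have p1: "0 \<le> t powr (- (1/2 + \<mu>)) * \<tau> powr (- 1 / 2)" "0 \<le> t powr (- 1 / 2) * H s" using H0[of s] by auto
      show ?thesis
      proof (cases "s < t / 2")
        case True
        have th: "t / 2 \<le> \<tau>" using True by (simp add: \<tau>_def)
        have "\<tau> powr (- (1/2)) \<le> 2 powr (1/2) * t powr (- (1/2))" using t th by (intro powr_half_le) auto
        also have "\<dots> \<le> d1 * t powr (- (1/2))" unfolding d1_def using n by (intro mult_right_mono powr_mono) auto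
        finally have e1: "\<tau> powr (- 1 / 2) \<le> d1 * t powr (- 1 / 2)" by simp
        have e2: "\<tau> powr (- (1/2 + n/2)) \<le> d1 * t powr (- (1/2 + n/2))" unfolding d1_def using t th n by (intro powr_half_le) auto
        have "\<kappa> * \<tau> powr (- 1 / 2) * (B * H s) \<le> \<kappa> * (d1 * t powr (- 1 / 2)) * (B * H s)"
          using \<kappa> B H0 by (intro mult_right_mono mult_left_mono e1) auto
        also have "\<dots> = (\<kappa> * B * d1) * (t powr (- 1 / 2) * H s)" by simp
        also have "\<dots> \<le> D * (t powr (- 1 / 2) * H s)" by (intro mult_right_mono D p1)
        also have "\<dots> \<le> \<beta> s" unfolding \<beta>_def \<tau>_def[symmetric] using D0 p1 by (intro mult_left_mono) auto
        finally have L1: "\<kappa> * \<tau> powr (- 1 / 2) * (B * H s) \<le> \<beta> s" .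
        have Li: "\<bar>convol (dgauss a \<tau>) (g s) x\<bar> \<le> t powr (- (n / 2)) * \<beta> s" for x
        proof -
          have "\<bar>convol (dgauss a \<tau>) (g s) x\<bar> \<le> \<kappa> * \<tau> powr (- (1 / 2 + n / 2)) * (B * H s)"
            using abs_convol_dgauss_le_L1[OF \<tau> gs, of a x] unfolding \<kappa>_def n_def by simp
          also have "\<dots> \<le> \<kappa> * (d1 * t powr (- (1/2 + n/2))) * (B * H s)"
            using \<kappa> B H0 by (intro mult_right_mono mult_left_mono e2) auto
          also have "t powr (- (1/2 + n/2)) = t powr (- 1 / 2) * t powr (- (n / 2))" by (simp add: powr_add[symmetric])
          also have "\<kappa> * (d1 * (t powr (- 1 / 2) * t powr (- (n / 2)))) * (B * H s) = t powr (- (n / 2)) * ((\<kappa> * B * d1) * (t powr (- 1 / 2) * H s))" by simp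
          also have "\<dots> \<le> t powr (- (n / 2)) * (D * (t powr (- 1 / 2) * H s))" by (intro mult_left_mono mult_right_mono D p1) auto
          also have "\<dots> \<le> t powr (- (n / 2)) * \<beta> s" unfolding \<beta>_def \<tau>_def[symmetric] using D0 p1 by (intro mult_left_mono) auto
          finally show ?thesis .
        qed
        show ?thesis using L1Linf_mono[OF L0 L1 order_refl] Li unfolding \<tau>_def[symmetric] by (auto simp: L1Linf_def)
      next
        case False
        hence sh: "t / 2 \<le> s" by simp
        have "H s \<le> s powr (- (1/2 + \<mu>))"
        proof (cases "s \<le> 1")
          \<comment> \<open>Occurs only for t \<le> 2. The early exponent is then dominated because
            \<sigma> \<le> \<mu> and s \<le> 1.\<close>
          case True
          thus ?thesis using s \<sigma> unfolding H_def source_rate_def by (auto intro!: powr_mono')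
        next
          case False thus ?thesis unfolding H_def source_rate_def by (simp add: algebra_simps)
        qed
        also have "\<dots> \<le> d2 * t powr (- (1/2 + \<mu>))" unfolding d2_def using t sh \<sigma> by (intro powr_half_le) auto
        finally have Hs: "H s \<le> d2 * t powr (- (1/2 + \<mu>))" .
        have "\<kappa> * \<tau> powr (- 1 / 2) * (B * H s) \<le> \<kappa> * \<tau> powr (- 1 / 2) * (B * (d2 * t powr (- (1/2 + \<mu>))))"
          using \<kappa> B by (intro mult_left_mono Hs) auto
        also have "\<dots> = (\<kappa> * B * d2) * (t powr (- (1/2 + \<mu>)) * \<tau> powr (- 1 / 2))" by simp
        also have "\<dots> \<le> D * (t powr (- (1/2 + \<mu>)) * \<tau> powr (- 1 / 2))" by (intro mult_right_mono D p1)
        also have "\<dots> \<le> \<beta> s" unfolding \<beta>_def \<tau>_def[symmetric] using D0 p1 by (intro mult_left_mono) auto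
        finally have L1: "\<kappa> * \<tau> powr (- 1 / 2) * (B * H s) \<le> \<beta> s" .
        have d12: "2 powr (n / 2) \<le> d1" unfolding d1_def by (intro powr_mono) auto
        have Li: "\<kappa> * \<tau> powr (- 1 / 2) * (B * H s * s powr (- (n / 2))) \<le> t powr (- (n / 2)) * \<beta> s"
        proof -
          have "s powr (- (n / 2)) \<le> 2 powr (n / 2) * t powr (- (n / 2))" using t sh n by (intro powr_half_le) auto
          also have "\<dots> \<le> d1 * t powr (- (n / 2))" by (intro mult_right_mono d12) auto
          finally have sn: "s powr (- (n / 2)) \<le> d1 * t powr (- (n / 2))" .
          have "\<kappa> * \<tau> powr (- 1 / 2) * (B * H s * s powr (- (n / 2))) \<le> \<kappa> * \<tau> powr (- 1 / 2) * (B * (d2 * t powr (- (1/2 + \<mu>))) * (d1 * t powr (- (n / 2))))"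
            using \<kappa> B H0[of s] d by (intro mult_left_mono mult_mono Hs sn) auto
          also have "\<dots> = t powr (- (n / 2)) * (D * (t powr (- (1/2 + \<mu>)) * \<tau> powr (- 1 / 2)))" by (simp add: D_def)
          also have "\<dots> \<le> t powr (- (n / 2)) * \<beta> s" unfolding \<beta>_def \<tau>_def[symmetric] using D0 p1 by (intro mult_left_mono) auto
          finally show ?thesis .
        qed
        show ?thesis using L1Linf_mono[OF L0 L1 Li] unfolding \<tau>_def[symmetric] by simp
      qed
    qed
    have nn: "0 \<le> t powr (- (n / 2))" by simp
    note r = L1Linf_time_integral[OF m bd \<beta>I \<beta>0 nn]
    have I': "I' \<le> C * rate \<mu> t"
    proof -
      have "t powr (- (1/2 + \<mu>)) * (t powr (- 1 / 2 + 1) / (- 1 / 2 + 1)) = 2 * (t powr (- (1/2 + \<mu>)) * t powr (1/2))" by simp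
      also have "t powr (- (1/2 + \<mu>)) * t powr (1/2) = t powr (- \<mu>)" by (simp add: powr_add[symmetric])
      finally have eq: "t powr (- (1/2 + \<mu>)) * (t powr (- 1 / 2 + 1) / (- 1 / 2 + 1)) = 2 * t powr (- \<mu>)" .
      have "I' \<le> D * (C0 * rate \<mu> t + 2 * rate \<mu> t)"
        unfolding I'_def eq using D0 I(2) rate_ge(2)[OF t, of \<mu>] by (intro mult_left_mono add_mono) auto
      thus ?thesis by (simp add: C_def algebra_simps)
    qed
    have "L1Linf (duhamel a g t) I' (t powr (- (n / 2)) * I')" using r(1) unfolding duhamel_def[abs_def] by simp
    hence "L1Linf (duhamel a g t) (C * rate \<mu> t) (t powr (- (n / 2)) * (C * rate \<mu> t))"
      by (rule L1Linf_mono[OF _ I']) (use I' in \<open>auto intro!: mult_left_mono\<close>)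
    thus ?thesis using r(2) by auto
  qed
  show ?thesis by (rule that[OF C]) (use main in \<open>auto simp: n_def\<close>)
qed

text \<open>The difference is the superposition of the increments G_t(x - y) - G_t(x) with weights
  v0 y, each of L1 size |y| t^(-1/2) up to a constant. The first moment of the datum enters here,
  and the resulting t^(-1/2) is the ceiling of the rates.\<close>

lemma heat_minus_mass:
  fixes v0 :: "'a::euclidean_space \<Rightarrow> real"
  assumes v0: "integrable lborel v0" and mom: "integrable lborel (\<lambda>y. norm y * \<bar>v0 y\<bar>)" and t: "t > 0"
  defines "C \<equiv> moment_const TYPE('a) * (LINT y|lborel. norm y * \<bar>v0 y\<bar>)"
  shows "L1Linf (\<lambda>x. convol (gauss t) v0 x - (LINT y|lborel. v0 y) * gauss t x) (C * t powr (- 1 / 2)) (t powr (- (real DIM('a) / 2)) * (C * t powr (- 1 / 2)))"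
proof -
  have [measurable]: "v0 \<in> borel_measurable borel" using v0 by auto
  define I where "I = (LINT y|lborel. norm y * \<bar>v0 y\<bar>)"
  have I0: "0 \<le> I" unfolding I_def by (intro integral_nonneg_AE) auto
  define k where "k = moment_const TYPE('a) * t powr (- 1 / 2)"
  have k: "0 \<le> k" using moment_const_pos[where ?'a='a] by (simp add: k_def)
  let ?c = "t powr (- (real DIM('a) / 2))"
  have eq: "convol (gauss t) v0 x - (LINT y|lborel. v0 y) * gauss t x = (LINT y|lborel. (gauss t (x - y) - gauss t x) * v0 y)" for x
  proof -
    have "integrable lborel (\<lambda>y. gauss t (x - y) * v0 y)"
      by (rule convol_integrable[of "gauss t", OF _ L1LinfD(4)[OF L1Linf_gauss[OF t]] v0]) measurable
    hence "(LINT y|lborel. (gauss t (x - y) - gauss t x) * v0 y) = (LINT y|lborel. gauss t (x - y) * v0 y) - (LINT y|lborel. gauss t x * v0 y)"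
      using v0 by (simp add: left_diff_distrib)
    thus ?thesis unfolding convol_def by simp
  qed
  have nn: "(\<integral>\<^sup>+y. ennreal (c * (norm y * \<bar>v0 y\<bar>)) \<partial>lborel) = ennreal (c * I)" if "0 \<le> c" for c
    using mom that I0 unfolding I_def by (subst nn_integral_eq_integral) auto
  have "L1Linf (\<lambda>x. LINT y|lborel. (gauss t (x - y) - gauss t x) * v0 y) (k * I) (?c * k * I)"
  proof (rule L1Linf_integral(1)[where \<alpha>="\<lambda>y. k * (norm y * \<bar>v0 y\<bar>)" and \<beta>="\<lambda>y. ?c * k * (norm y * \<bar>v0 y\<bar>)"])
    show "(\<lambda>(y, x). (gauss t (x - y) - gauss t x) * v0 y) \<in> borel_measurable (borel \<Otimes>\<^sub>M borel)" by measurable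
    fix y :: 'a
    have "L1Linf (\<lambda>x. gauss t (x + - y) - gauss t x) (norm y * k) (norm y * (?c * k))"
      unfolding L1Linf_def
    proof (intro conjI allI)
      show "(\<integral>\<^sup>+x. ennreal \<bar>gauss t (x + - y) - gauss t x\<bar> \<partial>lborel) \<le> ennreal (norm y * k)"
        using nn_integral_gauss_diff[OF t, of "- y"] by (simp add: k_def ac_simps)
      fix x
      have "\<bar>gauss t (x + - y) - gauss t x\<bar> \<le> norm y * moment_const TYPE('a) * t powr (- 1 / 2 - real DIM('a) / 2)"
        using abs_gauss_diff_le[OF t, of x "- y"] by simp
      also have "t powr (- 1 / 2 - real DIM('a) / 2) = t powr (- 1 / 2) * ?c" by (simp add: powr_add[symmetric])
      finally show "\<bar>gauss t (x + - y) - gauss t x\<bar> \<le> norm y * (?c * k)" by (simp add: k_def ac_simps)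
    qed (use k in auto)
    from L1Linf_cmult[OF this, of "v0 y"]
    show "L1Linf (\<lambda>x. (gauss t (x - y) - gauss t x) * v0 y) (k * (norm y * \<bar>v0 y\<bar>)) (?c * k * (norm y * \<bar>v0 y\<bar>))"
      by (simp add: ac_simps)
  qed (use nn k I0 in auto)
  thus ?thesis unfolding eq C_def I_def[symmetric] k_def by (simp add: ac_simps)
qed

text \<open>|w|^r is at most the sup bound to the power r - 1 times |w|. With L1 bound R and sup
  bound c R this gives c^(1 - 1/q) R; for c = t^(-n/2) that is the weight of the statement.\<close>

lemma Lnorm_interpolation:
  fixes w h :: "'a::euclidean_space \<Rightarrow> real"
  assumes w: "L1Linf w R (c * R)" and R: "R > 0" and c: "c > 0"
    and h: "h \<in> borel_measurable lebesgue" "AE x in lebesgue. h x = w x" and q: "1 \<le> q"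
  shows "Lnorm q h \<le> ereal (c powr (1 - qinv q) * R)"
proof (cases "q = \<infinity>")
  case True
  have "esssup lebesgue (\<lambda>x. ereal \<bar>h x\<bar>) \<le> ereal (c * R)"
  proof (rule esssup_I)
    show "AE x in lebesgue. ereal \<bar>h x\<bar> \<le> ereal (c * R)" using h(2) by eventually_elim (use L1LinfD(4)[OF w] in simp)
  qed (use h in measurable)
  thus ?thesis using True c by (simp add: Lnorm_def qinv_def)
next
  case False
  then obtain r where r: "q = ereal r" "r \<ge> 1" using q by (cases q) auto
  have [measurable]: "w \<in> borel_measurable borel" by (rule L1LinfD(1)[OF w])
  define I where "I = (\<integral>\<^sup>+ x. ennreal (\<bar>h x\<bar> powr r) \<partial>lebesgue)"
  have cR: "0 \<le> c * R" using c R by simp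
  have "I = (\<integral>\<^sup>+ x. ennreal (\<bar>w x\<bar> powr r) \<partial>lebesgue)"
    unfolding I_def using h(2) by (intro nn_integral_cong_AE) (auto elim: eventually_mono)
  also have "\<dots> = (\<integral>\<^sup>+ x. ennreal (\<bar>w x\<bar> powr r) \<partial>lborel)" by (simp add: nn_integral_completion)
  also have "\<dots> \<le> (\<integral>\<^sup>+ x. ennreal ((c * R) powr (r - 1)) * ennreal \<bar>w x\<bar> \<partial>lborel)"
  proof (rule nn_integral_mono)
    fix x
    have "\<bar>w x\<bar> powr r \<le> (c * R) powr (r - 1) * \<bar>w x\<bar>"
    proof (cases "w x = 0")
      case False
      have "\<bar>w x\<bar> powr r = \<bar>w x\<bar> powr (r - 1) * \<bar>w x\<bar> powr 1" by (simp only: powr_add[symmetric]) simp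
      also have "\<dots> \<le> (c * R) powr (r - 1) * \<bar>w x\<bar> powr 1"
        using L1LinfD(4)[OF w, of x] r by (intro mult_right_mono powr_mono2) auto
      finally show ?thesis by simp
    qed simp
    thus "ennreal (\<bar>w x\<bar> powr r) \<le> ennreal ((c * R) powr (r - 1)) * ennreal \<bar>w x\<bar>"
      by (simp add: ennreal_mult[symmetric] ennreal_leI)
  qed
  also have "\<dots> = ennreal ((c * R) powr (r - 1)) * (\<integral>\<^sup>+ x. ennreal \<bar>w x\<bar> \<partial>lborel)" by (rule nn_integral_cmult) measurable
  also have "\<dots> \<le> ennreal ((c * R) powr (r - 1)) * ennreal R" by (intro mult_left_mono L1LinfD(3)[OF w]) auto
  also have "\<dots> = ennreal ((c * R) powr (r - 1) * R)" using R by (simp add: ennreal_mult)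
  finally have I: "I \<le> ennreal ((c * R) powr (r - 1) * R)" .
  hence Itop: "I \<noteq> \<infinity>" by (auto simp: top_unique)
  have "Lnorm q h = ereal (enn2real I powr (1 / r))"
    using False r h(1) Itop unfolding Lnorm_def I_def by (simp add: Let_def)
  also have "enn2real I powr (1 / r) \<le> ((c * R) powr (r - 1) * R) powr (1 / r)"
    using I R r by (intro powr_mono2 enn2real_leI) auto
  also have "((c * R) powr (r - 1) * R) powr (1 / r) = c powr (1 - 1 / r) * R"
  proof -
    have "((c * R) powr (r - 1) * R) powr (1 / r) = c powr ((r - 1) * (1 / r)) * (R powr ((r - 1) * (1 / r)) * R powr (1 / r))"
      by (simp add: powr_mult powr_powr)
    also have "R powr ((r - 1) * (1 / r)) * R powr (1 / r) = R"
      using r R by (simp only: powr_add[symmetric]) (simp add: field_simps)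
    also have "(r - 1) * (1 / r) = 1 - 1 / r" using r by (simp add: field_simps)
    finally show ?thesis .
  qed
  finally show ?thesis using r False by (simp add: qinv_def)
qed

section \<open>Profile expansion\<close>

lemma borel_measurable_lebesgueI: "h \<in> borel_measurable borel \<Longrightarrow> h \<in> borel_measurable lebesgue"
  by (intro measurable_completion) simp

context mild_solution
begin

lemma f_diff_L1Linf:
  assumes d: "L1Linf (\<lambda>x. w1 x - w2 x) A B" and b: "\<And>x. \<bar>w1 x\<bar> \<le> R" "\<And>x. \<bar>w2 x\<bar> \<le> R"
    and [measurable]: "w1 \<in> borel_measurable borel" "w2 \<in> borel_measurable borel"
  shows "L1Linf (\<lambda>x. f (w1 x) - f (w2 x)) (2 * L * R powr (p - 1) * A) (2 * L * R powr (p - 1) * B)"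
  by (rule L1Linf_dominated[OF d _ lip_local[OF lip L p b]]) (use L in auto)

text \<open>Induction on j; joint measurability of the glued profile is carried along because the
  next Duhamel estimate needs it. The linear parts differ by \<open>heat_minus_mass\<close>. The
  Duhamel parts differ by the one with source f(v) - f(W), where W is A0 up to time 1 and the j-th
  profile afterwards, as in the recursion of the profiles.\<close>

lemma profile_expansion:
  assumes pn: "p > 1 + 1 / real DIM('a)" and mom: "integrable lborel (\<lambda>y. norm y * \<bar>v0 y\<bar>)"
    and mass: "mass0 u0 = (LINT y|lborel. v0 y)"
    and \<sigma>_def: "\<sigma> = real DIM('a) / 2 * (p - 1) - 1 / 2"
    and j: "real j * \<sigma> < 1 / 2" and \<sigma>2: "\<sigma> < 1 / 2"
  shows "(\<lambda>(t,x). if t \<le> 1 then A0 u0 t x else profile a f u0 j t x) \<in> borel_measurable (borel \<Otimes>\<^sub>M borel) \<and>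
    (\<exists>C>0. \<forall>t>1. L1Linf (\<lambda>x. v t x - profile a f u0 j t x) (C * rate ((real j + 1) * \<sigma>) t)
       (t powr (- (real DIM('a) / 2)) * (C * rate ((real j + 1) * \<sigma>) t)))"
proof -
  define n where "n = real DIM('a)"
  have n: "n \<ge> 1" using DIM_positive[where ?'a='a] by (simp add: n_def Suc_le_eq)
  define m0 where "m0 = (LINT y|lborel. v0 y)"
  have A0_eq: "A0 u0 t x = m0 * gauss t x" for t x by (simp add: A0_def mass m0_def)
  have \<sigma>0: "\<sigma> > 0" using pn n unfolding \<sigma>_def n_def[symmetric] by (simp add: field_simps)
  have \<sigma>p: "n / 2 * (p - 1) = 1 / 2 + \<sigma>" by (simp add: \<sigma>_def n_def)
  obtain C1 where C1: "0 < C1" "\<And>t x. 0 < t \<Longrightarrow> \<bar>v t x\<bar> \<le> C1 * t powr (- (n / 2))"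
    using sup_decay[OF pn] unfolding n_def by blast
  have vL1: "L1Linf (v s) M (C1 * s powr (- (n / 2)))" if "s > 0" for s
    using vL[OF that] C1(2)[OF that] by (auto simp: L1Linf_def)
  have A0L: "L1Linf (A0 u0 s) \<bar>m0\<bar> (\<bar>m0\<bar> * s powr (- (n / 2)))" if s: "s > 0" for s
  proof -
    have "(4 * pi * s) powr (- n / 2) \<le> s powr (- (n / 2))" using s n pi_gt3 by (auto intro!: powr_mono2')
    hence "L1Linf (gauss s :: 'a \<Rightarrow> real) 1 (s powr (- (n / 2)))"
      using L1Linf_mono[OF L1Linf_gauss[OF s] order_refl] unfolding n_def by simp
    from L1Linf_cmult[OF this, of m0] show ?thesis by (simp add: A0_eq[abs_def])
  qed
  have vms[measurable]: "v s \<in> borel_measurable borel" if "s > 0" for s by (rule L1LinfD(1)[OF vL[OF that]])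
  \<comment> \<open>This is the origin of \<sigma>: the power p - 1 of the decay s^(-n/2) is s^(-1/2
    - \<sigma>), and \<sigma> measures the distance from p = 1 + 1/n.\<close>
  have Rp: "(R * s powr (- (n / 2))) powr (p - 1) = R powr (p - 1) * s powr (- 1 / 2 - \<sigma>)" for R s
  proof -
    have "- (n / 2) * (p - 1) = - 1 / 2 - \<sigma>" using \<sigma>p by (simp add: field_simps)
    thus ?thesis by (simp only: powr_mult powr_powr)
  qed
  define Kh where "Kh = moment_const TYPE('a) * (LINT y|lborel. norm y * \<bar>v0 y\<bar>)"
  have Kh0: "0 \<le> Kh" unfolding Kh_def using moment_const_pos[where ?'a='a] by (intro mult_nonneg_nonneg integral_nonneg_AE) auto
  have heatL: "L1Linf (\<lambda>x. convol (gauss t) v0 x - A0 u0 t x) (Kh * rate \<mu> t) (t powr (- (n / 2)) * (Kh * rate \<mu> t))" if t: "t > 1" for t \<mu>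
  proof -
    have le: "Kh * t powr (- 1 / 2) \<le> Kh * rate \<mu> t" by (intro mult_left_mono rate_ge(1)[OF t] Kh0)
    have "L1Linf (\<lambda>x. convol (gauss t) v0 x - A0 u0 t x) (Kh * t powr (- 1 / 2)) (t powr (- (n / 2)) * (Kh * t powr (- 1 / 2)))"
      using heat_minus_mass[OF L1LinfD(6)[OF v0L] mom, of t] t unfolding A0_eq m0_def Kh_def n_def by simp
    thus ?thesis by (rule L1Linf_mono[OF _ le]) (use le in \<open>auto intro!: mult_left_mono\<close>)
  qed
  have vv: "v t x = convol (gauss t) v0 x + duhamel a (\<lambda>s y. f (v s y)) t x" if "t > 1" for t x using v_duhamel[of t x] that by simp
  \<comment> \<open>For j = 0 the source is f(v) itself: it is compared with f(0) = 0 and has the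
    same power before and after time 1.\<close>
  define Bv where "Bv = 2 * L * C1 powr (p - 1) * max M C1"
  have Bv: "0 \<le> Bv" using L C1 by (simp add: Bv_def max_def)
  have gvL: "L1Linf (\<lambda>y. f (v s y)) (Bv * source_rate \<sigma> \<sigma> s) (Bv * source_rate \<sigma> \<sigma> s * s powr (- (n / 2)))" if s: "s > 0" for s
  proof -
    have H: "source_rate \<sigma> \<sigma> s = s powr (- 1 / 2 - \<sigma>)" by (simp add: source_rate_def)
    have "L1Linf (\<lambda>x. v s x - 0) (max M C1) (max M C1 * s powr (- (n / 2)))"
      using L1Linf_mono[OF vL1[OF s], of "max M C1" "max M C1 * s powr (- (n / 2))"] by (simp add: mult_right_mono)
    hence "L1Linf (\<lambda>x. f (v s x) - f 0) (2 * L * (C1 * s powr (- (n / 2))) powr (p - 1) * max M C1) (2 * L * (C1 * s powr (- (n / 2))) powr (p - 1) * (max M C1 * s powr (- (n / 2))))"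
      by (rule f_diff_L1Linf) (use C1 s in auto)
    thus ?thesis unfolding Rp H Bv_def f_0 by (simp add: ac_simps)
  qed
  obtain Cv where Cv: "0 \<le> Cv" "\<And>t. t > 1 \<Longrightarrow> L1Linf (duhamel a (\<lambda>s y. f (v s y)) t) (Cv * rate \<sigma> t) (t powr (- (n / 2)) * (Cv * rate \<sigma> t))"
    "\<And>t x. t > 1 \<Longrightarrow> set_integrable lborel {0<..<t} (\<lambda>s. convol (dgauss a (t - s)) (\<lambda>y. f (v s y)) x)"
    using duhamel_decay[OF \<sigma>0 \<sigma>2 order_refl Bv gm gvL[unfolded n_def]] unfolding n_def by blast
  show ?thesis using j unfolding n_def[symmetric]
  proof (induction j)
    case 0
    have "(\<lambda>(t,x). if t \<le> 1 then A0 u0 t x else profile a f u0 0 t x) = (\<lambda>z. m0 * gauss (fst z) (snd z))"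
      by (auto simp: A0_eq)
    moreover have "(\<lambda>z. m0 * gauss (fst z) (snd z)) \<in> borel_measurable (borel \<Otimes>\<^sub>M borel)" by measurable
    moreover have "L1Linf (\<lambda>x. v t x - profile a f u0 0 t x) ((Kh + Cv + 1) * rate ((real 0 + 1) * \<sigma>) t) (t powr (- (n / 2)) * ((Kh + Cv + 1) * rate ((real 0 + 1) * \<sigma>) t))"
      if t: "t > 1" for t
    proof -
      have eq: "v t x - profile a f u0 0 t x = (convol (gauss t) v0 x - A0 u0 t x) + duhamel a (\<lambda>s y. f (v s y)) t x" for x
        using vv[OF t] by simp
      have r: "0 \<le> rate \<sigma> t" using rate_pos[OF t, of \<sigma>] by simp
      have 1: "Kh * rate \<sigma> t + Cv * rate \<sigma> t \<le> (Kh + Cv + 1) * rate \<sigma> t" using r by (simp add: algebra_simps)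
      have "L1Linf (\<lambda>x. v t x - profile a f u0 0 t x) (Kh * rate \<sigma> t + Cv * rate \<sigma> t) (t powr (- (n / 2)) * (Kh * rate \<sigma> t + Cv * rate \<sigma> t))"
        unfolding eq distrib_left by (rule L1Linf_add[OF heatL[OF t] Cv(2)[OF t]])
      hence "L1Linf (\<lambda>x. v t x - profile a f u0 0 t x) ((Kh + Cv + 1) * rate \<sigma> t) (t powr (- (n / 2)) * ((Kh + Cv + 1) * rate \<sigma> t))"
        by (rule L1Linf_mono[OF _ 1]) (intro mult_left_mono 1, simp)
      thus ?thesis by simp
    qed
    moreover have "Kh + Cv + 1 > 0" using Kh0 Cv(1) by simp
    ultimately show ?case by auto
  next
    case (Suc j)
    \<comment> \<open>The second inequality puts the previous error in the pure power case of
      \<open>rate\<close>; the new exponent \<mu> may fall in any of the three.\<close>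
    have js: "real j * \<sigma> < 1 / 2" "(real j + 1) * \<sigma> < 1 / 2" using Suc.prems \<sigma>0 by (auto simp: algebra_simps)
    define W where "W = (\<lambda>t x. if t \<le> 1 then A0 u0 t x else profile a f u0 j t x)"
    have Wm: "(\<lambda>(t,x). W t x) \<in> borel_measurable (borel \<Otimes>\<^sub>M borel)" using Suc.IH[OF js(1)] by (simp add: W_def)
    note [measurable] = Wm
    obtain C where C: "C > 0" "\<And>t. t > 1 \<Longrightarrow> L1Linf (\<lambda>x. v t x - profile a f u0 j t x) (C * rate ((real j + 1) * \<sigma>) t)
       (t powr (- (n / 2)) * (C * rate ((real j + 1) * \<sigma>) t))"
      using Suc.IH[OF js(1)] by blast
    define \<mu> where "\<mu> = (real (Suc j) + 1) * \<sigma>"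
    have \<mu>: "\<sigma> \<le> \<mu>" "\<mu> = \<sigma> + (real j + 1) * \<sigma>" using \<sigma>0 by (auto simp: \<mu>_def algebra_simps)
    define R0 where "R0 = C1 + C + \<bar>m0\<bar>"
    define D where "D = C + M + C1 + \<bar>m0\<bar>"
    have D0: "0 \<le> D" using C C1 M_nonneg by (simp add: D_def)
    have D: "C \<le> D" "M + \<bar>m0\<bar> \<le> D" "C1 + \<bar>m0\<bar> \<le> D" using C C1 M_nonneg by (auto simp: D_def)
    define Bg where "Bg = 2 * L * R0 powr (p - 1) * D"
    have Bg: "0 \<le> Bg" using L D0 by (simp add: Bg_def)
    define g where "g = (\<lambda>s y. f (v s y) - f (W s y))"
    have gm': "(\<lambda>(s,y). g s y) \<in> borel_measurable (borel \<Otimes>\<^sub>M borel)" unfolding g_def by measurable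
    have gL': "L1Linf (g s) (Bg * source_rate \<sigma> \<mu> s) (Bg * source_rate \<sigma> \<mu> s * s powr (- (n / 2)))" if s: "s > 0" for s
    proof -
      have [measurable]: "W s \<in> borel_measurable borel" by measurable
      \<comment> \<open>The gain over the trivial bound: none before time 1, the rate of the
        previous profile after it.\<close>
      define e where "e = (if s \<le> 1 then 1 else s powr (- ((real j + 1) * \<sigma>)))"
      have e0: "0 \<le> e" by (simp add: e_def)
      have H: "source_rate \<sigma> \<mu> s = s powr (- 1 / 2 - \<sigma>) * e"
      proof (cases "s \<le> 1")
        case False
        have "- 1 / 2 - \<mu> = (- 1 / 2 - \<sigma>) + - ((real j + 1) * \<sigma>)" using \<mu>(2) by simp
        thus ?thesis using False unfolding source_rate_def e_def by (simp only: powr_add if_False)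
      qed (simp add: source_rate_def e_def)
      have dl: "L1Linf (\<lambda>x. v s x - W s x) (D * e) (D * e * s powr (- (n / 2)))"
      proof (cases "s \<le> 1")
        case True
        have "L1Linf (\<lambda>x. v s x - A0 u0 s x) (M + \<bar>m0\<bar>) (C1 * s powr (- (n / 2)) + \<bar>m0\<bar> * s powr (- (n / 2)))"
          by (rule L1Linf_diff[OF vL1[OF s] A0L[OF s]])
        moreover have "C1 * s powr (- (n / 2)) + \<bar>m0\<bar> * s powr (- (n / 2)) \<le> D * s powr (- (n / 2))"
          unfolding distrib_right[symmetric] by (intro mult_right_mono D) auto
        ultimately have "L1Linf (\<lambda>x. v s x - A0 u0 s x) D (D * s powr (- (n / 2)))"
          by (rule L1Linf_mono[OF _ D(2)])
        thus ?thesis using True by (simp add: W_def e_def)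
      next
        case False
        hence s1: "s > 1" by simp
        have re: "rate ((real j + 1) * \<sigma>) s = e" using js(2) False by (simp add: rate_def e_def)
        have 1: "C * e \<le> D * e" using D(1) e0 by (rule mult_right_mono)
        have "L1Linf (\<lambda>x. v s x - profile a f u0 j s x) (C * e) (s powr (- (n / 2)) * (C * e))" using C(2)[OF s1] unfolding re .
        hence "L1Linf (\<lambda>x. v s x - profile a f u0 j s x) (D * e) (s powr (- (n / 2)) * (D * e))"
          by (rule L1Linf_mono[OF _ 1]) (intro mult_left_mono 1, simp)
        thus ?thesis using False by (simp add: W_def mult.commute)
      qed
      have b1: "\<bar>v s x\<bar> \<le> R0 * s powr (- (n / 2))" for x
        by (rule order.trans[OF C1(2)[OF s]], intro mult_right_mono) (use C in \<open>auto simp: R0_def\<close>)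
      have b2: "\<bar>W s x\<bar> \<le> R0 * s powr (- (n / 2))" for x
      proof (cases "s \<le> 1")
        case True
        have "\<bar>A0 u0 s x\<bar> \<le> \<bar>m0\<bar> * s powr (- (n / 2))" by (rule L1LinfD(4)[OF A0L[OF s]])
        also have "\<dots> \<le> R0 * s powr (- (n / 2))" using C C1 by (intro mult_right_mono) (auto simp: R0_def)
        finally show ?thesis using True by (simp add: W_def)
      next
        case False
        hence s1: "s > 1" by simp
        have re: "rate ((real j + 1) * \<sigma>) s \<le> 1"
        proof -
          have "s powr (- ((real j + 1) * \<sigma>)) \<le> s powr 0" using s1 \<sigma>0 by (intro powr_mono) auto
          thus ?thesis using js(2) s1 by (simp add: rate_def)
        qed
        have "\<bar>v s x - profile a f u0 j s x\<bar> \<le> s powr (- (n / 2)) * (C * rate ((real j + 1) * \<sigma>) s)" by (rule L1LinfD(4)[OF C(2)[OF s1]])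
        also have "\<dots> \<le> s powr (- (n / 2)) * (C * 1)" using C(1) re by (intro mult_left_mono) auto
        finally have "\<bar>profile a f u0 j s x\<bar> \<le> C1 * s powr (- (n / 2)) + C * s powr (- (n / 2))" using C1(2)[OF s, of x] by (simp add: mult.commute)
        also have "\<dots> \<le> R0 * s powr (- (n / 2))" unfolding distrib_right[symmetric] by (intro mult_right_mono) (auto simp: R0_def)
        finally show ?thesis using False by (simp add: W_def)
      qed
      have "L1Linf (\<lambda>x. f (v s x) - f (W s x)) (2 * L * (R0 * s powr (- (n / 2))) powr (p - 1) * (D * e)) (2 * L * (R0 * s powr (- (n / 2))) powr (p - 1) * (D * e * s powr (- (n / 2))))"
        by (rule f_diff_L1Linf[OF dl b1 b2]) (use s in auto)
      thus ?thesis unfolding Rp H Bg_def g_def by (simp add: ac_simps)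
    qed
    obtain Cg where Cg: "0 \<le> Cg" "\<And>t. t > 1 \<Longrightarrow> L1Linf (duhamel a g t) (Cg * rate \<mu> t) (t powr (- (n / 2)) * (Cg * rate \<mu> t))"
      "\<And>t x. t > 1 \<Longrightarrow> set_integrable lborel {0<..<t} (\<lambda>s. convol (dgauss a (t - s)) (g s) x)"
      using duhamel_decay[OF \<sigma>0 \<sigma>2 \<mu>(1) Bg gm' gL'[unfolded n_def]] unfolding n_def by blast
    have gvi: "integrable lborel (\<lambda>y. f (v s y))" "integrable lborel (g s)" if "s > 0" for s
      using L1LinfD(6)[OF gL[OF that]] L1LinfD(6)[OF gL'[OF that]] by auto
    \<comment> \<open>f(W) is not estimated directly; its integrability and its Duhamel integral
      come from those of f(v) and of the difference g.\<close>
    have fWi: "integrable lborel (\<lambda>y. f (W s y))" if "s > 0" for s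
      using Bochner_Integration.integrable_diff[OF gvi[OF that]] by (simp add: g_def)
    have cW: "convol (dgauss a \<tau>) (\<lambda>y. f (W s y)) x = convol (dgauss a \<tau>) (\<lambda>y. f (v s y)) x - convol (dgauss a \<tau>) (g s) x" if "\<tau> > 0" "s > 0" for \<tau> s x
    proof -
      have "convol (dgauss a \<tau>) (\<lambda>y. f (v s y) - g s y) x = convol (dgauss a \<tau>) (\<lambda>y. f (v s y)) x - convol (dgauss a \<tau>) (g s) x"
        by (rule convol_diff_right[OF _ abs_dgauss_le_sup[OF that(1)] gvi[OF that(2)]]) measurable
      thus ?thesis by (simp add: g_def)
    qed
    let ?FW = "\<lambda>t x s. convol (dgauss a (t - s)) (\<lambda>y. f (W s y)) x"
    have FWi: "set_integrable lborel {0<..<t} (?FW t x)" and FWd: "duhamel a (\<lambda>s y. f (W s y)) t x = duhamel a (\<lambda>s y. f (v s y)) t x - duhamel a g t x" if t: "t > 1" for t x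
    proof -
      have eq: "?FW t x s = convol (dgauss a (t - s)) (\<lambda>y. f (v s y)) x - convol (dgauss a (t - s)) (g s) x" if "s \<in> {0<..<t}" for s
        using cW[of "t - s" s x] that by simp
      note d = set_integral_diff[OF Cv(3)[OF t, of x] Cg(3)[OF t, of x]]
      show "set_integrable lborel {0<..<t} (?FW t x)"
        using d(1) eq by (subst set_integrable_cong[OF refl refl eq]) auto
      show "duhamel a (\<lambda>s y. f (W s y)) t x = duhamel a (\<lambda>s y. f (v s y)) t x - duhamel a g t x"
        unfolding duhamel_def d(2)[symmetric] using eq by (intro set_lebesgue_integral_cong) auto
    qed
    have prof: "profile a f u0 (Suc j) t x = A0 u0 t x + duhamel a (\<lambda>s y. f (W s y)) t x" if t: "t > 1" for t x
    proof -
      have dd: "dderiv a (heat (t - s) (\<lambda>y. f (W s y))) x = ?FW t x s" if "0 < s" "s < t" for s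
        by (rule dderiv_heat_eq_convol) (use that fWi[OF that(1)] in \<open>auto intro!: borel_measurable_lebesgueI\<close>)
      have i1: "(LBINT s=ereal 0..ereal 1. dderiv a (heat (t - s) (\<lambda>y. f (A0 u0 s y))) x) = (LBINT s:{0<..<1}. ?FW t x s)"
      proof -
        have "dderiv a (heat (t - s) (\<lambda>y. f (A0 u0 s y))) x = ?FW t x s" if "s \<in> {0<..<1}" for s
          using dd[of s] that t by (simp add: W_def)
        thus ?thesis unfolding interval_lebesgue_integral_def einterval_eq by (auto intro!: set_lebesgue_integral_cong)
      qed
      have i2: "(LBINT s=ereal 1..ereal t. dderiv a (heat (t - s) (\<lambda>y. f (profile a f u0 j s y))) x) = (LBINT s:{1<..<t}. ?FW t x s)"
      proof -
        have "dderiv a (heat (t - s) (\<lambda>y. f (profile a f u0 j s y))) x = ?FW t x s" if "s \<in> {1<..<t}" for s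
          using dd[of s] that by (simp add: W_def)
        thus ?thesis using t unfolding interval_lebesgue_integral_def by (auto intro!: set_lebesgue_integral_cong)
      qed
      show ?thesis unfolding duhamel_def using set_integral_split[OF _ t FWi[OF t, of x]] i1 i2 by simp
    qed
    have m1: "(\<lambda>(t,x). if t \<le> 1 then A0 u0 t x else profile a f u0 (Suc j) t x) \<in> borel_measurable (borel \<Otimes>\<^sub>M borel)"
    proof -
      have [measurable]: "(\<lambda>(t,x). duhamel a (\<lambda>s y. f (W s y)) t x) \<in> borel_measurable (borel \<Otimes>\<^sub>M borel)"
        by (rule duhamel_measurable) measurable
      have "(\<lambda>(t,x). if t \<le> 1 then A0 u0 t x else profile a f u0 (Suc j) t x)
          = (\<lambda>(t,x). if t \<le> 1 then m0 * gauss t x else m0 * gauss t x + duhamel a (\<lambda>s y. f (W s y)) t x)"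
        using prof by (auto simp: A0_eq fun_eq_iff simp del: profile.simps)
      thus ?thesis by (simp only:) measurable
    qed
    have "L1Linf (\<lambda>x. v t x - profile a f u0 (Suc j) t x) ((Kh + Cg + 1) * rate \<mu> t) (t powr (- (n / 2)) * ((Kh + Cg + 1) * rate \<mu> t))" if t: "t > 1" for t
    proof -
      have eq: "v t x - profile a f u0 (Suc j) t x = (convol (gauss t) v0 x - A0 u0 t x) + duhamel a g t x" for x
        unfolding prof[OF t] vv[OF t] FWd[OF t] by simp
      have r: "0 \<le> rate \<mu> t" using rate_pos[OF t, of \<mu>] by simp
      have 1: "Kh * rate \<mu> t + Cg * rate \<mu> t \<le> (Kh + Cg + 1) * rate \<mu> t" using r by (simp add: algebra_simps)
      have "L1Linf (\<lambda>x. v t x - profile a f u0 (Suc j) t x) (Kh * rate \<mu> t + Cg * rate \<mu> t) (t powr (- (n / 2)) * (Kh * rate \<mu> t + Cg * rate \<mu> t))"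
        unfolding eq distrib_left by (rule L1Linf_add[OF heatL[OF t] Cg(2)[OF t]])
      thus ?thesis by (rule L1Linf_mono[OF _ 1]) (intro mult_left_mono 1, simp)
    qed
    moreover have "Kh + Cg + 1 > 0" using Kh0 Cg(1) by simp
    ultimately show ?case using m1 unfolding \<mu>_def by blast
  qed
qed

end

section \<open>From the representative back to the solution, and from two norms to all q\<close>

theorem theorem2p1:
  fixes a :: "'a::euclidean_space" and f :: "real \<Rightarrow> real" and p :: real and k :: nat
    and u0 :: "'a \<Rightarrow> real" and u :: "real \<Rightarrow> 'a \<Rightarrow> real"
  defines "n \<equiv> real DIM('a)"
  defines "\<sigma> \<equiv> n / 2 * (p - 1) - 1 / 2"
  assumes a_nz: "a \<noteq> 0"
    and p_gt1: "p > 1"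
    and f_C1: "\<exists>f'. (\<forall>x. (f has_real_derivative f' x) (at x)) \<and> continuous_on UNIV f'"
    and f_nz: "\<exists>x. f x \<noteq> 0"
    and f_0: "f 0 = 0"
    and f_lip: "\<exists>C. \<forall>\<xi> \<eta>. \<bar>f \<xi> - f \<eta>\<bar> \<le> C * (\<bar>\<xi>\<bar> powr (p - 1) + \<bar>\<eta>\<bar> powr (p - 1)) * \<bar>\<xi> - \<eta>\<bar>"
    and k_pos: "k > 0"
    and p_lo: "1 + 1 / n < p"
    and p_hi: "p < 1 + (real k + 1) / (real k * n)"
    and u0_L1: "integrable lebesgue u0"
    and u0_L11: "\<forall>j\<in>Basis. integrable lebesgue (\<lambda>x. (x \<bullet> j) * u0 x)"
    and u0_Linf: "u0 \<in> borel_measurable lebesgue" "\<exists>M. AE x in lebesgue. \<bar>u0 x\<bar> \<le> M"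
    and sol: "is_global_solution a f u0 u"
  shows "\<forall>q::ereal. 1 \<le> q \<longrightarrow> (\<exists>C>0. \<forall>t>2 ^ k.
           ereal (t powr (n / 2 * (1 - qinv q))) * Lnorm q (\<lambda>x. u t x - profile a f u0 k t x)
           \<le> ereal (if (real k + 1) * \<sigma> < 1 / 2 then C * t powr (- (real k + 1) * \<sigma>)
                    else if (real k + 1) * \<sigma> = 1 / 2 then C * t powr (- 1 / 2) * ln (2 + t)
                    else C * t powr (- 1 / 2)))"
proof -
  have n: "n \<ge> 1" using DIM_positive[where ?'a='a] by (simp add: n_def Suc_le_eq)
  obtain f' where f': "\<And>x. (f has_real_derivative f' x) (at x)" using f_C1 by blast
  have f_cont: "continuous_on UNIV f" by (rule DERIV_continuous_on[OF DERIV_subset[OF f']]) auto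
  obtain L0 where L0: "\<And>\<xi> \<eta>. \<bar>f \<xi> - f \<eta>\<bar> \<le> L0 * (\<bar>\<xi>\<bar> powr (p - 1) + \<bar>\<eta>\<bar> powr (p - 1)) * \<bar>\<xi> - \<eta>\<bar>"
    using f_lip by blast
  define L where "L = \<bar>L0\<bar>"
  have L: "0 \<le> L" by (simp add: L_def)
  have lip: "\<bar>f \<xi> - f \<eta>\<bar> \<le> L * (\<bar>\<xi>\<bar> powr (p - 1) + \<bar>\<eta>\<bar> powr (p - 1)) * \<bar>\<xi> - \<eta>\<bar>" for \<xi> \<eta>
    by (rule order.trans[OF L0], intro mult_right_mono) (auto simp: L_def)
  obtain K where K: "AE x in lebesgue. \<bar>u0 x\<bar> \<le> K" using u0_Linf(2) by blast
  obtain v1 where v1: "v1 \<in> borel_measurable lborel" "AE x in lborel. u0 x = v1 x"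
    using completion_ex_borel_measurable_real[OF u0_Linf(1)] by blast
  \<comment> \<open>A Borel version of the datum, clipped so that it is bounded at every
    point.\<close>
  define v0 where "v0 x = max (- \<bar>K\<bar>) (min \<bar>K\<bar> (v1 x))" for x
  have v0m[measurable]: "v0 \<in> borel_measurable borel" unfolding v0_def[abs_def] using v1(1) by simp
  have u0v0: "AE x in lebesgue. u0 x = v0 x"
    using AE_completion[OF v1(2)] K
  proof eventually_elim
    case (elim x) thus ?case unfolding v0_def by linarith
  qed
  \<comment> \<open>Used with c = 1 for the datum itself and with c a coordinate for its first
    moments.\<close>
  have transfer: "integrable lborel (\<lambda>x. c x * v0 x)" if "c \<in> borel_measurable borel" "integrable lebesgue (\<lambda>x. c x * u0 x)" for c
  proof -
    have m: "(\<lambda>x. c x * v0 x) \<in> borel_measurable lborel" using that by simp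
    have "integrable lebesgue (\<lambda>x. c x * v0 x)"
      by (rule integrable_cong_AE_imp[OF that(2)]) (use m u0v0 in \<open>auto intro!: borel_measurable_lebesgueI elim: eventually_mono\<close>)
    thus ?thesis using integrable_completion[OF m] by simp
  qed
  have v0i: "integrable lborel v0" using transfer[of "\<lambda>_. 1"] u0_L1 by simp
  have mom: "integrable lborel (\<lambda>y. norm y * \<bar>v0 y\<bar>)"
  proof (rule Bochner_Integration.integrable_bound)
    show "integrable lborel (\<lambda>y. \<Sum>b\<in>Basis. \<bar>(y \<bullet> b) * v0 y\<bar>)"
      using u0_L11 by (intro Bochner_Integration.integrable_sum integrable_abs transfer) auto
    show "AE y in lborel. norm (norm y * \<bar>v0 y\<bar>) \<le> norm (\<Sum>b\<in>Basis. \<bar>(y \<bullet> b) * v0 y\<bar>)"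
    proof (rule AE_I2)
      fix y :: 'a
      have "norm y * \<bar>v0 y\<bar> \<le> (\<Sum>b\<in>Basis. \<bar>y \<bullet> b\<bar>) * \<bar>v0 y\<bar>" by (intro mult_right_mono norm_le_l1) auto
      also have "\<dots> = (\<Sum>b\<in>Basis. \<bar>(y \<bullet> b) * v0 y\<bar>)" by (simp add: sum_distrib_right abs_mult)
      finally show "norm (norm y * \<bar>v0 y\<bar>) \<le> norm (\<Sum>b\<in>Basis. \<bar>(y \<bullet> b) * v0 y\<bar>)" by simp
    qed
  qed measurable
  define M0 where "M0 = max \<bar>K\<bar> (LINT x|lborel. \<bar>v0 x\<bar>)"
  have v0L: "L1Linf v0 M0 M0"
  proof (rule L1LinfI[OF v0i])
    show "\<bar>v0 x\<bar> \<le> M0" for x unfolding M0_def v0_def by linarith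
  qed (simp add: M0_def)
  have mass: "mass0 u0 = (LINT y|lborel. v0 y)"
  proof -
    have "mass0 u0 = (LINT y|lebesgue. v0 y)"
      unfolding mass0_def using u0v0 by (intro integral_cong_AE) (use u0_Linf(1) in \<open>auto intro!: borel_measurable_lebesgueI\<close>)
    thus ?thesis using integral_completion[of v0 lborel] by simp
  qed
  obtain v M where v: "(\<lambda>(t,x). v t x) \<in> borel_measurable (borel \<Otimes>\<^sub>M borel)"
    "\<And>t. 0 < t \<Longrightarrow> AE x in lebesgue. u t x = v t x"
    "\<And>t. 0 < t \<Longrightarrow> L1Linf (v t) M M"
    "\<And>t x. 0 < t \<Longrightarrow> v t x = convol (gauss t) v0 x + duhamel a (\<lambda>s y. f (v s y)) t x"
    using mild_solution_representative[OF f_cont f_0 lip L p_gt1 v0L u0_Linf(1) u0v0 sol] by blast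
  interpret mild_solution a f L p M M0 v0 v
    by unfold_locales (use f_cont f_0 lip L p_gt1 v0L v in auto)
  have \<sigma>0: "\<sigma> > 0" using p_lo n unfolding \<sigma>_def by (simp add: field_simps)
  \<comment> \<open>The upper bound on p reads (p - 1) k n < k + 1, which is k \<sigma> < 1/2 after
    inserting \<sigma>.\<close>
  have k\<sigma>: "real k * \<sigma> < 1 / 2"
  proof -
    have "(p - 1) * (real k * n) < real k + 1" using p_hi k_pos n by (simp add: field_simps)
    thus ?thesis unfolding \<sigma>_def by (simp add: algebra_simps)
  qed
  have "1 * \<sigma> \<le> real k * \<sigma>" using k_pos \<sigma>0 by (intro mult_right_mono) auto
  hence \<sigma>2: "\<sigma> < 1 / 2" using k\<sigma> by simp
  define \<rho> where "\<rho> = rate ((real k + 1) * \<sigma>)"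
  obtain C where C: "C > 0" and CL: "\<And>t. t > 1 \<Longrightarrow> L1Linf (\<lambda>x. v t x - profile a f u0 k t x) (C * \<rho> t) (t powr (- (n / 2)) * (C * \<rho> t))"
    using profile_expansion[OF p_lo[unfolded n_def] mom mass \<sigma>_def[unfolded n_def, THEN meta_eq_to_obj_eq] k\<sigma> \<sigma>2]
    unfolding \<rho>_def n_def by blast
  show ?thesis
  proof (intro allI impI exI[of _ C] conjI C)
    fix q :: ereal and t :: real assume q: "1 \<le> q" and t: "2 ^ k < t"
    have "(1::real) \<le> 2 ^ k" by simp
    hence t1: "t > 1" using t by linarith
    have t0: "t > 0" using t1 by simp
    have R: "C * \<rho> t > 0" unfolding \<rho>_def using C rate_pos[OF t1] by simp
    have cp: "t powr (- (n / 2)) > 0" using t0 by simp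
    have um: "u t \<in> borel_measurable lebesgue" using sol t0 unfolding is_global_solution_def by blast
    have "v t \<in> borel_measurable borel" by (rule L1LinfD(1)[OF v(3)[OF t0]])
    hence pm: "profile a f u0 k t \<in> borel_measurable borel"
      using borel_measurable_diff[OF _ L1LinfD(1)[OF CL[OF t1]], of "v t"] by simp
    have hm: "(\<lambda>x. u t x - profile a f u0 k t x) \<in> borel_measurable lebesgue"
      using um borel_measurable_lebesgueI[OF pm] by simp
    have "Lnorm q (\<lambda>x. u t x - profile a f u0 k t x) \<le> ereal ((t powr (- (n / 2))) powr (1 - qinv q) * (C * \<rho> t))"
    proof (rule Lnorm_interpolation[OF CL[OF t1] R cp hm _ q])
      show "AE x in lebesgue. u t x - profile a f u0 k t x = v t x - profile a f u0 k t x"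
        using v(2)[OF t0] by eventually_elim simp
    qed
    hence "ereal (t powr (n / 2 * (1 - qinv q))) * Lnorm q (\<lambda>x. u t x - profile a f u0 k t x)
        \<le> ereal (t powr (n / 2 * (1 - qinv q))) * ereal ((t powr (- (n / 2))) powr (1 - qinv q) * (C * \<rho> t))"
      by (intro ereal_mult_left_mono) auto
    also have "\<dots> = ereal (C * \<rho> t)"
    proof -
      \<comment> \<open>The interpolation weight cancels the prefactor for every q, so a single C
        serves all exponents.\<close>
      have "t powr (n / 2 * (1 - qinv q)) * (t powr (- (n / 2))) powr (1 - qinv q) = 1"
        using t0 by (simp add: powr_powr powr_add[symmetric])
      hence "t powr (n / 2 * (1 - qinv q)) * ((t powr (- (n / 2))) powr (1 - qinv q) * (C * \<rho> t)) = C * \<rho> t"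
        by (metis mult.assoc mult_1)
      thus ?thesis by simp
    qed
    also have "C * \<rho> t = (if (real k + 1) * \<sigma> < 1 / 2 then C * t powr (- (real k + 1) * \<sigma>)
                    else if (real k + 1) * \<sigma> = 1 / 2 then C * t powr (- 1 / 2) * ln (2 + t)
                    else C * t powr (- 1 / 2))"
    proof -
      have "- ((real k + 1) * \<sigma>) = - (real k + 1) * \<sigma>" by (rule minus_mult_left)
      thus ?thesis unfolding \<rho>_def rate_def by (simp only: mult.assoc if_distrib[of "\<lambda>z. C * z"])
    qed
    finally show "ereal (t powr (n / 2 * (1 - qinv q))) * Lnorm q (\<lambda>x. u t x - profile a f u0 k t x)
           \<le> ereal (if (real k + 1) * \<sigma> < 1 / 2 then C * t powr (- (real k + 1) * \<sigma>)
                    else if (real k + 1) * \<sigma> = 1 / 2 then C * t powr (- 1 / 2) * ln (2 + t)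
                    else C * t powr (- 1 / 2))" .
  qed
qed

end
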